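(* Let $(\mathcal{A}, \varphi)$ be a non-commutative probability space and let $a, b \in \mathcal{A}$ be such that $\varphi(a) = \varphi(b) = \lambda$ and $\mathrm{var}(a) = \mathrm{var}(b) = \sigma^2 \neq 0$. Let \[ \delta^2 = \mathrm{var}(a\otimes a) = \mathrm{var}(b\otimes b) = \sigma^2(\sigma^2 + 2\lambda^2) \] and \[ q = \frac{2\lambda^2}{\sigma^2 + 2 \lambda^2} \in [0,1). \] Let $(a_k)_{k\geq 1}$ be a sequence of freely independent copies of $a$ in $(\mathcal{A}, \varphi)$ and let $(b_k)_{k\geq 1}$ be a sequence of freely independent copies of $b$ in $(\mathcal{A}, \varphi)$. Let \[ S_n = \frac{1}{\delta \sqrt{n}} \sum_{k=1}^n (a_k \otimes b_k - \lambda 1 \otimes \lambda 1) \in \mathcal{A} \otimes \mathcal{A}. \] Then the sequence $(S_n)_{n\geq 1}$ converges in distribution, with respect to $\varphi \otimes \varphi$, to \[ \mu_q = \sqrt{q}\left(\tfrac{1}{\sqrt{2}} \mu_{sc} \oplus \tfrac{1}{\sqrt{2}} \mu_{sc}\right) \boxplus \sqrt{1-q}\, \mu_{sc}. \]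
   Context: A non-commutative probability space is a pair $(\mathcal{A},\varphi)$ where $\mathcal{A}$ is a unital C$^*$-algebra and $\varphi:\mathcal{A}\to\mathbb{C}$ is a unital positive linear map (not assumed tracial). $\varphi\otimes\varphi$ is the product state on $\mathcal{A}\otimes\mathcal{A}$. The variance $\mathrm{var}(x)$ is the second moment minus the square of the first moment, i.e. $\varphi(x^2)-\varphi(x)^2$ for $x\in\mathcal{A}$, and the same expression with $\varphi\otimes\varphi$ for $x\in\mathcal{A}\otimes\mathcal{A}$. "Freely independent copies of $a$" means elements $a_1,a_2,\dots$ of $\mathcal{A}$ that are freely independent with respect to $\varphi$ and each have the same distribution as $a$. No relation between the sequences $(a_k)$ and $(b_k)$ is assumed. Convergence in distribution to $\mu_q$ means convergence of moments: for every $m\in\mathbb{N}$, $\lim_{n\to\infty}(\varphi\otimes\varphi)(S_n^m)=\int_{\mathbb{R}} x^m\,d\mu_q(x)$. $\mu_{sc}$ is the centred semicircular distribution with variance $1$. For $t>0$ and a probability measure $\mu$ on $\mathbb{R}$, $t\mu$ denotes the dilation $(t\mu)(A)=\mu(t^{-1}A)$ for Borel $A\subseteq\mathbb{R}$, i.e. the distribution of $tx$ if $x$ has distribution $\mu$ (for $t=0$ this is the point mass at $0$). $\oplus$ denotes the distribution of the sum of classically independent random variables with the given distributions (classical convolution), and $\boxplus$ denotes the distribution of the sum of freely independent random variables with the given distributions (free additive convolution). *)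

theory Defs
  imports "HOL-Probability.Probability"
begin

section \<open>Complex star-algebras, C*-algebras and states\<close>

text \<open>All algebras are over the complex numbers, associative and unital; via \<^class>\<open>ring_1\<close> they
  are moreover non-zero, which the existence of a unital functional forces anyway.\<close>

class complex_algebra_1 = ring_1 +
  fixes scaleC :: "complex \<Rightarrow> 'a \<Rightarrow> 'a"  (infixr \<open>*\<^sub>C\<close> 75)
  assumes scaleC_add_right: "c *\<^sub>C (x + y) = c *\<^sub>C x + c *\<^sub>C y"
    and scaleC_add_left: "(c + d) *\<^sub>C x = c *\<^sub>C x + d *\<^sub>C x"
    and scaleC_scaleC: "c *\<^sub>C d *\<^sub>C x = (c * d) *\<^sub>C x"
    and scaleC_one: "1 *\<^sub>C x = x"
    and mult_scaleC_left: "(c *\<^sub>C x) * y = c *\<^sub>C (x * y)"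
    and mult_scaleC_right: "x * (c *\<^sub>C y) = c *\<^sub>C (x * y)"

class complex_star_algebra_1 = complex_algebra_1 +
  fixes star :: "'a \<Rightarrow> 'a"
  assumes star_star: "star (star x) = x"
    and star_add: "star (x + y) = star x + star y"
    and star_scaleC: "star (c *\<^sub>C x) = cnj c *\<^sub>C star x"
    and star_mult: "star (x * y) = star y * star x"

class unital_cstar_algebra = complex_star_algebra_1 + real_normed_algebra_1 + banach +
  assumes scaleR_scaleC: "r *\<^sub>R x = complex_of_real r *\<^sub>C x"
    and norm_scaleC: "norm (c *\<^sub>C x) = cmod c * norm x"
    and cstar_identity: "norm (star x * x) = (norm x)\<^sup>2"

definition clinear :: "('a::complex_algebra_1 \<Rightarrow> 'b::complex_algebra_1) \<Rightarrow> bool" where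
  "clinear f \<longleftrightarrow> (\<forall>x y. f (x + y) = f x + f y) \<and> (\<forall>c x. f (c *\<^sub>C x) = c *\<^sub>C f x)"

definition cbilinear ::
  "('a::complex_algebra_1 \<Rightarrow> 'b::complex_algebra_1 \<Rightarrow> 'c::complex_algebra_1) \<Rightarrow> bool" where
  "cbilinear f \<longleftrightarrow> (\<forall>a. clinear (f a)) \<and> (\<forall>b. clinear (\<lambda>a. f a b))"

instantiation complex :: complex_algebra_1
begin
definition scaleC_complex :: "complex \<Rightarrow> complex \<Rightarrow> complex" where
  "scaleC_complex c x = c * x"
instance by standard (simp_all add: scaleC_complex_def algebra_simps)
end

definition state :: "('a::complex_star_algebra_1 \<Rightarrow> complex) \<Rightarrow> bool" where
  "state \<phi> \<longleftrightarrow> clinear \<phi> \<and> \<phi> 1 = 1 \<and> (\<forall>x. \<phi> (star x * x) \<in> \<real>\<^sub>\<ge>\<^sub>0)"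

definition var :: "('a::complex_algebra_1 \<Rightarrow> complex) \<Rightarrow> 'a \<Rightarrow> complex" where
  "var \<phi> x = \<phi> (x\<^sup>2) - (\<phi> x)\<^sup>2"

definition same_distribution :: "('a::complex_algebra_1 \<Rightarrow> complex) \<Rightarrow> 'a \<Rightarrow> 'a \<Rightarrow> bool" where
  "same_distribution \<phi> x y \<longleftrightarrow> (\<forall>m::nat. \<phi> (x ^ m) = \<phi> (y ^ m))"

text \<open>The distribution of a single element is its moment sequence; a measure represents it if it
  has these moments.\<close>

definition has_distribution :: "('a::complex_algebra_1 \<Rightarrow> complex) \<Rightarrow> 'a \<Rightarrow> real measure \<Rightarrow> bool" where
  "has_distribution \<phi> x \<mu> \<longleftrightarrow>
     (\<forall>m::nat. integrable \<mu> (\<lambda>t. t ^ m) \<and> \<phi> (x ^ m) = of_real (\<integral>t. t ^ m \<partial>\<mu>))"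

section \<open>Free independence\<close>

inductive_set generated_algebra :: "'a::complex_algebra_1 set \<Rightarrow> 'a set" for X where
  one: "1 \<in> generated_algebra X"
| base: "x \<in> X \<Longrightarrow> x \<in> generated_algebra X"
| add: "x \<in> generated_algebra X \<Longrightarrow> y \<in> generated_algebra X \<Longrightarrow> x + y \<in> generated_algebra X"
| scale: "x \<in> generated_algebra X \<Longrightarrow> c *\<^sub>C x \<in> generated_algebra X"
| mult: "x \<in> generated_algebra X \<Longrightarrow> y \<in> generated_algebra X \<Longrightarrow> x * y \<in> generated_algebra X"

text \<open>In the alternating product, neighbouring factors come from distinct algebras; non-neighbouring
  ones may come from the same algebra.\<close>

definition freely_independent ::
  "('a::complex_algebra_1 \<Rightarrow> complex) \<Rightarrow> 'i set \<Rightarrow> ('i \<Rightarrow> 'a) \<Rightarrow> bool" where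
  "freely_independent \<phi> I x \<longleftrightarrow>
     (\<forall>ks ps. ks \<noteq> [] \<longrightarrow> length ps = length ks \<longrightarrow> set ks \<subseteq> I \<longrightarrow> distinct_adj ks \<longrightarrow>
        (\<forall>j<length ks. ps ! j \<in> generated_algebra {x (ks ! j)} \<and> \<phi> (ps ! j) = 0) \<longrightarrow>
        \<phi> (prod_list ps) = 0)"

section \<open>The algebraic tensor product\<close>

text \<open>The tensor \<open>a\<^sub>1 \<otimes> b\<^sub>1 + \<dots> + a\<^sub>n \<otimes> b\<^sub>n\<close> is realised as the functional
  \<open>f \<mapsto> f a\<^sub>1 b\<^sub>1 + \<dots> + f a\<^sub>n b\<^sub>n\<close> on the space of bilinear forms; two formal sums of pairs are
  therefore the same tensor iff no bilinear form separates them. The value on functions that are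
  not bilinear is set to 0. The universal property is proved below
  (\<open>tensor_universal\<close>).\<close>

definition eval_pairs ::
  "('a \<times> 'b) list \<Rightarrow> ('a::complex_algebra_1 \<Rightarrow> 'b::complex_algebra_1 \<Rightarrow> complex) \<Rightarrow> complex" where
  "eval_pairs l f = (if cbilinear f then \<Sum>(a, b)\<leftarrow>l. f a b else 0)"

typedef (overloaded) ('a, 'b) tensor =
  "range (eval_pairs :: ('a::complex_algebra_1 \<times> 'b::complex_algebra_1) list \<Rightarrow> _)"
  morphisms tensor_eval Abs_tensor by auto

setup_lifting type_definition_tensor

lemma clinear_simps:
  assumes "clinear f"
  shows "f (x + y) = f x + f y" "f (c *\<^sub>C x) = c *\<^sub>C f x" "f 0 = 0" "f (- x) = - f x"
proof -
  show 1: "f (x + y) = f x + f y" for x y using assms by (simp add: clinear_def)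
  show "f (c *\<^sub>C x) = c *\<^sub>C f x" using assms by (simp add: clinear_def)
  show 0: "f 0 = 0" using 1[of 0 0] by simp
  show "f (- x) = - f x" using 1[of x "- x"] 0 by (simp add: eq_neg_iff_add_eq_0 add.commute)
qed

lemma cbilinearD: "cbilinear f \<Longrightarrow> clinear (f a)" "cbilinear f \<Longrightarrow> clinear (\<lambda>a. f a b)"
  by (simp_all add: cbilinear_def)

lemma cbilinear_simps:
  assumes "cbilinear f"
  shows "f (x + x') y = f x y + f x' y" "f x (y + y') = f x y + f x y'"
    "f (c *\<^sub>C x) y = c *\<^sub>C f x y" "f x (c *\<^sub>C y) = c *\<^sub>C f x y"
    "f (- x) y = - f x y" "f 0 y = 0" "f x 0 = 0"
  using clinear_simps[OF cbilinearD(1)[OF assms]] clinear_simps[OF cbilinearD(2)[OF assms]]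
  by simp_all

lemma eval_pairs_append: "eval_pairs (l @ l') f = eval_pairs l f + eval_pairs l' f"
  by (simp add: eval_pairs_def)

lemma eval_pairs_scale: "eval_pairs (map (\<lambda>(a, b). (c *\<^sub>C a, b)) l) f = c * eval_pairs l f"
  by (induction l) (auto simp: eval_pairs_def cbilinear_simps scaleC_complex_def algebra_simps
      split: if_splits)

lemma eval_pairs_uminus: "eval_pairs (map (\<lambda>(a, b). (- a, b)) l) f = - eval_pairs l f"
  by (induction l) (auto simp: eval_pairs_def cbilinear_simps(5) split: if_splits)

lemma cbilinear_mult2: "cbilinear f \<Longrightarrow> cbilinear (\<lambda>c d. f (a * c) (b * d))"
  by (auto simp: cbilinear_def clinear_def distrib_left mult_scaleC_right)

lemma cbilinear_mult_right: "cbilinear f \<Longrightarrow> cbilinear (\<lambda>a b. f (a * c) (b * d))"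
  by (auto simp: cbilinear_def clinear_def distrib_right mult_scaleC_left)

lemma cbilinear_plus:
  "cbilinear f \<Longrightarrow> cbilinear g \<Longrightarrow> cbilinear (\<lambda>a b. f a b + g a b)"
  by (simp add: cbilinear_def clinear_def scaleC_add_right)

lemma cbilinear_eval_mult:
  assumes "cbilinear f"
  shows "cbilinear (\<lambda>a b. eval_pairs l (\<lambda>c d. f (a * c) (b * d)))"
proof -
  have "cbilinear (\<lambda>a b. \<Sum>(c, d)\<leftarrow>l. f (a * c) (b * d))"
  proof (induction l)
    case Nil
    show ?case by (simp add: cbilinear_def clinear_def scaleC_complex_def)
  next
    case (Cons p l)
    obtain c d where p: "p = (c, d)" by (cases p)
    from cbilinear_plus[OF cbilinear_mult_right[OF assms, of c d] Cons]
    show ?case by (simp add: p)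
  qed
  then show ?thesis by (simp add: eval_pairs_def cbilinear_mult2[OF assms])
qed

lemma eval_pairs_mult:
  "(if cbilinear f then eval_pairs l (\<lambda>a b. eval_pairs l' (\<lambda>c d. f (a * c) (b * d))) else 0) =
   eval_pairs [(a * c, b * d). (a, b) \<leftarrow> l, (c, d) \<leftarrow> l'] f"
proof (cases "cbilinear f")
  case True
  have "eval_pairs (map (\<lambda>(c, d). (a * c, b * d)) l') f = eval_pairs l' (\<lambda>c d. f (a * c) (b * d))"
    for a b using True by (auto simp: eval_pairs_def cbilinear_mult2 o_def case_prod_unfold)
  moreover have "eval_pairs l g = (\<Sum>(a, b)\<leftarrow>l. g a b)" if "cbilinear g" for g
    using that by (simp add: eval_pairs_def)
  note this[OF cbilinear_eval_mult[OF True, of l']]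
  moreover have "eval_pairs (concat (map h l)) f = (\<Sum>p\<leftarrow>l. eval_pairs (h p) f)" for h
    by (induction l) (simp_all add: eval_pairs_append, simp add: eval_pairs_def)
  ultimately show ?thesis using True by (simp add: case_prod_unfold)
qed (simp add: eval_pairs_def)

lemma eval_pairs_not_cbilinear: "\<not> cbilinear f \<Longrightarrow> eval_pairs l f = 0"
  by (simp add: eval_pairs_def)

lemma eval_pairs_single: "eval_pairs [(a, b)] f = (if cbilinear f then f a b else 0)"
  by (simp add: eval_pairs_def)

lemma eval_pairs_add:
  "cbilinear f \<Longrightarrow> cbilinear g \<Longrightarrow>
   eval_pairs l (\<lambda>a b. f a b + g a b) = eval_pairs l f + eval_pairs l g"
proof -
  assume fg: "cbilinear f" "cbilinear g"
  then have "cbilinear (\<lambda>a b. f a b + g a b)" by (rule cbilinear_plus)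
  with fg show ?thesis
    by (induction l) (auto simp: eval_pairs_def)
qed

lemma eval_pairs_cmult:
  "cbilinear f \<Longrightarrow> eval_pairs l (\<lambda>a b. c * f a b) = c * eval_pairs l f"
proof -
  assume f: "cbilinear f"
  then have "cbilinear (\<lambda>a b. c * f a b)"
    by (simp add: cbilinear_def clinear_def scaleC_complex_def algebra_simps)
  with f show ?thesis
    by (induction l) (auto simp: eval_pairs_def algebra_simps)
qed

lemma cbilinear_prod:
  "clinear h \<Longrightarrow> clinear k \<Longrightarrow> cbilinear (\<lambda>a b. h a * k b :: complex)"
  by (simp add: cbilinear_def clinear_def scaleC_complex_def algebra_simps)

lift_definition tensor :: "'a::complex_algebra_1 \<Rightarrow> 'b::complex_algebra_1 \<Rightarrow> ('a, 'b) tensor"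
    (infix \<open>\<otimes>\<^sub>t\<close> 72) is "\<lambda>a b. eval_pairs [(a, b)]"
  by simp

lemma exists_functional_one:
  assumes "(x::'a::complex_algebra_1) \<noteq> 0"
  shows "\<exists>h::'a \<Rightarrow> complex. clinear h \<and> h x = 1"
proof -
  interpret A: vector_space "scaleC :: complex \<Rightarrow> 'a \<Rightarrow> 'a"
    by standard (simp_all add: scaleC_add_right scaleC_add_left scaleC_scaleC scaleC_one)
  interpret C: vector_space "scaleC :: complex \<Rightarrow> complex \<Rightarrow> complex"
    by standard (simp_all add: scaleC_complex_def algebra_simps)
  interpret AC: vector_space_pair "scaleC :: complex \<Rightarrow> 'a \<Rightarrow> 'a"
    "scaleC :: complex \<Rightarrow> complex \<Rightarrow> complex" ..
  have "A.independent {x}" using assms by simp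
  from AC.linear_independent_extend[OF this, of "\<lambda>_. 1"]
  obtain h :: "'a \<Rightarrow> complex" where
    h: "Vector_Spaces.linear scaleC scaleC h" "h x = 1" by auto
  then interpret h: Vector_Spaces.linear "scaleC :: complex \<Rightarrow> 'a \<Rightarrow> 'a"
    "scaleC :: complex \<Rightarrow> complex \<Rightarrow> complex" h by simp
  have "clinear h" unfolding clinear_def using h.add h.scale by blast
  then show ?thesis using h(2) by blast
qed

text \<open>Multiplication is \<open>(a \<otimes> b) * (c \<otimes> d) = (a * c) \<otimes> (b * d)\<close>, extended bilinearly.\<close>

instantiation tensor :: (complex_algebra_1, complex_algebra_1) complex_algebra_1
begin

lift_definition zero_tensor :: "('a, 'b) tensor" is "\<lambda>_. 0"
  by (rule image_eqI[of _ _ "[]"]) (auto simp: eval_pairs_def)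

lift_definition one_tensor :: "('a, 'b) tensor" is "eval_pairs [(1, 1)]" by simp

lift_definition plus_tensor :: "('a, 'b) tensor \<Rightarrow> ('a, 'b) tensor \<Rightarrow> ('a, 'b) tensor"
  is "\<lambda>s t f. s f + t f"
  by (force simp: eval_pairs_append[symmetric])

lift_definition uminus_tensor :: "('a, 'b) tensor \<Rightarrow> ('a, 'b) tensor" is "\<lambda>s f. - s f"
  by (force simp: eval_pairs_uminus[symmetric])

definition minus_tensor :: "('a, 'b) tensor \<Rightarrow> ('a, 'b) tensor \<Rightarrow> ('a, 'b) tensor" where
  "minus_tensor s t = s + - t"

lift_definition scaleC_tensor :: "complex \<Rightarrow> ('a, 'b) tensor \<Rightarrow> ('a, 'b) tensor"
  is "\<lambda>c s f. c * s f"
  by (force simp: eval_pairs_scale[symmetric])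

lift_definition times_tensor :: "('a, 'b) tensor \<Rightarrow> ('a, 'b) tensor \<Rightarrow> ('a, 'b) tensor"
  is "\<lambda>s t f. if cbilinear f then s (\<lambda>a b. t (\<lambda>c d. f (a * c) (b * d))) else 0"
  by (auto simp: eval_pairs_mult)

lemma tensor_eval_pairs: obtains l where "tensor_eval t = eval_pairs l"
  using tensor_eval[of t] by auto

lemma tensor_eqI:
  assumes "\<And>f. cbilinear f \<Longrightarrow> tensor_eval s f = tensor_eval t f"
  shows "s = t"
proof -
  obtain l where l: "tensor_eval s = eval_pairs l" by (rule tensor_eval_pairs)
  obtain l' where l': "tensor_eval t = eval_pairs l'" by (rule tensor_eval_pairs)
  have "tensor_eval s f = tensor_eval t f" for f
    using assms[of f] by (cases "cbilinear f") (simp_all add: l l' eval_pairs_not_cbilinear)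
  then show ?thesis by (simp add: tensor_eval_inject[symmetric] fun_eq_iff)
qed

lemma tensor_eval_mult:
  "cbilinear f \<Longrightarrow>
   tensor_eval (s * t) f = tensor_eval s (\<lambda>a b. tensor_eval t (\<lambda>c d. f (a * c) (b * d)))"
  by (simp add: times_tensor.rep_eq)

lemma tensor_eval_add:
  "cbilinear f \<Longrightarrow> cbilinear g \<Longrightarrow>
   tensor_eval t (\<lambda>a b. f a b + g a b) = tensor_eval t f + tensor_eval t g"
  by (rule tensor_eval_pairs[of t]) (simp add: eval_pairs_add)

lemma tensor_eval_cmult:
  "cbilinear f \<Longrightarrow> tensor_eval t (\<lambda>a b. c * f a b) = c * tensor_eval t f"
  by (rule tensor_eval_pairs[of t]) (simp add: eval_pairs_cmult)

lemma cbilinear_tensor_eval: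
  "cbilinear f \<Longrightarrow> cbilinear (\<lambda>a b. tensor_eval t (\<lambda>c d. f (a * c) (b * d)))"
  by (rule tensor_eval_pairs[of t]) (simp add: cbilinear_eval_mult)

lemma tensor_eval_tensor: "cbilinear f \<Longrightarrow> tensor_eval (a \<otimes>\<^sub>t b) f = f a b"
  by (simp add: tensor.rep_eq eval_pairs_single)

lemma tensor_eval_one: "cbilinear f \<Longrightarrow> tensor_eval 1 f = f 1 1"
  by (simp add: one_tensor.rep_eq eval_pairs_single)

instance proof
  fix s t u :: "('a, 'b) tensor" and c d :: complex
  note linear_rules = plus_tensor.rep_eq zero_tensor.rep_eq uminus_tensor.rep_eq
    scaleC_tensor.rep_eq minus_tensor_def algebra_simps
  show "s + t + u = s + (t + u)" "s + t = t + s" "0 + s = s" "- s + s = 0" "s - t = s + - t"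
    "c *\<^sub>C (s + t) = c *\<^sub>C s + c *\<^sub>C t" "(c + d) *\<^sub>C s = c *\<^sub>C s + d *\<^sub>C s"
    "c *\<^sub>C d *\<^sub>C s = (c * d) *\<^sub>C s" "1 *\<^sub>C s = s"
    by (rule tensor_eqI, simp add: linear_rules)+
  show "s * t * u = s * (t * u)"
  proof (rule tensor_eqI)
    fix f :: "'a \<Rightarrow> 'b \<Rightarrow> complex" assume f: "cbilinear f"
    show "tensor_eval (s * t * u) f = tensor_eval (s * (t * u)) f"
      by (simp add: tensor_eval_mult f cbilinear_tensor_eval[OF f] cbilinear_mult2[OF f] mult.assoc)
  qed
  show "1 * s = s"
    by (rule tensor_eqI)
      (simp add: tensor_eval_mult tensor_eval_one[OF cbilinear_tensor_eval])
  show "s * 1 = s"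
    by (rule tensor_eqI) (simp add: tensor_eval_mult tensor_eval_one[OF cbilinear_mult2])
  show "(s + t) * u = s * u + t * u" "(c *\<^sub>C s) * t = c *\<^sub>C (s * t)"
    by (rule tensor_eqI, simp add: tensor_eval_mult plus_tensor.rep_eq scaleC_tensor.rep_eq)+
  show "s * (t + u) = s * t + s * u"
    by (rule tensor_eqI)
      (simp add: tensor_eval_mult plus_tensor.rep_eq
        tensor_eval_add[OF cbilinear_tensor_eval cbilinear_tensor_eval])
  show "s * (c *\<^sub>C t) = c *\<^sub>C (s * t)"
    by (rule tensor_eqI)
      (simp add: tensor_eval_mult scaleC_tensor.rep_eq tensor_eval_cmult[OF cbilinear_tensor_eval])
  obtain h :: "'a \<Rightarrow> complex" and k :: "'b \<Rightarrow> complex"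
    where hk: "clinear h" "h 1 = 1" "clinear k" "k 1 = 1"
    using exists_functional_one[of "1::'a"] exists_functional_one[of "1::'b"] by auto
  then have "tensor_eval (1 :: ('a, 'b) tensor) (\<lambda>a b. h a * k b) = 1"
    by (simp add: tensor_eval_one cbilinear_prod)
  moreover have "tensor_eval (0 :: ('a, 'b) tensor) (\<lambda>a b. h a * k b) = 0"
    by (simp add: zero_tensor.rep_eq)
  ultimately show "(0 :: ('a, 'b) tensor) \<noteq> 1" by (metis zero_neq_one)
qed

end

text \<open>The functional \<open>\<phi> \<otimes> \<psi>\<close>; it is the linear extension of \<open>a \<otimes> b \<mapsto> \<phi> a * \<psi> b\<close>
  (\<open>clinear_tensor_functional\<close>, \<open>tensor_functional_tensor\<close>).\<close>

definition tensor_functional ::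
  "('a::complex_algebra_1 \<Rightarrow> complex) \<Rightarrow> ('b::complex_algebra_1 \<Rightarrow> complex) \<Rightarrow> ('a, 'b) tensor \<Rightarrow> complex"
  where "tensor_functional \<phi> \<psi> t = tensor_eval t (\<lambda>a b. \<phi> a * \<psi> b)"

lemma clinear_tensor_functional: "clinear (tensor_functional \<phi> \<psi>)"
  by (simp add: clinear_def tensor_functional_def plus_tensor.rep_eq scaleC_tensor.rep_eq
      scaleC_complex_def)

lemma tensor_functional_tensor:
  "clinear \<phi> \<Longrightarrow> clinear \<psi> \<Longrightarrow> tensor_functional \<phi> \<psi> (a \<otimes>\<^sub>t b) = \<phi> a * \<psi> b"
  by (simp add: tensor_functional_def tensor_eval_tensor cbilinear_prod)

lemma one_tensor_eq: "1 = 1 \<otimes>\<^sub>t 1"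
  by transfer simp

lemma tensor_mult: "(a \<otimes>\<^sub>t b) * (c \<otimes>\<^sub>t d) = (a * c) \<otimes>\<^sub>t (b * d)"
  by (rule tensor_eqI)
    (simp add: tensor_eval_mult tensor_eval_tensor[OF cbilinear_mult2]
      tensor_eval_tensor cbilinear_mult_right)

lemma cbilinear_tensor: "cbilinear (\<otimes>\<^sub>t)"
  unfolding cbilinear_def clinear_def
  by (intro conjI allI; rule tensor_eqI;
      simp add: tensor_eval_tensor cbilinear_simps plus_tensor.rep_eq scaleC_tensor.rep_eq
        scaleC_complex_def)

lemma tensor_sum_list: "\<exists>l. t = (\<Sum>(a, b)\<leftarrow>l. a \<otimes>\<^sub>t b)"
proof -
  obtain l where l: "tensor_eval t = eval_pairs l" using tensor_eval[of t] by auto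
  have "tensor_eval (\<Sum>(a, b)\<leftarrow>l. a \<otimes>\<^sub>t b) = eval_pairs l" for l :: "('a \<times> 'b) list"
  proof (induction l)
    case Nil
    show ?case by (rule ext) (simp add: zero_tensor.rep_eq eval_pairs_def)
  next
    case (Cons p l)
    obtain a b where p: "p = (a, b)" by (cases p)
    show ?case
      by (rule ext) (simp add: p plus_tensor.rep_eq tensor.rep_eq Cons
          eval_pairs_append[of "[(a, b)]" l, simplified])
  qed
  from this[of l] l have "t = (\<Sum>(a, b)\<leftarrow>l. a \<otimes>\<^sub>t b)"
    by (simp add: tensor_eval_inject[symmetric])
  then show ?thesis by blast
qed

theorem tensor_universal:
  fixes B :: "'a::complex_algebra_1 \<Rightarrow> 'b::complex_algebra_1 \<Rightarrow> 'c::complex_algebra_1"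
  assumes B: "cbilinear B"
  shows "\<exists>!g. clinear g \<and> (\<forall>a b. g (a \<otimes>\<^sub>t b) = B a b)"
proof -
  let ?S = "\<lambda>l. \<Sum>(a, b)\<leftarrow>l. B a b"
  have wd: "?S l = ?S l'" if eq: "eval_pairs l = eval_pairs l'" for l l'
  proof (rule ccontr)
    assume "?S l \<noteq> ?S l'"
    then obtain h :: "'c \<Rightarrow> complex" where h: "clinear h" "h (?S l + - ?S l') = 1"
      using exists_functional_one[of "?S l - ?S l'"] by auto
    have "cbilinear (\<lambda>a b. h (B a b))"
      using B h by (simp add: cbilinear_def clinear_def)
    then have "eval_pairs l (\<lambda>a b. h (B a b)) = h (?S l)" for l
      by (induction l) (auto simp: eval_pairs_def clinear_simps(1,3)[OF h(1)])
    from this[of l] this[of l'] eq have "h (?S l) = h (?S l')" by simp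
    then have "h (?S l + - ?S l') = 0" by (simp only: clinear_simps(1,4)[OF h(1)] add.right_inverse)
    with h(2) show False by (simp only: zero_neq_one)
  qed
  define g where "g t = ?S (SOME l. tensor_eval t = eval_pairs l)" for t :: "('a, 'b) tensor"
  have g: "g t = ?S l" if "tensor_eval t = eval_pairs l" for t l
    unfolding g_def using someI[of "\<lambda>l. tensor_eval t = eval_pairs l", OF that]
    by (intro wd) (simp add: that[symmetric])
  have "clinear g"
    unfolding clinear_def
  proof (intro conjI allI)
    fix s t :: "('a, 'b) tensor" and c
    obtain l l' where l: "tensor_eval s = eval_pairs l" "tensor_eval t = eval_pairs l'"
      using tensor_eval[of s] tensor_eval[of t] by auto
    have "tensor_eval (s + t) = eval_pairs (l @ l')"
      by (auto simp: plus_tensor.rep_eq l eval_pairs_append)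
    then show "g (s + t) = g s + g t" using g l by simp
    have "tensor_eval (c *\<^sub>C s) = eval_pairs (map (\<lambda>(a, b). (c *\<^sub>C a, b)) l)"
      by (auto simp: scaleC_tensor.rep_eq l eval_pairs_scale)
    moreover have "?S (map (\<lambda>(a, b). (c *\<^sub>C a, b)) l) = c *\<^sub>C ?S l"
    proof (induction l)
      case Nil
      show ?case using scaleC_add_right[of c 0 "0::'c"] by simp
    next
      case (Cons p l)
      then show ?case by (cases p) (simp add: cbilinear_simps(3)[OF B] scaleC_add_right)
    qed
    ultimately show "g (c *\<^sub>C s) = c *\<^sub>C g s" using g l by simp
  qed
  moreover have g_tensor: "g (a \<otimes>\<^sub>t b) = B a b" for a b
    using g[of "a \<otimes>\<^sub>t b" "[(a, b)]"] by (simp add: tensor.rep_eq)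
  moreover have "g' = g" if "clinear g'" "\<forall>a b. g' (a \<otimes>\<^sub>t b) = B a b" for g'
  proof
    fix t :: "('a, 'b) tensor"
    have eq_sum: "f (\<Sum>(a, b)\<leftarrow>l. a \<otimes>\<^sub>t b) = ?S l" if "clinear f" "\<forall>a b. f (a \<otimes>\<^sub>t b) = B a b" for f l
      by (induction l) (auto simp: clinear_simps(1,3)[OF that(1)] that(2))
    obtain l where "t = (\<Sum>(a, b)\<leftarrow>l. a \<otimes>\<^sub>t b)" using tensor_sum_list by blast
    then show "g' t = g t"
      using eq_sum[of g' l] eq_sum[of g l] that \<open>clinear g\<close> g_tensor by simp
  qed
  ultimately show ?thesis by blast
qed

section \<open>Polynomials in non-commuting indeterminates\<close>

text \<open>Non-commutative polynomials with complex coefficients in indeterminates indexed by \<open>'i\<close>,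
  as finitely supported functions on words. The star operation makes the indeterminates
  self-adjoint, so states on this algebra are the joint distributions of families of
  self-adjoint variables.\<close>

typedef 'i ncpoly = "{f :: 'i list \<Rightarrow> complex. finite {w. f w \<noteq> 0}}"
  morphisms nc_coeff Abs_ncpoly
  by (rule exI[of _ "\<lambda>_. 0"]) simp

setup_lifting type_definition_ncpoly

lift_definition nc_var :: "'i \<Rightarrow> 'i ncpoly" is "\<lambda>i w. if w = [i] then 1 else 0"
  by simp

definition splits :: "'i list \<Rightarrow> ('i list \<times> 'i list) set" where
  "splits w = {(u, v). u @ v = w}"

lemma finite_splits: "finite (splits w)"
proof (rule finite_subset)
  show "splits w \<subseteq> (\<lambda>k. (take k w, drop k w)) ` {..length w}"
  proof
    fix p assume "p \<in> splits w"
    then have "p = (take (length (fst p)) w, drop (length (fst p)) w)" "length (fst p) \<le> length w"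
      by (auto simp: splits_def)
    then show "p \<in> (\<lambda>k. (take k w, drop k w)) ` {..length w}" by blast
  qed
qed simp

instantiation ncpoly :: (type) complex_star_algebra_1
begin

lift_definition zero_ncpoly :: "'a ncpoly" is "\<lambda>_. 0" by simp

lift_definition one_ncpoly :: "'a ncpoly" is "\<lambda>w. if w = [] then 1 else 0" by simp

lift_definition plus_ncpoly :: "'a ncpoly \<Rightarrow> 'a ncpoly \<Rightarrow> 'a ncpoly" is "\<lambda>f g w. f w + g w"
proof -
  fix f g :: "'a list \<Rightarrow> complex"
  assume "finite {w. f w \<noteq> 0}" "finite {w. g w \<noteq> 0}"
  then have "finite ({w. f w \<noteq> 0} \<union> {w. g w \<noteq> 0})" by simp
  then show "finite {w. f w + g w \<noteq> 0}"
    by (rule finite_subset[rotated]) auto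
qed

lift_definition uminus_ncpoly :: "'a ncpoly \<Rightarrow> 'a ncpoly" is "\<lambda>f w. - f w" by simp

lift_definition minus_ncpoly :: "'a ncpoly \<Rightarrow> 'a ncpoly \<Rightarrow> 'a ncpoly" is "\<lambda>f g w. f w - g w"
proof -
  fix f g :: "'a list \<Rightarrow> complex"
  assume "finite {w. f w \<noteq> 0}" "finite {w. g w \<noteq> 0}"
  then have "finite ({w. f w \<noteq> 0} \<union> {w. g w \<noteq> 0})" by simp
  then show "finite {w. f w - g w \<noteq> 0}"
    by (rule finite_subset[rotated]) auto
qed

lift_definition times_ncpoly :: "'a ncpoly \<Rightarrow> 'a ncpoly \<Rightarrow> 'a ncpoly"
  is "\<lambda>f g w. \<Sum>(u, v)\<in>splits w. f u * g v"
proof -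
  fix f g :: "'a list \<Rightarrow> complex"
  assume "finite {w. f w \<noteq> 0}" "finite {w. g w \<noteq> 0}"
  then have "finite ((\<lambda>(u, v). u @ v) ` ({w. f w \<noteq> 0} \<times> {w. g w \<noteq> 0}))" by blast
  moreover have "{w. (\<Sum>(u, v)\<in>splits w. f u * g v) \<noteq> 0}
      \<subseteq> (\<lambda>(u, v). u @ v) ` ({w. f w \<noteq> 0} \<times> {w. g w \<noteq> 0})"
  proof
    fix w assume "w \<in> {w. (\<Sum>(u, v)\<in>splits w. f u * g v) \<noteq> 0}"
    then obtain p where "p \<in> splits w" "(case p of (u, v) \<Rightarrow> f u * g v) \<noteq> 0"
      using sum.not_neutral_contains_not_neutral by blast
    then show "w \<in> (\<lambda>(u, v). u @ v) ` ({w. f w \<noteq> 0} \<times> {w. g w \<noteq> 0})"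
      by (force simp: splits_def)
  qed
  ultimately show "finite {w. (\<Sum>(u, v)\<in>splits w. f u * g v) \<noteq> 0}" by (rule finite_subset[rotated])
qed

lift_definition scaleC_ncpoly :: "complex \<Rightarrow> 'a ncpoly \<Rightarrow> 'a ncpoly" is "\<lambda>c f w. c * f w"
  by (erule finite_subset[rotated]) auto

lift_definition star_ncpoly :: "'a ncpoly \<Rightarrow> 'a ncpoly" is "\<lambda>f w. cnj (f (rev w))"
proof -
  fix f :: "'a list \<Rightarrow> complex"
  assume "finite {w. f w \<noteq> 0}"
  then have "finite (rev ` {w. f w \<noteq> 0})" by simp
  then show "finite {w. cnj (f (rev w)) \<noteq> 0}"
    by (rule finite_subset[rotated]) (force simp: image_iff intro: exI[of _ "rev _"])
qed

instance proof
  fix f g h :: "'a ncpoly" and c d :: complex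
  show "f + g + h = f + (g + h)" "f + g = g + f" "0 + f = f" "- f + f = 0" "f - g = f + - g"
    "(0 :: 'a ncpoly) \<noteq> 1"
    by (transfer; auto simp: algebra_simps fun_eq_iff)+
  show "c *\<^sub>C (f + g) = c *\<^sub>C f + c *\<^sub>C g" "(c + d) *\<^sub>C f = c *\<^sub>C f + d *\<^sub>C f"
    "c *\<^sub>C d *\<^sub>C f = (c * d) *\<^sub>C f" "1 *\<^sub>C f = f"
    by (transfer; simp add: algebra_simps)+
  show "(f + g) * h = f * h + g * h" "f * (g + h) = f * g + f * h"
    "(c *\<^sub>C f) * g = c *\<^sub>C (f * g)" "f * (c *\<^sub>C g) = c *\<^sub>C (f * g)"
    by (transfer; simp add: algebra_simps sum.distrib sum_distrib_left case_prod_unfold)+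
  show "star (star f) = f" "star (f + g) = star f + star g" "star (c *\<^sub>C f) = cnj c *\<^sub>C star f"
    by (transfer; simp)+
  show "1 * f = f"
  proof (transfer, rule ext)
    fix f :: "'a list \<Rightarrow> complex" and w
    have "(\<Sum>(u, v)\<in>splits w. (if u = [] then 1 else 0) * f v)
        = (\<Sum>p\<in>splits w. if p = ([], w) then f w else 0)"
      by (rule sum.cong) (auto simp: splits_def split: if_splits)
    also have "\<dots> = f w" by (simp add: finite_splits) (simp add: splits_def)
    finally show "(\<Sum>(u, v)\<in>splits w. (if u = [] then 1 else 0) * f v) = f w" .
  qed
  show "f * 1 = f"
  proof (transfer, rule ext)
    fix f :: "'a list \<Rightarrow> complex" and w
    have "(\<Sum>(u, v)\<in>splits w. f u * (if v = [] then 1 else 0))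
        = (\<Sum>p\<in>splits w. if p = (w, []) then f w else 0)"
      by (rule sum.cong) (auto simp: splits_def split: if_splits)
    also have "\<dots> = f w" by (simp add: finite_splits) (simp add: splits_def)
    finally show "(\<Sum>(u, v)\<in>splits w. f u * (if v = [] then 1 else 0)) = f w" .
  qed
  show "f * g * h = f * (g * h)"
  proof (transfer, rule ext)
    fix f g h :: "'a list \<Rightarrow> complex" and w
    have "(\<Sum>(u, v)\<in>splits w. (\<Sum>(a, b)\<in>splits u. f a * g b) * h v)
        = (\<Sum>p\<in>splits w. \<Sum>q\<in>splits (fst p). f (fst q) * g (snd q) * h (snd p))"
      by (simp add: case_prod_unfold sum_distrib_right)
    also have "\<dots> = (\<Sum>x\<in>(SIGMA p:splits w. splits (fst p)).
        f (fst (snd x)) * g (snd (snd x)) * h (snd (fst x)))"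
      by (subst sum.Sigma) (auto simp: finite_splits case_prod_unfold)
    also have "\<dots> = (\<Sum>x\<in>(SIGMA p:splits w. splits (snd p)).
        f (fst (fst x)) * (g (fst (snd x)) * h (snd (snd x))))"
      by (rule sum.reindex_bij_witness[where
            i = "\<lambda>((a, u), (b, v)). ((a @ b, v), (a, b))" and
            j = "\<lambda>((u, v), (a, b)). ((a, b @ v), (b, v))"])
        (auto simp: splits_def mult.assoc)
    also have "\<dots> = (\<Sum>p\<in>splits w. \<Sum>q\<in>splits (snd p). f (fst p) * (g (fst q) * h (snd q)))"
      by (subst sum.Sigma) (auto simp: finite_splits case_prod_unfold)
    also have "\<dots> = (\<Sum>(u, v)\<in>splits w. f u * (\<Sum>(a, b)\<in>splits v. g a * h b))"
      by (simp add: case_prod_unfold sum_distrib_left)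
    finally show "(\<Sum>(u, v)\<in>splits w. (\<Sum>(a, b)\<in>splits u. f a * g b) * h v)
        = (\<Sum>(u, v)\<in>splits w. f u * (\<Sum>(a, b)\<in>splits v. g a * h b))" .
  qed
  show "star (f * g) = star g * star f"
  proof (transfer, rule ext)
    fix f g :: "'a list \<Rightarrow> complex" and w
    show "cnj (\<Sum>(u, v)\<in>splits (rev w). f u * g v)
        = (\<Sum>(u, v)\<in>splits w. cnj (g (rev u)) * cnj (f (rev v)))"
      unfolding cnj_sum
      by (rule sum.reindex_bij_witness[where i = "\<lambda>(u, v). (rev v, rev u)" and
            j = "\<lambda>(u, v). (rev v, rev u)"])
        (auto simp: splits_def rev_append[symmetric] rev_swap simp del: rev_append)
  qed
qed

end

section \<open>Measures on the real line\<close>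

definition dilation :: "real \<Rightarrow> real measure \<Rightarrow> real measure" where
  "dilation t \<mu> = distr \<mu> borel (\<lambda>x. t * x)"

definition semicircle :: "real measure" where
  "semicircle = density lborel (\<lambda>x. ennreal (indicator {-2..2} x * sqrt (4 - x\<^sup>2) / (2 * pi)))"

text \<open>The law of \<open>x + y\<close> for freely independent self-adjoint \<open>x\<close>, \<open>y\<close> with laws \<open>\<mu>\<close>, \<open>\<nu>\<close> (for
  compactly supported \<open>\<mu>\<close>, \<open>\<nu>\<close>). The joint distribution of any such pair \<open>(x, y)\<close> in any
  non-commutative probability space is a state on the polynomials in two indeterminates, so it
  suffices to let the two indeterminates play the role of \<open>x\<close> and \<open>y\<close>. Compact support makes
  \<open>\<rho>\<close> unique.\<close>

definition free_convolution :: "real measure \<Rightarrow> real measure \<Rightarrow> real measure"  (infixl \<open>\<boxplus>\<close> 65) where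
  "\<mu> \<boxplus> \<nu> = (THE \<rho>. real_distribution \<rho> \<and> (\<exists>K. AE t in \<rho>. \<bar>t\<bar> \<le> K) \<and>
     (\<exists>\<psi> :: bool ncpoly \<Rightarrow> complex. state \<psi> \<and> freely_independent \<psi> UNIV nc_var \<and>
        has_distribution \<psi> (nc_var False) \<mu> \<and> has_distribution \<psi> (nc_var True) \<nu> \<and>
        has_distribution \<psi> (nc_var False + nc_var True) \<rho>))"

definition mu_q :: "real \<Rightarrow> real measure" where
  "mu_q q = dilation (sqrt q)
      (convolution (dilation (1 / sqrt 2) semicircle) (dilation (1 / sqrt 2) semicircle))
    \<boxplus> dilation (sqrt (1 - q)) semicircle"

end

theory Submission
  imports Defs
begin

text \<open>Centring \<open>c\<^sub>k = a\<^sub>k \<otimes> b\<^sub>k - \<lambda>\<^sup>2\<close> with \<open>a\<^sub>k = \<lambda> + a\<^sub>k\<degree>\<close>, \<open>b\<^sub>k = \<lambda> + b\<^sub>k\<degree>\<close> gives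
  \<open>c\<^sub>k = a\<^sub>k\<degree> \<otimes> b\<^sub>k\<degree> + \<lambda> a\<^sub>k\<degree> \<otimes> 1 + \<lambda> 1 \<otimes> b\<^sub>k\<degree>\<close>. Expanding the \<open>m\<close>-th power of the sum, words
  in which some index occurs once contribute nothing by freeness, and words with too few indices are
  negligible, as the joint moments of a free family depend only on the pattern of the indices.
  In the remaining words every index occurs twice, and freeness lets a word survive iff each tensor
  leg reduces to the empty word in a free product of copies of \<open>\<int>/2\<close>. Read from right to left, such
  a word either opens a pair with a fresh index or closes an open pair, so up to the choice of the
  indices it is a closed path on the words in letters \<open>A, B, C\<close> modulo \<open>A B = B A\<close>. Hence the limit
  is the vacuum moment of the sum of the weighted adjacency operators of \<open>A\<close>, \<open>B\<close> and \<open>C\<close>.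

  In this Fock space the operators of \<open>A\<close> and \<open>B\<close> are commuting, independent semicircular
  elements, and the operator of \<open>C\<close> is semicircular and free from both. The vacuum state therefore
  realises the free convolution \<open>\<mu>\<^sub>q\<close>, once the spectral measure of the bounded symmetric sum is
  obtained from the Hausdorff moment problem; it is unique because compactly supported measures are
  determined by their moments and a free family by its marginals.\<close>

section \<open>Moments of free families\<close>

text \<open>A letter \<open>A\<close> lives in the first tensor leg, \<open>B\<close> in the second,
  \<open>C\<close> in both. An open \<open>C\<close> lies on top of both legs and blocks all older
  letters, which makes it free from \<open>A\<close> and \<open>B\<close>; these two sit in
  different legs and never block each other. This is why the same basis vectors describe the
  surviving words and the Fock space.

  A pair of letters \<open>C\<close> contributes \<open>\<sigma>^4\<close>, a pair of
  \<open>A\<close> or of \<open>B\<close> contributes \<open>\<lambda>^2 \<sigma>^2\<close>. Divided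
  by \<open>\<delta>^2\<close> these become \<open>1 - q\<close> and \<open>q / 2\<close>, whose
  square roots are the coefficients in \<open>mu_q\<close>.

  Since \<open>\<boxplus>\<close> is a definite description over states, a moment of
  \<open>mu_q\<close> can only be computed once existence and uniqueness of the law are settled.
  Both the tensor moments and \<open>mu_q\<close> are therefore compared with vacuum moments of one
  operator. Discarding the negligible words requires a bound that is uniform in infinitely many
  indices; it comes from renaming indices, not from the norm of the algebra.\<close>

lemma scaleC_0_left [simp]: "0 *\<^sub>C (x::'a::complex_algebra_1) = 0"
proof -
  have "0 *\<^sub>C x + 0 *\<^sub>C x = 0 *\<^sub>C x"
    using scaleC_add_left[of 0 0 x] by simp
  then show ?thesis by simp
qed

lemma scaleC_0_right [simp]: "c *\<^sub>C (0::'a::complex_algebra_1) = 0"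
proof -
  have "c *\<^sub>C (0::'a) + c *\<^sub>C 0 = c *\<^sub>C 0"
    using scaleC_add_right[of c 0 "0::'a"] by simp
  then show ?thesis by simp
qed

lemma scaleC_minus_left: "(- c) *\<^sub>C (x::'a::complex_algebra_1) = - (c *\<^sub>C x)"
proof -
  have "(- c) *\<^sub>C x + c *\<^sub>C x = 0"
    using scaleC_add_left[of "- c" c x] by simp
  then show ?thesis by (simp add: eq_neg_iff_add_eq_0)
qed

lemma clinear_functional:
  fixes \<phi> :: "'a::complex_algebra_1 \<Rightarrow> complex"
  assumes "clinear \<phi>"
  shows "\<phi> (x + y) = \<phi> x + \<phi> y" "\<phi> (c *\<^sub>C x) = c * \<phi> x" "\<phi> 0 = 0" "\<phi> (- x) = - \<phi> x"
    "\<phi> (x - y) = \<phi> x - \<phi> y"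
  using clinear_simps[OF assms] clinear_simps(1)[OF assms, of x "- y"]
  by (simp_all add: scaleC_complex_def)

lemma clinear_sum:
  assumes "clinear \<phi>"
  shows "\<phi> (\<Sum>i\<in>A. f i) = (\<Sum>i\<in>A. \<phi> (f i) :: complex)"
  by (induction A rule: infinite_finite_induct) (simp_all add: clinear_functional[OF assms])

text \<open>Horner evaluation with complex coefficients at an element of a noncommutative
  algebra.\<close>

definition alg_poly :: "complex poly \<Rightarrow> 'a::complex_algebra_1 \<Rightarrow> 'a" where
  "alg_poly p x = fold_coeffs (\<lambda>c y. c *\<^sub>C 1 + x * y) p 0"

lemma alg_poly_0 [simp]: "alg_poly 0 x = 0"
  by (simp add: alg_poly_def)

lemma alg_poly_pCons [simp]: "alg_poly (pCons c p) x = c *\<^sub>C 1 + x * alg_poly p x"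
  by (cases "p = 0 \<and> c = 0") (auto simp: alg_poly_def)

lemma alg_poly_1 [simp]: "alg_poly 1 x = 1"
  by (simp add: one_pCons scaleC_one)

lemma alg_poly_add: "alg_poly (p + r) x = alg_poly p x + alg_poly r x"
  by (induction p r rule: poly_induct2) (simp_all add: scaleC_add_left algebra_simps)

lemma alg_poly_smult: "alg_poly (smult c p) x = c *\<^sub>C alg_poly p x"
  by (induction p)
    (simp_all add: scaleC_add_right scaleC_scaleC mult_scaleC_right)

lemma alg_poly_mult: "alg_poly (p * r) x = alg_poly p x * alg_poly r x"
  by (induction p)
    (simp_all add: alg_poly_add alg_poly_smult distrib_right mult_scaleC_left mult.assoc)

lemma alg_poly_uminus: "alg_poly (- p) x = - alg_poly p x"
  using alg_poly_smult[of "-1" p x] by (simp add: scaleC_minus_left scaleC_one)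

lemma alg_poly_diff: "alg_poly (p - r) x = alg_poly p x - alg_poly r x"
  using alg_poly_add[of p "- r" x] by (simp add: alg_poly_uminus)

lemma generated_algebra_zero: "0 \<in> generated_algebra X"
  using generated_algebra.scale[OF generated_algebra.one, of 0] by simp

lemma alg_poly_generated: "alg_poly p x \<in> generated_algebra {x}"
  by (induction p) (auto intro: generated_algebra.intros generated_algebra_zero)

text \<open>A single generator commutes with itself, so its unital algebra consists of polynomial
  values. Freeness thereby becomes a statement about words of polynomials.\<close>

lemma generated_algebra_singleton_obtain:
  assumes "y \<in> generated_algebra {x}"
  obtains p where "y = alg_poly p x"
proof -
  from assms have "\<exists>p. y = alg_poly p x"
  proof induction
    case one
    show ?case by (rule exI[of _ 1]) simp
  next
    case (base y)
    then show ?case by (intro exI[of _ "[:0, 1:]"]) (simp add: scaleC_one)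
  next
    case (add u v)
    then show ?case by (metis alg_poly_add)
  next
    case (scale u c)
    then show ?case by (metis alg_poly_smult)
  next
    case (mult u v)
    then show ?case by (metis alg_poly_mult)
  qed
  then show ?thesis using that by blast
qed

lemma functional_alg_poly_cong:
  fixes \<phi> :: "'a::complex_algebra_1 \<Rightarrow> complex" and \<phi>' :: "'b::complex_algebra_1 \<Rightarrow> complex"
  assumes lin: "clinear \<phi>" "clinear \<phi>'" and mom: "\<And>m::nat. \<phi> (x ^ m) = \<phi>' (y ^ m)"
  shows "\<phi> (alg_poly p x) = \<phi>' (alg_poly p y)"
proof -
  \<comment> \<open>The power \<open>x ^ j\<close> absorbs the factor \<open>x\<close> that each
    Horner step produces.\<close>
  have "\<phi> (x ^ j * alg_poly p x) = \<phi>' (y ^ j * alg_poly p y)" for j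
  proof (induction p arbitrary: j)
    case 0
    then show ?case using lin by (simp add: clinear_functional[OF lin(1)] clinear_functional[OF lin(2)])
  next
    case (pCons c p)
    have "\<phi> (x ^ j * alg_poly (pCons c p) x) = c * \<phi> (x ^ j) + \<phi> (x ^ Suc j * alg_poly p x)"
      using lin by (simp add: clinear_functional[OF lin(1)] clinear_functional[OF lin(2)] distrib_left mult_scaleC_right power_Suc2 mult.assoc
          del: power_Suc)
    moreover have "\<phi>' (y ^ j * alg_poly (pCons c p) y) = c * \<phi>' (y ^ j) + \<phi>' (y ^ Suc j * alg_poly p y)"
      using lin by (simp add: clinear_functional[OF lin(1)] clinear_functional[OF lin(2)] distrib_left mult_scaleC_right power_Suc2 mult.assoc
          del: power_Suc)
    ultimately show ?case using pCons.IH[of "Suc j"] mom by simp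
  qed
  from this[of 0] show ?thesis by simp
qed

section \<open>Reduction of words to alternating centred words\<close>

lemma not_distinct_adj_obtain:
  assumes "\<not> distinct_adj xs"
  obtains u i v where "xs = u @ i # i # v"
proof -
  have "\<exists>u i v. xs = u @ i # i # v"
    using assms
  proof (induction xs rule: induct_list012)
    case (3 x y zs)
    show ?case
    proof (cases "x = y")
      case True
      then show ?thesis by (intro exI[of _ "[]"]) auto
    next
      case False
      with 3 obtain u i v where "y # zs = u @ i # i # v" by auto
      then show ?thesis by (intro exI[of _ "x # u"]) auto
    qed
  qed simp_all
  then show ?thesis using that by blast
qed

text \<open>Every word of polynomials is reduced to alternating centred words by merging neighbours
  with equal index and by splitting off means; merging may create one new non-centred letter but
  shortens the word, hence the weight 2 of the length in the measure.\<close>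

lemma word_reduction_induct [case_names mean_centred reduced merge center]:
  fixes c :: "'i \<Rightarrow> complex poly \<Rightarrow> complex"
  assumes c: "\<And>i p. c i (p - [:c i p:]) = 0"
    and reduced: "\<And>l. distinct_adj (map fst l) \<Longrightarrow> (\<And>i p. (i, p) \<in> set l \<Longrightarrow> c i p = 0) \<Longrightarrow> P l"
    and merge: "\<And>u i p r v. P (u @ (i, p * r) # v) \<Longrightarrow> P (u @ (i, p) # (i, r) # v)"
    and center: "\<And>u i p v. c i p \<noteq> 0 \<Longrightarrow> P (u @ (i, p - [:c i p:]) # v) \<Longrightarrow> P (u @ v)
        \<Longrightarrow> P (u @ (i, p) # v)"
  shows "P l"
proof (induction l rule: measure_induct_rule
    [of "\<lambda>l. 2 * length l + length (filter (\<lambda>(i, p). c i p \<noteq> 0) l)"])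
  case (less l)
  consider (r) "distinct_adj (map fst l)" "\<And>i p. (i, p) \<in> set l \<Longrightarrow> c i p = 0"
    | (m) "\<not> distinct_adj (map fst l)"
    | (n) "\<exists>i p. (i, p) \<in> set l \<and> c i p \<noteq> 0" by blast
  then show ?case
  proof cases
    case r
    then show ?thesis by (rule reduced)
  next
    case m
    then obtain u i v where l: "map fst l = u @ i # i # v" by (rule not_distinct_adj_obtain)
    then obtain U p r V where "l = U @ (i, p) # (i, r) # V"
      by (auto simp: map_eq_append_conv map_eq_Cons_conv)
    moreover have "P (U @ (i, p * r) # V)"
      by (rule less) (auto simp: calculation)
    ultimately show ?thesis using merge by simp
  next
    case n
    then obtain i p U V where l: "l = U @ (i, p) # V" and n: "c i p \<noteq> 0"
      by (meson split_list)
    have "P (U @ (i, p - [:c i p:]) # V)" "P (U @ V)"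
      by (rule less; use n c in \<open>simp add: l\<close>)+
    then show ?thesis using center n l by blast
  qed
qed

definition poly_word :: "('i \<Rightarrow> 'a::complex_algebra_1) \<Rightarrow> ('i \<times> complex poly) list \<Rightarrow> 'a" where
  "poly_word x l = prod_list (map (\<lambda>(i, p). alg_poly p (x i)) l)"

lemma poly_word_simps [simp]:
  "poly_word x [] = 1"
  "poly_word x ((i, p) # l) = alg_poly p (x i) * poly_word x l"
  "poly_word x (l @ l') = poly_word x l * poly_word x l'"
  by (simp_all add: poly_word_def)

lemma poly_word_center:
  assumes "clinear \<phi>"
  shows "\<phi> (poly_word x (u @ (i, p) # v)) =
     \<phi> (poly_word x (u @ (i, p - [:c:]) # v)) + c * \<phi> (poly_word x (u @ v))"
  using assms
  by (simp add: alg_poly_diff clinear_functional[OF assms] distrib_left distrib_right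
      left_diff_distrib right_diff_distrib mult_scaleC_left mult_scaleC_right)

lemma freely_independent_poly_word:
  assumes "freely_independent \<phi> I x" "l \<noteq> []" "fst ` set l \<subseteq> I" "distinct_adj (map fst l)"
    and "\<And>i p. (i, p) \<in> set l \<Longrightarrow> \<phi> (alg_poly p (x i)) = 0"
  shows "\<phi> (poly_word x l) = 0"
proof -
  let ?ps = "map (\<lambda>(i, p). alg_poly p (x i)) l"
  have "\<forall>j<length (map fst l). ?ps ! j \<in> generated_algebra {x (map fst l ! j)} \<and> \<phi> (?ps ! j) = 0"
    using assms(5) by (auto simp: case_prod_unfold alg_poly_generated)
  with assms(1-4) show ?thesis
    unfolding freely_independent_def poly_word_def
    by (metis (no_types, lifting) Nil_is_map_conv length_map list.set_map)
qed

text \<open>The means that steer the reduction depend only on individual moments, so both words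
  reduce in the same way, and alternating centred words vanish on both sides. Applied with one
  functional it gives exchangeability, with two it gives uniqueness of the law of a free
  sum.\<close>

theorem free_joint_moments_unique:
  fixes \<phi> :: "'a::complex_algebra_1 \<Rightarrow> complex" and \<phi>' :: "'b::complex_algebra_1 \<Rightarrow> complex"
  assumes lin: "clinear \<phi>" "clinear \<phi>'" and one: "\<phi> 1 = 1" "\<phi>' 1 = 1"
    and free: "freely_independent \<phi> I x" "freely_independent \<phi>' I y"
    and mom: "\<And>i m. i \<in> I \<Longrightarrow> \<phi> (x i ^ m) = \<phi>' (y i ^ m)"
    and I: "fst ` set l \<subseteq> I"
  shows "\<phi> (poly_word x l) = \<phi>' (poly_word y l)"
proof -
  have eq: "\<phi> (alg_poly p (x i)) = \<phi>' (alg_poly p (y i))" if "i \<in> I" for i p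
    using functional_alg_poly_cong[OF lin, of "x i" "y i"] mom[OF that] by blast
  have "fst ` set l \<subseteq> I \<longrightarrow> \<phi> (poly_word x l) = \<phi>' (poly_word y l)"
  proof (induction l rule: word_reduction_induct[where c = "\<lambda>i p. \<phi> (alg_poly p (x i))"])
    case (mean_centred i p)
    show ?case using lin one by (simp add: alg_poly_diff clinear_functional[OF lin(1)] clinear_functional[OF lin(2)])
  next
    case (reduced l)
    show ?case
    proof (cases "l = []")
      case False
      show ?thesis
      proof
        assume l: "fst ` set l \<subseteq> I"
        have "\<phi> (poly_word x l) = 0"
          by (rule freely_independent_poly_word[OF free(1) False l]) (use reduced in auto)
        moreover have "\<phi>' (poly_word y l) = 0"
          by (rule freely_independent_poly_word[OF free(2) False l])
            (use reduced l eq in \<open>force+\<close>)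
        ultimately show "\<phi> (poly_word x l) = \<phi>' (poly_word y l)" by simp
      qed
    qed (simp add: one)
  next
    case (merge u i p r v)
    then show ?case by (simp add: alg_poly_mult mult.assoc)
  next
    case (center u i p v)
    show ?case
    proof
      assume "fst ` set (u @ (i, p) # v) \<subseteq> I"
      with center show "\<phi> (poly_word x (u @ (i, p) # v)) = \<phi>' (poly_word y (u @ (i, p) # v))"
        using poly_word_center[OF lin(1), of x u i p v "\<phi> (alg_poly p (x i))"]
          poly_word_center[OF lin(2), of y u i p v "\<phi> (alg_poly p (x i))"] by simp
    qed
  qed
  with I show ?thesis by blast
qed

text \<open>The reduction never touches the letter of \<open>i\<close>: it has no neighbour of equal
  index to merge with, and its mean is already \<open>0\<close>. Hence it survives, every terminal
  word is nonempty, and freeness annihilates it.\<close>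

theorem free_singleton_vanish:
  fixes \<phi> :: "'a::complex_algebra_1 \<Rightarrow> complex"
  assumes lin: "clinear \<phi>" and one: "\<phi> 1 = 1" and free: "freely_independent \<phi> I x"
    and "fst ` set l \<subseteq> I" "count_list (map fst l) i = 1"
    and "\<And>p. (i, p) \<in> set l \<Longrightarrow> \<phi> (alg_poly p (x i)) = 0"
  shows "\<phi> (poly_word x l) = 0"
proof -
  have "fst ` set l \<subseteq> I \<longrightarrow> count_list (map fst l) i = 1
      \<longrightarrow> (\<forall>p. (i, p) \<in> set l \<longrightarrow> \<phi> (alg_poly p (x i)) = 0) \<longrightarrow> \<phi> (poly_word x l) = 0"
  proof (induction l rule: word_reduction_induct[where c = "\<lambda>i p. \<phi> (alg_poly p (x i))"])
    case (mean_centred i p)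
    show ?case using one by (simp add: alg_poly_diff clinear_functional[OF lin])
  next
    case (reduced l)
    have "l \<noteq> []" if "count_list (map fst l) i = 1" using that by auto
    then show ?case
      using freely_independent_poly_word[OF free _ _ reduced(1), OF _ _ reduced(2)] by blast
  next
    case (merge u j r s v)
    show ?case
    proof (intro impI)
      assume *: "fst ` set (u @ (j, r) # (j, s) # v) \<subseteq> I"
        "count_list (map fst (u @ (j, r) # (j, s) # v)) i = 1"
        "\<forall>p. (i, p) \<in> set (u @ (j, r) # (j, s) # v) \<longrightarrow> \<phi> (alg_poly p (x i)) = 0"
      then have "j \<noteq> i" by auto
      with * have "\<phi> (poly_word x (u @ (j, r * s) # v)) = 0"
        by (intro merge[rule_format]) auto
      then show "\<phi> (poly_word x (u @ (j, r) # (j, s) # v)) = 0"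
        by (simp add: alg_poly_mult mult.assoc)
    qed
  next
    case (center u j r v)
    let ?c = "\<phi> (alg_poly r (x j))"
    show ?case
    proof (intro impI)
      assume *: "fst ` set (u @ (j, r) # v) \<subseteq> I" "count_list (map fst (u @ (j, r) # v)) i = 1"
        "\<forall>p. (i, p) \<in> set (u @ (j, r) # v) \<longrightarrow> \<phi> (alg_poly p (x i)) = 0"
      with center.hyps have "j \<noteq> i" by auto
      with * have "\<phi> (poly_word x (u @ (j, r - [:?c:]) # v)) = 0" "\<phi> (poly_word x (u @ v)) = 0"
        by (intro center.IH[rule_format]; auto)+
      then show "\<phi> (poly_word x (u @ (j, r) # v)) = 0"
        using poly_word_center[OF lin, of x u j r v ?c] by simp
    qed
  qed
  with assms show ?thesis by blast
qed

section \<open>Words in centred free variables\<close>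

definition centred_word :: "complex \<Rightarrow> ('i \<Rightarrow> 'a::complex_algebra_1) \<Rightarrow> 'i list \<Rightarrow> 'a" where
  "centred_word c x v = prod_list (map (\<lambda>i. x i - c *\<^sub>C 1) v)"

lemma centred_word_simps [simp]:
  "centred_word c x [] = 1"
  "centred_word c x (i # v) = (x i - c *\<^sub>C 1) * centred_word c x v"
  "centred_word c x (u @ v) = centred_word c x u * centred_word c x v"
  by (simp_all add: centred_word_def)

lemma centred_word_eq_poly_word:
  "centred_word c x v = poly_word x (map (\<lambda>i. (i, [:- c, 1:])) v)"
  by (induction v) (simp_all add: scaleC_minus_left scaleC_one)

text \<open>Reduction in the free product of copies of \<open>\<int>/2\<close>.\<close>

fun stack_reduce :: "'i list \<Rightarrow> 'i list" where
  "stack_reduce [] = []"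
| "stack_reduce (i # v) = (case stack_reduce v of [] \<Rightarrow> [i] | j # r \<Rightarrow> if i = j then r else i # j # r)"

lemma distinct_adj_stack_reduce: "distinct_adj (stack_reduce v)"
  by (induction v) (auto split: list.splits simp: distinct_adj_Cons)

lemma count_stack_reduce: "count_list (stack_reduce v) i \<le> count_list v i"
  by (induction v) (auto split: list.splits)

lemma set_stack_reduce: "set (stack_reduce v) \<subseteq> set v"
  by (induction v) (auto split: list.splits)

text \<open>A cancellation removes two equal letters, so a word not containing \<open>i\<close>
  cannot remove an \<open>i\<close> behind it. This makes an illegal closing irreparable.\<close>

lemma stack_reduce_persist:
  "i \<notin> set u \<Longrightarrow> i \<in> set (stack_reduce v) \<Longrightarrow> i \<in> set (stack_reduce (u @ v))"
  by (induction u) (auto split: list.splits)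

text \<open>The square of the centred variable is its mean \<open>s\<close> plus a centred
  remainder; in the word with the remainder \<open>i\<close> is a singleton, so that word
  vanishes.\<close>

lemma centred_word_pair:
  fixes \<phi> :: "'a::complex_algebra_1 \<Rightarrow> complex"
  assumes lin: "clinear \<phi>" and one: "\<phi> 1 = 1" and free: "freely_independent \<phi> I x"
    and I: "set (u @ i # v) \<subseteq> I" and i: "i \<notin> set u" "i \<notin> set v"
    and mean: "\<phi> (x i) = c" and var: "\<phi> (x i ^ 2) = s + c\<^sup>2"
  shows "\<phi> (centred_word c x (u @ i # i # v)) = s * \<phi> (centred_word c x (u @ v))"
proof -
  let ?w = "map (\<lambda>i. (i, [:- c, 1:]))" and ?p = "[:- c, 1:] * [:- c, 1:] :: complex poly"
  have e: "alg_poly ?p (x i) = x i ^ 2 - (2 * c) *\<^sub>C x i + c\<^sup>2 *\<^sub>C 1"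
    by (simp add: alg_poly_mult power2_eq_square algebra_simps scaleC_minus_left scaleC_one
        mult_scaleC_left mult_scaleC_right scaleC_add_left scaleC_add_right scaleC_scaleC mult_2)
  have "\<phi> (alg_poly ?p (x i)) = s"
    using one mean var unfolding e by (simp add: clinear_functional[OF lin] power2_eq_square)
  then have c: "\<phi> (alg_poly (?p - [:s:]) (x i)) = 0"
    using one by (simp add: alg_poly_diff clinear_functional[OF lin] del: mult_pCons_left mult_pCons_right)
  have "\<phi> (centred_word c x (u @ i # i # v)) = \<phi> (poly_word x (?w u @ (i, ?p) # ?w v))"
    unfolding centred_word_eq_poly_word by (simp add: alg_poly_mult mult.assoc del: mult_pCons_left mult_pCons_right)
  also have "\<dots> = \<phi> (poly_word x (?w u @ (i, ?p - [:s:]) # ?w v)) + s * \<phi> (poly_word x (?w u @ ?w v))"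
    by (rule poly_word_center[OF lin])
  also have "\<phi> (poly_word x (?w u @ (i, ?p - [:s:]) # ?w v)) = 0"
    by (rule free_singleton_vanish[OF lin one free, where i = i])
      (use I i c in \<open>auto simp: o_def count_list_0_iff\<close>)
  finally show ?thesis by (simp add: centred_word_eq_poly_word)
qed

lemma centred_word_moment:
  fixes \<phi> :: "'a::complex_algebra_1 \<Rightarrow> complex" and \<sigma> :: real
  assumes lin: "clinear \<phi>" and one: "\<phi> 1 = 1" and free: "freely_independent \<phi> I x"
    and v: "set v \<subseteq> I" "\<And>i. count_list v i \<le> 2"
    and mean: "\<And>i. i \<in> I \<Longrightarrow> \<phi> (x i) = c" and var: "\<And>i. i \<in> I \<Longrightarrow> \<phi> (x i ^ 2) = of_real (\<sigma>\<^sup>2) + c\<^sup>2"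
  shows "\<phi> (centred_word c x v) = (if stack_reduce v = [] then of_real \<sigma> ^ length v else 0)"
proof -
  \<comment> \<open>The suffix \<open>v\<close> is reduced inside a longer word, so the untouched
    prefix \<open>u\<close> is generalised. The length bound keeps the natural subtraction in the
    exponent exact.\<close>
  have *: "length (stack_reduce v) \<le> length v \<and> \<phi> (centred_word c x (u @ v)) =
     of_real \<sigma> ^ (length v - length (stack_reduce v)) * \<phi> (centred_word c x (u @ stack_reduce v))"
    if "set (u @ v) \<subseteq> I" "\<And>i. count_list (u @ v) i \<le> 2" for u
    using that
  proof (induction v arbitrary: u)
    case Nil
    then show ?case by simp
  next
    case (Cons i v)
    have IH: "length (stack_reduce v) \<le> length v" "\<phi> (centred_word c x (u @ i # v)) =
      of_real \<sigma> ^ (length v - length (stack_reduce v)) * \<phi> (centred_word c x (u @ i # stack_reduce v))"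
      using Cons.IH[of "u @ [i]"] Cons.prems by simp_all
    show ?case
    proof (cases "\<exists>r. stack_reduce v = i # r")
      case True
      then obtain r where r: "stack_reduce v = i # r" by blast
      \<comment> \<open>With at most two occurrences overall, a letter that meets its twin on top of
        the stack occurs nowhere else, as \<open>centred_word_pair\<close> requires.\<close>
      have cnt: "count_list u j + count_list (i # i # r) j \<le> 2" for j
        using Cons.prems(2)[of j] count_stack_reduce[of v j] r by auto
      have i: "i \<notin> set u" "i \<notin> set r"
        using cnt[of i] by (auto simp: count_list_0_iff[symmetric])
      have "set r \<subseteq> set v"
        using set_stack_reduce[of v] r by simp
      then have "set (u @ i # r) \<subseteq> I" using Cons.prems by auto
      from centred_word_pair[OF lin one free this i] mean var Cons.prems
      have "\<phi> (centred_word c x (u @ i # i # r)) = of_real (\<sigma>\<^sup>2) * \<phi> (centred_word c x (u @ r))"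
        by simp
      moreover have "of_real \<sigma> ^ (length v - Suc (length r)) * (of_real (\<sigma>\<^sup>2) :: complex) =
          of_real \<sigma> ^ (Suc (length v) - length r)"
      proof -
        have "Suc (length v) - length r = (length v - Suc (length r)) + 2" using IH(1) r by simp
        then show ?thesis by (simp only: power_add of_real_power)
      qed
      ultimately show ?thesis using IH r
        by (simp add: mult.assoc[symmetric] del: centred_word_simps)
    next
      case False
      then have "stack_reduce (i # v) = i # stack_reduce v"
        by (auto split: list.splits)
      then show ?thesis using IH by (simp del: stack_reduce.simps centred_word_simps)
    qed
  qed
  show ?thesis
  proof (cases "stack_reduce v = []")
    case True
    then show ?thesis using *[of "[]"] v one by simp
  next
    case False
    have "set (stack_reduce v) \<subseteq> I"
      using v(1) set_stack_reduce[of v] by blast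
    moreover have "\<phi> (alg_poly [:- c, 1:] (x i)) = 0" if "i \<in> I" for i
      using lin one mean[OF that] by (simp add: clinear_functional[OF lin] scaleC_minus_left scaleC_one)
    ultimately have "\<phi> (centred_word c x (stack_reduce v)) = 0"
      unfolding centred_word_eq_poly_word
      by (intro freely_independent_poly_word[OF free])
        (use False in \<open>auto simp: distinct_adj_stack_reduce o_def\<close>)
    then show ?thesis using *[of "[]"] v False by simp
  qed
qed

lemma centred_word_singleton:
  fixes \<phi> :: "'a::complex_algebra_1 \<Rightarrow> complex"
  assumes lin: "clinear \<phi>" and one: "\<phi> 1 = 1" and free: "freely_independent \<phi> I x"
    and v: "set v \<subseteq> I" "count_list v i = 1" and mean: "\<phi> (x i) = c"
  shows "\<phi> (centred_word c x v) = 0"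
proof -
  have "\<phi> (alg_poly [:- c, 1:] (x i)) = 0"
    using one mean by (simp add: clinear_functional[OF lin] scaleC_minus_left scaleC_one)
  then show ?thesis
    using v unfolding centred_word_eq_poly_word
    by (intro free_singleton_vanish[OF lin one free, where i = i]) (auto simp: o_def)
qed

section \<open>Reindexing and exchangeability\<close>

lemma freely_independent_reindex:
  assumes "freely_independent \<phi> J x" "inj_on \<pi> I" "\<pi> ` I \<subseteq> J"
  shows "freely_independent \<phi> I (x \<circ> \<pi>)"
  unfolding freely_independent_def
proof (intro allI impI)
  fix ks ps
  assume *: "ks \<noteq> []" "length ps = length ks" "set ks \<subseteq> I" "distinct_adj ks"
    "\<forall>j<length ks. ps ! j \<in> generated_algebra {(x \<circ> \<pi>) (ks ! j)} \<and> \<phi> (ps ! j) = 0"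
  have "distinct_adj (map \<pi> ks)"
    using *(3,4) assms(2)
    by (subst distinct_adj_map_iff) (auto intro: inj_on_subset)
  moreover have "set (map \<pi> ks) \<subseteq> J" using * assms by auto
  ultimately show "\<phi> (prod_list ps) = 0"
    using assms(1)[unfolded freely_independent_def, rule_format, of "map \<pi> ks" ps] * by simp
qed

lemma freely_independent_subset: "freely_independent \<phi> J x \<Longrightarrow> I \<subseteq> J \<Longrightarrow> freely_independent \<phi> I x"
  using freely_independent_reindex[of \<phi> J x id I] by simp

lemma centred_word_exchangeable:
  fixes \<phi> :: "'a::complex_algebra_1 \<Rightarrow> complex"
  assumes lin: "clinear \<phi>" and one: "\<phi> 1 = 1" and free: "freely_independent \<phi> J x"
    and same: "\<And>i j m. i \<in> J \<Longrightarrow> j \<in> J \<Longrightarrow> \<phi> (x i ^ m) = \<phi> (x j ^ m)"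
    and \<pi>: "inj_on \<pi> (set v)" "\<pi> ` set v \<subseteq> J" "set v \<subseteq> J"
  shows "\<phi> (centred_word c x (map \<pi> v)) = \<phi> (centred_word c x v)"
proof -
  have "centred_word c x (map \<pi> v) = centred_word c (x \<circ> \<pi>) v"
    by (simp add: centred_word_def o_def)
  moreover have "\<phi> (centred_word c (x \<circ> \<pi>) v) = \<phi> (centred_word c x v)"
    unfolding centred_word_eq_poly_word
    by (rule free_joint_moments_unique[OF lin lin one one freely_independent_reindex[OF free \<pi>(1,2)]
          freely_independent_subset[OF free \<pi>(3)]])
      (use \<pi> in \<open>auto intro!: same\<close>)
  ultimately show ?thesis by simp
qed

text \<open>A word of length at most \<open>m\<close> has at most \<open>m\<close> indices and can
  be renamed into \<open>{1..m}\<close> without changing its moment, so only finitely many values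
  occur. The sum of their norms serves as the bound.\<close>

lemma centred_word_bounded:
  fixes \<phi> :: "'a::complex_algebra_1 \<Rightarrow> complex" and x :: "nat \<Rightarrow> 'a"
  assumes lin: "clinear \<phi>" and one: "\<phi> 1 = 1" and free: "freely_independent \<phi> {1..} x"
    and same: "\<And>i j m. i \<ge> 1 \<Longrightarrow> j \<ge> 1 \<Longrightarrow> \<phi> (x i ^ m) = \<phi> (x j ^ m)"
  obtains K where "\<And>v. set v \<subseteq> {1..} \<Longrightarrow> length v \<le> m \<Longrightarrow> norm (\<phi> (centred_word c x v)) \<le> K"
proof -
  let ?V = "{v. set v \<subseteq> {1..m} \<and> length v \<le> m}"
  have fin: "finite ?V" by (rule finite_lists_length_le) simp
  have "norm (\<phi> (centred_word c x v)) \<le> (\<Sum>v\<in>?V. norm (\<phi> (centred_word c x v)))"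
    if v: "set v \<subseteq> {1..}" "length v \<le> m" for v
  proof -
    have "card (set v) \<le> card {1..m}" using v card_length[of v] by simp
    then obtain \<pi> where \<pi>: "inj_on \<pi> (set v)" "\<pi> ` set v \<subseteq> {1..m}"
      using inj_on_iff_card_le[of "set v" "{1..m}"] by auto
    have "\<phi> (centred_word c x (map \<pi> v)) = \<phi> (centred_word c x v)"
      by (rule centred_word_exchangeable[OF lin one free]; use \<pi> v in \<open>force intro: same\<close>)
    moreover have "map \<pi> v \<in> ?V" using \<pi> v by auto
    ultimately show ?thesis
      using member_le_sum[of "map \<pi> v" ?V "\<lambda>v. norm (\<phi> (centred_word c x v))"] fin by simp
  qed
  then show ?thesis using that by blast
qed

section \<open>Symmetric operators on finitely supported functions\<close>

text \<open>Vacuum moments involve only finitely many basis vectors, so the operators are studied on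
  this dense subspace of the square-summable functions, which they preserve.\<close>

definition fin_supp :: "('s \<Rightarrow> complex) \<Rightarrow> bool" where
  "fin_supp f \<longleftrightarrow> finite {s. f s \<noteq> 0}"

definition l2_inner :: "('s \<Rightarrow> complex) \<Rightarrow> ('s \<Rightarrow> complex) \<Rightarrow> complex" where
  "l2_inner f g = (\<Sum>\<^sub>\<infinity>s. cnj (f s) * g s)"

definition unit_vec :: "'s \<Rightarrow> 's \<Rightarrow> complex" where
  "unit_vec v s = (if s = v then 1 else 0)"

definition lin_op :: "(('s \<Rightarrow> complex) \<Rightarrow> 't \<Rightarrow> complex) \<Rightarrow> bool" where
  "lin_op T \<longleftrightarrow> (\<forall>f g. T (\<lambda>s. f s + g s) = (\<lambda>s. T f s + T g s)) \<and>
     (\<forall>c f. T (\<lambda>s. c * f s) = (\<lambda>s. c * T f s))"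

definition sym_op :: "(('s \<Rightarrow> complex) \<Rightarrow> 's \<Rightarrow> complex) \<Rightarrow> bool" where
  "sym_op T \<longleftrightarrow> lin_op T \<and> (\<forall>f. fin_supp f \<longrightarrow> fin_supp (T f)) \<and>
     (\<forall>f g. fin_supp f \<longrightarrow> fin_supp g \<longrightarrow> l2_inner (T f) g = l2_inner f (T g))"

lemma lin_opD:
  assumes "lin_op T"
  shows "T (\<lambda>s. f s + g s) = (\<lambda>s. T f s + T g s)" "T (\<lambda>s. c * f s) = (\<lambda>s. c * T f s)"
    "T (\<lambda>s. 0) = (\<lambda>s. 0)"
proof -
  show "T (\<lambda>s. f s + g s) = (\<lambda>s. T f s + T g s)" "T (\<lambda>s. c * f s) = (\<lambda>s. c * T f s)" for f g c
    using assms by (auto simp: lin_op_def)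
  from this(2)[of 0] show "T (\<lambda>s. 0) = (\<lambda>s. 0)" by simp
qed

lemma lin_op_sum:
  assumes "lin_op T"
  shows "T (\<lambda>s. \<Sum>i\<in>A. c i * f i s) = (\<lambda>s. \<Sum>i\<in>A. c i * T (f i) s)"
  by (induction A rule: infinite_finite_induct) (simp_all add: lin_opD[OF assms])

lemma sym_opD:
  assumes "sym_op T"
  shows "lin_op T" "fin_supp f \<Longrightarrow> fin_supp (T f)"
    "fin_supp f \<Longrightarrow> fin_supp g \<Longrightarrow> l2_inner (T f) g = l2_inner f (T g)"
  using assms by (auto simp: sym_op_def)

lemma fin_supp_unit_vec [simp]: "fin_supp (unit_vec v)"
  by (simp add: fin_supp_def unit_vec_def)

lemma fin_supp_subset: "finite A \<Longrightarrow> (\<And>s. s \<notin> A \<Longrightarrow> f s = 0) \<Longrightarrow> fin_supp f"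
  unfolding fin_supp_def by (rule finite_subset[of _ A]) auto

lemma fin_supp_add: "fin_supp f \<Longrightarrow> fin_supp g \<Longrightarrow> fin_supp (\<lambda>s. f s + g s)"
  by (rule fin_supp_subset[of "{s. f s \<noteq> 0} \<union> {s. g s \<noteq> 0}"]) (auto simp: fin_supp_def)

lemma fin_supp_mult: "fin_supp f \<Longrightarrow> fin_supp (\<lambda>s. c s * f s)"
  by (rule fin_supp_subset[of "{s. f s \<noteq> 0}"]) (auto simp: fin_supp_def)

lemma fin_supp_sum: "(\<And>i. i \<in> A \<Longrightarrow> fin_supp (f i)) \<Longrightarrow> fin_supp (\<lambda>s. \<Sum>i\<in>A. f i s)"
  by (induction A rule: infinite_finite_induct) (simp_all add: fin_supp_add, simp_all add: fin_supp_def)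

lemma fin_supp_summable:
  assumes "fin_supp (f :: 's \<Rightarrow> complex)"
  shows "f summable_on A"
proof -
  have "f summable_on ({s. f s \<noteq> 0} \<inter> A)"
    using assms by (intro summable_on_finite) (simp add: fin_supp_def)
  then show ?thesis by (rule summable_on_cong_neutral[THEN iffD1, rotated -1]) auto
qed

lemma l2_inner_add:
  assumes "fin_supp g" "fin_supp h"
  shows "l2_inner f (\<lambda>s. g s + h s) = l2_inner f g + l2_inner f h"
    "l2_inner (\<lambda>s. g s + h s) f = l2_inner g f + l2_inner h f"
proof -
  have *: "fin_supp (\<lambda>s. cnj (g s) * f s)" if "fin_supp g" for g
    by (rule fin_supp_subset[of "{s. g s \<noteq> 0}"]) (use that in \<open>auto simp: fin_supp_def\<close>)
  show "l2_inner f (\<lambda>s. g s + h s) = l2_inner f g + l2_inner f h"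
    unfolding l2_inner_def distrib_left
    by (intro infsum_add fin_supp_summable fin_supp_mult assms)
  show "l2_inner (\<lambda>s. g s + h s) f = l2_inner g f + l2_inner h f"
    unfolding l2_inner_def complex_cnj_add distrib_right
    by (intro infsum_add fin_supp_summable * assms)
qed

lemma l2_inner_scale:
  "l2_inner f (\<lambda>s. c * g s) = c * l2_inner f g" "l2_inner (\<lambda>s. c * f s) g = cnj c * l2_inner f g"
  unfolding l2_inner_def
  by (simp_all add: infsum_cmult_right'[symmetric] mult.left_commute mult.assoc)

lemma l2_inner_sum:
  assumes "\<And>i. i \<in> A \<Longrightarrow> fin_supp (g i)"
  shows "l2_inner f (\<lambda>s. \<Sum>i\<in>A. c i * g i s) = (\<Sum>i\<in>A. c i * l2_inner f (g i))"
    "l2_inner (\<lambda>s. \<Sum>i\<in>A. c i * g i s) f = (\<Sum>i\<in>A. cnj (c i) * l2_inner (g i) f)"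
proof -
  have *: "fin_supp (\<lambda>s. c x * g x s)" "fin_supp (\<lambda>s. \<Sum>i\<in>F. c i * g i s)" if "insert x F \<subseteq> A" for x F
    using assms that by (auto intro!: fin_supp_mult fin_supp_sum)
  have z: "l2_inner f (\<lambda>s. 0) = 0" "l2_inner (\<lambda>s. 0) f = 0" by (simp_all add: l2_inner_def)
  have "l2_inner f (\<lambda>s. \<Sum>i\<in>B. c i * g i s) = (\<Sum>i\<in>B. c i * l2_inner f (g i)) \<and>
      l2_inner (\<lambda>s. \<Sum>i\<in>B. c i * g i s) f = (\<Sum>i\<in>B. cnj (c i) * l2_inner (g i) f)"
    if "B \<subseteq> A" for B
    using that
  proof (induction B rule: infinite_finite_induct)
    case (insert x F)
    then show ?case using l2_inner_add[OF *[of x F], of f] by (simp add: l2_inner_scale)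
  qed (simp_all add: z)
  then show "l2_inner f (\<lambda>s. \<Sum>i\<in>A. c i * g i s) = (\<Sum>i\<in>A. c i * l2_inner f (g i))"
    "l2_inner (\<lambda>s. \<Sum>i\<in>A. c i * g i s) f = (\<Sum>i\<in>A. cnj (c i) * l2_inner (g i) f)" by simp_all
qed

lemma l2_inner_unit_vec: "l2_inner (unit_vec v) f = f v"
proof -
  have "l2_inner (unit_vec v) f = (\<Sum>\<^sub>\<infinity>s\<in>{v}. cnj (unit_vec v s) * f s)"
    unfolding l2_inner_def by (rule infsum_cong_neutral) (auto simp: unit_vec_def)
  then show ?thesis by (simp add: unit_vec_def)
qed

lemma l2_inner_self:
  assumes "fin_supp f"
  shows "l2_inner f f \<in> \<real>\<^sub>\<ge>\<^sub>0"
proof -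
  have "l2_inner f f = (\<Sum>\<^sub>\<infinity>s. complex_of_real ((cmod (f s))\<^sup>2))"
    unfolding l2_inner_def by (rule infsum_cong) (metis complex_norm_square mult.commute)
  also have "\<dots> = (\<Sum>\<^sub>\<infinity>s\<in>{s. f s \<noteq> 0}. complex_of_real ((cmod (f s))\<^sup>2))"
    by (rule infsum_cong_neutral) auto
  also have "\<dots> = of_real (\<Sum>s | f s \<noteq> 0. (cmod (f s))\<^sup>2)"
    using assms by (simp add: fin_supp_def)
  finally show ?thesis by (simp only: nonneg_Reals_of_real_iff) (simp add: sum_nonneg)
qed

lemma sym_op_comp_pow: "sym_op T \<Longrightarrow> fin_supp f \<Longrightarrow> fin_supp ((T ^^ n) f)"
  by (induction n) (auto intro: sym_opD(2))

lemma sym_op_lincomb: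
  assumes "sym_op S" "sym_op T"
  shows "sym_op (\<lambda>f s. of_real a * S f s + of_real b * T f s)"
  unfolding sym_op_def lin_op_def
proof (intro conjI allI impI)
  note S = sym_opD(1)[OF assms(1)] and T = sym_opD(1)[OF assms(2)]
  show "(\<lambda>s. of_real a * S (\<lambda>s. f s + g s) s + of_real b * T (\<lambda>s. f s + g s) s) =
     (\<lambda>s. of_real a * S f s + of_real b * T f s + (of_real a * S g s + of_real b * T g s))" for f g
    by (simp add: lin_opD[OF S] lin_opD[OF T] algebra_simps)
  show "(\<lambda>s. of_real a * S (\<lambda>s. c * f s) s + of_real b * T (\<lambda>s. c * f s) s) =
     (\<lambda>s. c * (of_real a * S f s + of_real b * T f s))" for c f
    by (simp add: lin_opD[OF S] lin_opD[OF T] algebra_simps)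
  fix f :: "'a \<Rightarrow> complex" assume f: "fin_supp f"
  show "fin_supp (\<lambda>s. of_real a * S f s + of_real b * T f s)"
    by (intro fin_supp_add fin_supp_mult sym_opD(2)[OF assms(1) f] sym_opD(2)[OF assms(2) f])
  fix g :: "'a \<Rightarrow> complex" assume g: "fin_supp g"
  show "l2_inner (\<lambda>s. of_real a * S f s + of_real b * T f s) g =
      l2_inner f (\<lambda>s. of_real a * S g s + of_real b * T g s)"
    using f g
    by (simp add: l2_inner_add l2_inner_scale fin_supp_mult sym_opD(2,3)[OF assms(1)]
        sym_opD(2,3)[OF assms(2)])
qed

text \<open>For injective \<open>u\<close> this is \<open>V + V*\<close> for the isometry \<open>V\<close> induced by \<open>u\<close>.\<close>

definition adjacency :: "('s \<Rightarrow> 's) \<Rightarrow> ('s \<Rightarrow> complex) \<Rightarrow> 's \<Rightarrow> complex" where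
  "adjacency u f s = f (u s) + (if s \<in> range u then f (inv u s) else 0)"

lemma adjacency_simps:
  "inj u \<Longrightarrow> adjacency u f (u s) = f (u (u s)) + f s"
  "s \<notin> range u \<Longrightarrow> adjacency u f s = f (u s)"
  by (simp_all add: adjacency_def)

lemma lin_op_adjacency: "lin_op (adjacency u)"
  by (auto simp: lin_op_def adjacency_def fun_eq_iff algebra_simps)

text \<open>Reindexing along the injective \<open>u\<close> turns the part supported on
  \<open>range u\<close> into a sum over all \<open>s\<close>. The two right-hand sides then agree
  up to order, which is the symmetry of \<open>adjacency u\<close>.\<close>

lemma l2_inner_adjacency:
  assumes "inj u" "fin_supp f" "fin_supp g"
  shows "l2_inner f (adjacency u g) = (\<Sum>\<^sub>\<infinity>s. cnj (f s) * g (u s)) + (\<Sum>\<^sub>\<infinity>s. cnj (f (u s)) * g s)"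
    "l2_inner (adjacency u f) g = (\<Sum>\<^sub>\<infinity>s. cnj (f (u s)) * g s) + (\<Sum>\<^sub>\<infinity>s. cnj (f s) * g (u s))"
proof -
  have fs: "fin_supp (\<lambda>s. cnj (f s) * h s)" for h
    by (rule fin_supp_subset[of "{s. f s \<noteq> 0}"]) (use assms in \<open>auto simp: fin_supp_def\<close>)
  have 1: "(\<Sum>\<^sub>\<infinity>s. cnj (f s) * (if s \<in> range u then g (inv u s) else 0)) = (\<Sum>\<^sub>\<infinity>s. cnj (f (u s)) * g s)"
  proof -
    have "(\<Sum>\<^sub>\<infinity>s. cnj (f s) * (if s \<in> range u then g (inv u s) else 0))
        = (\<Sum>\<^sub>\<infinity>s\<in>range u. cnj (f s) * g (inv u s))"
      by (rule infsum_cong_neutral) auto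
    also have "\<dots> = (\<Sum>\<^sub>\<infinity>s. cnj (f (u s)) * g s)"
      using assms(1) by (simp add: infsum_reindex o_def)
    finally show ?thesis .
  qed
  have 2: "(\<Sum>\<^sub>\<infinity>s. cnj (if s \<in> range u then f (inv u s) else 0) * g s) = (\<Sum>\<^sub>\<infinity>s. cnj (f s) * g (u s))"
  proof -
    have "(\<Sum>\<^sub>\<infinity>s. cnj (if s \<in> range u then f (inv u s) else 0) * g s)
        = (\<Sum>\<^sub>\<infinity>s\<in>range u. cnj (f (inv u s)) * g s)"
      by (rule infsum_cong_neutral) auto
    also have "\<dots> = (\<Sum>\<^sub>\<infinity>s. cnj (f s) * g (u s))"
      using assms(1) by (simp add: infsum_reindex o_def)
    finally show ?thesis .
  qed
  show "l2_inner f (adjacency u g) = (\<Sum>\<^sub>\<infinity>s. cnj (f s) * g (u s)) + (\<Sum>\<^sub>\<infinity>s. cnj (f (u s)) * g s)"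
    unfolding l2_inner_def adjacency_def distrib_left 1[symmetric]
    by (intro infsum_add fin_supp_summable fs)
  show "l2_inner (adjacency u f) g = (\<Sum>\<^sub>\<infinity>s. cnj (f (u s)) * g s) + (\<Sum>\<^sub>\<infinity>s. cnj (f s) * g (u s))"
    unfolding l2_inner_def adjacency_def distrib_right complex_cnj_add 2[symmetric]
    by (intro infsum_add fin_supp_summable fin_supp_mult assms(3))
qed

lemma fin_supp_adjacency:
  assumes "inj u" "fin_supp f"
  shows "fin_supp (adjacency u f)"
proof (rule fin_supp_subset)
  show "finite (u -` {s. f s \<noteq> 0} \<union> u ` {s. f s \<noteq> 0})"
    using assms finite_vimageI[of "{s. f s \<noteq> 0}" u] by (auto simp: fin_supp_def)
  show "adjacency u f s = 0" if "s \<notin> u -` {s. f s \<noteq> 0} \<union> u ` {s. f s \<noteq> 0}" for s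
    using that assms(1) by (auto simp: adjacency_def)
qed

lemma sym_op_adjacency: "inj u \<Longrightarrow> sym_op (adjacency u)"
  by (simp add: sym_op_def lin_op_adjacency fin_supp_adjacency l2_inner_adjacency)

text \<open>A bound on the numerical radius. It passes to nonnegative combinations, and for
  symmetric \<open>Z\<close> it is exactly what makes \<open>1/2 + Z/(2K)\<close> and
  \<open>1/2 - Z/(2K)\<close> positive.\<close>

definition op_bound :: "(('s \<Rightarrow> complex) \<Rightarrow> 's \<Rightarrow> complex) \<Rightarrow> real \<Rightarrow> bool" where
  "op_bound T K \<longleftrightarrow> (\<forall>f. fin_supp f \<longrightarrow> cmod (l2_inner f (T f)) \<le> K * Re (l2_inner f f))"

lemma op_bound_lincomb:
  assumes "sym_op S" "sym_op T" "op_bound S K" "op_bound T L" "a \<ge> 0" "b \<ge> 0"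
  shows "op_bound (\<lambda>f s. of_real a * S f s + of_real b * T f s) (a * K + b * L)"
  unfolding op_bound_def
proof (intro allI impI)
  fix f :: "'a \<Rightarrow> complex" assume f: "fin_supp f"
  have "l2_inner f (\<lambda>s. of_real a * S f s + of_real b * T f s)
      = of_real a * l2_inner f (S f) + of_real b * l2_inner f (T f)"
    using f by (simp add: l2_inner_add l2_inner_scale fin_supp_mult sym_opD(2)[OF assms(1)]
        sym_opD(2)[OF assms(2)])
  also have "cmod \<dots> \<le> a * cmod (l2_inner f (S f)) + b * cmod (l2_inner f (T f))"
    using norm_triangle_ineq[of "of_real a * l2_inner f (S f)" "of_real b * l2_inner f (T f)"] assms(5,6)
    by (simp add: norm_mult)
  also have "\<dots> \<le> a * (K * Re (l2_inner f f)) + b * (L * Re (l2_inner f f))"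
    using assms f unfolding op_bound_def by (intro add_mono mult_left_mono) auto
  finally show "cmod (l2_inner f (\<lambda>s. of_real a * S f s + of_real b * T f s))
      \<le> (a * K + b * L) * Re (l2_inner f f)" by (simp add: algebra_simps)
qed

text \<open>Each of the two shifts contributes at most the squared norm:
  \<open>2 x y \<le> x\<^sup>2 + y\<^sup>2\<close> holds termwise, and injectivity of
  \<open>u\<close> keeps the shifted mass below the original one.\<close>

lemma op_bound_adjacency:
  assumes "inj u"
  shows "op_bound (adjacency u) 2"
  unfolding op_bound_def
proof (intro allI impI)
  fix f :: "'a \<Rightarrow> complex" assume f: "fin_supp f"
  define A where "A = {s. f s \<noteq> 0}"
  have fA: "finite A" using f by (simp add: A_def fin_supp_def)
  have z: "f s = 0" if "s \<notin> A" for s using that by (simp add: A_def)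
  let ?N = "\<Sum>s\<in>A. (cmod (f s))\<^sup>2"
  have nn: "Re (l2_inner f f) = ?N"
  proof -
    have "l2_inner f f = (\<Sum>\<^sub>\<infinity>s\<in>A. cnj (f s) * f s)"
      unfolding l2_inner_def by (rule infsum_cong_neutral) (auto simp: z)
    then show ?thesis using fA by (simp add: cmod_power2) (simp add: power2_eq_square)
  qed
  have e1: "(\<Sum>\<^sub>\<infinity>s. cnj (f s) * f (u s)) = (\<Sum>s\<in>A. cnj (f s) * f (u s))"
  proof -
    have "(\<Sum>\<^sub>\<infinity>s. cnj (f s) * f (u s)) = (\<Sum>\<^sub>\<infinity>s\<in>A. cnj (f s) * f (u s))"
      by (rule infsum_cong_neutral) (auto simp: z)
    then show ?thesis using fA by simp
  qed
  have e2: "(\<Sum>\<^sub>\<infinity>s. cnj (f (u s)) * f s) = (\<Sum>s\<in>A. cnj (f (u s)) * f s)"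
  proof -
    have "(\<Sum>\<^sub>\<infinity>s. cnj (f (u s)) * f s) = (\<Sum>\<^sub>\<infinity>s\<in>A. cnj (f (u s)) * f s)"
      by (rule infsum_cong_neutral) (auto simp: z)
    then show ?thesis using fA by simp
  qed
  have "(\<Sum>s\<in>A. (cmod (f (u s)))\<^sup>2) = (\<Sum>s\<in>u ` A. (cmod (f s))\<^sup>2)"
    using assms by (simp add: sum.reindex inj_on_subset o_def)
  also have "\<dots> = (\<Sum>s\<in>u ` A \<inter> A. (cmod (f s))\<^sup>2)"
    using fA by (intro sum.mono_neutral_right) (auto simp: z)
  also have "\<dots> \<le> ?N" using fA by (intro sum_mono2) auto
  finally have u: "(\<Sum>s\<in>A. (cmod (f (u s)))\<^sup>2) \<le> ?N" .
  have m: "cmod (f s) * cmod (f (u s)) \<le> ((cmod (f s))\<^sup>2 + (cmod (f (u s)))\<^sup>2) / 2" for s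
    using sum_squares_bound[of "cmod (f s)" "cmod (f (u s))"] by simp
  have "(\<Sum>s\<in>A. cmod (f s) * cmod (f (u s))) \<le> (\<Sum>s\<in>A. ((cmod (f s))\<^sup>2 + (cmod (f (u s)))\<^sup>2) / 2)"
    by (intro sum_mono m)
  also have "\<dots> \<le> ?N" using u by (simp add: sum_divide_distrib[symmetric] sum.distrib)
  finally have m: "(\<Sum>s\<in>A. cmod (f s) * cmod (f (u s))) \<le> ?N" .
  have "cmod (\<Sum>s\<in>A. cnj (f s) * f (u s)) \<le> ?N"
    by (rule order_trans[OF norm_sum]) (use m in \<open>simp add: norm_mult\<close>)
  moreover have "cmod (\<Sum>s\<in>A. cnj (f (u s)) * f s) \<le> ?N"
    by (rule order_trans[OF norm_sum]) (use m in \<open>simp add: norm_mult mult.commute\<close>)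
  ultimately have "cmod ((\<Sum>s\<in>A. cnj (f s) * f (u s)) + (\<Sum>s\<in>A. cnj (f (u s)) * f s)) \<le> 2 * ?N"
    by norm
  then show "cmod (l2_inner f (adjacency u f)) \<le> 2 * Re (l2_inner f f)"
    by (simp add: l2_inner_adjacency(1)[OF assms f f] e1 e2 nn)
qed

section \<open>Vector states on non-commutative polynomials\<close>

text \<open>\<open>foldr\<close> lets the leftmost letter act last, so for linear \<open>T i\<close>
  words act as operator products and polynomials are represented multiplicatively.\<close>

definition nc_act :: "('i \<Rightarrow> ('s \<Rightarrow> complex) \<Rightarrow> 's \<Rightarrow> complex) \<Rightarrow> 'i ncpoly \<Rightarrow> ('s \<Rightarrow> complex) \<Rightarrow> 's \<Rightarrow> complex"
  where "nc_act T p f s = (\<Sum>w | nc_coeff p w \<noteq> 0. nc_coeff p w * foldr T w f s)"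

lemma finite_nc_coeff: "finite {w. nc_coeff p w \<noteq> 0}"
  using nc_coeff by auto

lemma nc_act_superset:
  assumes "finite W" "{w. nc_coeff p w \<noteq> 0} \<subseteq> W"
  shows "nc_act T p f s = (\<Sum>w\<in>W. nc_coeff p w * foldr T w f s)"
  unfolding nc_act_def by (rule sum.mono_neutral_left) (use assms in auto)

lemma nc_act_add: "nc_act T (p + r) f s = nc_act T p f s + nc_act T r f s"
proof -
  let ?W = "{w. nc_coeff p w \<noteq> 0} \<union> {w. nc_coeff r w \<noteq> 0}"
  have W: "finite ?W" by (simp add: finite_nc_coeff)
  have "{w. nc_coeff (p + r) w \<noteq> 0} \<subseteq> ?W" by (auto simp: plus_ncpoly.rep_eq)
  then show ?thesis
    using nc_act_superset[OF W, of p T f s] nc_act_superset[OF W, of r T f s]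
      nc_act_superset[OF W, of "p + r" T f s]
    by (simp add: plus_ncpoly.rep_eq sum.distrib[symmetric] algebra_simps)
qed

lemma nc_act_scale: "nc_act T (c *\<^sub>C p) f s = c * nc_act T p f s"
proof -
  let ?W = "{w. nc_coeff p w \<noteq> 0}"
  have W: "finite ?W" by (simp add: finite_nc_coeff)
  have "{w. nc_coeff (c *\<^sub>C p) w \<noteq> 0} \<subseteq> ?W" by (auto simp: scaleC_ncpoly.rep_eq)
  then show ?thesis
    using nc_act_superset[OF W, of p T f s] nc_act_superset[OF W, of "c *\<^sub>C p" T f s]
    by (simp add: scaleC_ncpoly.rep_eq sum_distrib_left algebra_simps)
qed

lemma nc_act_one: "nc_act T 1 f = f"
  using nc_act_superset[of "{[]}" 1 T f] by (auto simp: one_ncpoly.rep_eq fun_eq_iff split: if_splits)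

lemma nc_act_var: "nc_act T (nc_var i) f = T i f"
  using nc_act_superset[of "{[i]}" "nc_var i" T f]
  by (auto simp: nc_var.rep_eq fun_eq_iff split: if_splits)

lemma lin_op_foldr: "(\<And>i. lin_op (T i)) \<Longrightarrow> lin_op (foldr T w)"
  by (induction w) (auto simp: lin_op_def)

lemma nc_act_mult:
  assumes lin: "\<And>i. lin_op (T i)"
  shows "nc_act T (p * r) f = nc_act T p (nc_act T r f)"
proof
  fix s
  let ?U = "{w. nc_coeff p w \<noteq> 0}" and ?V = "{w. nc_coeff r w \<noteq> 0}"
  let ?W = "(\<lambda>(u, v). u @ v) ` (?U \<times> ?V)"
  let ?h = "\<lambda>(u, v). nc_coeff p u * nc_coeff r v * foldr T (u @ v) f s"
  have fin: "finite (?U \<times> ?V)" by (simp add: finite_nc_coeff)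
  \<comment> \<open>Discarding the splittings outside the two supports turns a coefficient of the
    product into a sum over a fibre of concatenation; \<open>sum.group\<close> then collects the
    fibres.\<close>
  have restrict: "(\<Sum>(u, v)\<in>splits w. nc_coeff p u * nc_coeff r v) =
      (\<Sum>(u, v)\<in>{x \<in> ?U \<times> ?V. (\<lambda>(u, v). u @ v) x = w}. nc_coeff p u * nc_coeff r v)" for w
    by (rule sum.mono_neutral_right) (auto simp: finite_splits, auto simp: splits_def)
  have "{w. nc_coeff (p * r) w \<noteq> 0} \<subseteq> ?W"
  proof
    fix w assume "w \<in> {w. nc_coeff (p * r) w \<noteq> 0}"
    then have "(\<Sum>(u, v)\<in>splits w. nc_coeff p u * nc_coeff r v) \<noteq> 0"
      by (simp add: times_ncpoly.rep_eq)
    then obtain x where "x \<in> {x \<in> ?U \<times> ?V. (\<lambda>(u, v). u @ v) x = w}"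
      unfolding restrict by (meson sum.not_neutral_contains_not_neutral)
    then show "w \<in> ?W" by force
  qed
  then have "nc_act T (p * r) f s = (\<Sum>w\<in>?W. nc_coeff (p * r) w * foldr T w f s)"
    using fin by (intro nc_act_superset) auto
  also have "\<dots> = (\<Sum>w\<in>?W. \<Sum>x\<in>{x \<in> ?U \<times> ?V. (\<lambda>(u, v). u @ v) x = w}. ?h x)"
    unfolding times_ncpoly.rep_eq restrict sum_distrib_right by (intro sum.cong) auto
  also have "\<dots> = (\<Sum>x\<in>?U \<times> ?V. ?h x)"
    using fin by (intro sum.group) auto
  also have "\<dots> = (\<Sum>u\<in>?U. \<Sum>v\<in>?V. nc_coeff p u * (nc_coeff r v * foldr T u (foldr T v f) s))"
    by (simp add: sum.cartesian_product mult.assoc)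
  also have "\<dots> = nc_act T p (nc_act T r f) s"
    by (simp add: nc_act_def[abs_def] lin_op_sum[OF lin_op_foldr[OF lin]] sum_distrib_left)
  finally show "nc_act T (p * r) f s = nc_act T p (nc_act T r f) s" .
qed

lemma nc_act_power:
  assumes "\<And>i. lin_op (T i)"
  shows "nc_act T (p ^ n) f = (nc_act T p ^^ n) f"
  by (induction n) (simp_all add: nc_act_one nc_act_mult[OF assms])

lemma fin_supp_foldr: "(\<And>i. sym_op (T i)) \<Longrightarrow> fin_supp f \<Longrightarrow> fin_supp (foldr T w f)"
  by (induction w) (auto intro: sym_opD(2))

lemma l2_inner_foldr:
  assumes T: "\<And>i. sym_op (T i)" and "fin_supp f" "fin_supp g"
  shows "l2_inner (foldr T w f) g = l2_inner f (foldr T (rev w) g)"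
  using assms(3)
proof (induction w arbitrary: g)
  case (Cons i w)
  have "l2_inner (T i (foldr T w f)) g = l2_inner (foldr T w f) (T i g)"
    by (rule sym_opD(3)[OF T fin_supp_foldr[OF T assms(2)] Cons.prems])
  also have "\<dots> = l2_inner f (foldr T (rev w) (T i g))"
    by (rule Cons.IH[OF sym_opD(2)[OF T Cons.prems]])
  finally show ?case by simp
qed simp

lemma nc_act_star:
  assumes T: "\<And>i. sym_op (T i)" and f: "fin_supp f" and g: "fin_supp g"
  shows "l2_inner (nc_act T p f) g = l2_inner f (nc_act T (star p) g)"
proof -
  let ?W = "{w. nc_coeff p w \<noteq> 0}"
  have "nc_act T (star p) g s = (\<Sum>w\<in>rev ` ?W. nc_coeff (star p) w * foldr T w g s)" for s
  proof (rule nc_act_superset)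
    show "{w. nc_coeff (star p) w \<noteq> 0} \<subseteq> rev ` ?W"
    proof
      fix w assume "w \<in> {w. nc_coeff (star p) w \<noteq> 0}"
      then have "rev w \<in> ?W" by (simp add: star_ncpoly.rep_eq)
      then show "w \<in> rev ` ?W" by (metis image_eqI rev_rev_ident)
    qed
  qed (simp add: finite_nc_coeff)
  also have "\<dots> s = (\<Sum>w\<in>?W. cnj (nc_coeff p w) * foldr T (rev w) g s)" for s
    by (simp add: sum.reindex star_ncpoly.rep_eq)
  finally have e: "nc_act T (star p) g = (\<lambda>s. \<Sum>w\<in>?W. cnj (nc_coeff p w) * foldr T (rev w) g s)"
    by blast
  have "l2_inner (nc_act T p f) g = (\<Sum>w\<in>?W. cnj (nc_coeff p w) * l2_inner (foldr T w f) g)"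
    unfolding nc_act_def[abs_def] by (intro l2_inner_sum fin_supp_foldr T f)
  also have "\<dots> = (\<Sum>w\<in>?W. cnj (nc_coeff p w) * l2_inner f (foldr T (rev w) g))"
    by (simp add: l2_inner_foldr[OF T f g])
  also have "\<dots> = l2_inner f (nc_act T (star p) g)"
    unfolding e by (intro l2_inner_sum(1)[symmetric] fin_supp_foldr T g)
  finally show ?thesis .
qed

lemma fin_supp_nc_act: "(\<And>i. sym_op (T i)) \<Longrightarrow> fin_supp f \<Longrightarrow> fin_supp (nc_act T p f)"
  unfolding nc_act_def[abs_def] by (intro fin_supp_sum fin_supp_mult fin_supp_foldr)

text \<open>By \<open>l2_inner_unit_vec\<close> the coefficient at \<open>v\<close> is the inner
  product with \<open>unit_vec v\<close>; positivity then follows from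
  \<open>nc_act_star\<close>.\<close>

definition vector_state ::
  "('i \<Rightarrow> ('s \<Rightarrow> complex) \<Rightarrow> 's \<Rightarrow> complex) \<Rightarrow> 's \<Rightarrow> 'i ncpoly \<Rightarrow> complex" where
  "vector_state T v p = nc_act T p (unit_vec v) v"

lemma state_vector_state:
  assumes T: "\<And>i. sym_op (T i)"
  shows "state (vector_state T v)"
  unfolding state_def clinear_def
proof (intro conjI allI)
  fix p :: "'a ncpoly"
  have "vector_state T v (star p * p) = l2_inner (unit_vec v) (nc_act T (star p * p) (unit_vec v))"
    by (simp add: vector_state_def l2_inner_unit_vec)
  also have "\<dots> = l2_inner (nc_act T p (unit_vec v)) (nc_act T p (unit_vec v))"
    by (simp add: nc_act_mult[OF sym_opD(1)[OF T]] nc_act_star[OF T] fin_supp_nc_act[OF T])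
  finally show "vector_state T v (star p * p) \<in> \<real>\<^sub>\<ge>\<^sub>0"
    by (simp add: l2_inner_self fin_supp_nc_act[OF T])
qed (simp_all add: vector_state_def nc_act_add nc_act_scale nc_act_one unit_vec_def scaleC_complex_def)

section \<open>The Fock space model\<close>

text \<open>Three self-adjoint operators act on finitely supported functions on \<open>shape\<close>: the first two are
  commuting (classically independent) semicircular elements, the third is a semicircular element free
  from both. A basis vector \<open>((a, b), [(a\<^sub>1, b\<^sub>1), \<dots>, (a\<^sub>k, b\<^sub>k)])\<close> stands for the word
  \<open>A\<^sup>a B\<^sup>b C A\<^bsup>a\<^sub>1\<^esup> B\<^bsup>b\<^sub>1\<^esup> C \<dots>\<close> in letters subject to \<open>A B = B A\<close> only.\<close>

type_synonym shape = "(nat \<times> nat) \<times> (nat \<times> nat) list"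

datatype kind = First | Second | Both

fun raise :: "kind \<Rightarrow> shape \<Rightarrow> shape" where
  "raise First ((a, b), r) = ((Suc a, b), r)"
| "raise Second ((a, b), r) = ((a, Suc b), r)"
| "raise Both (h, r) = ((0, 0), h # r)"

definition vacuum :: shape where
  "vacuum = ((0, 0), [])"

lemma inj_raise: "inj (raise t)"
  by (cases t) (auto simp: inj_def)

lemma range_raise:
  "((a, b), r) \<in> range (raise First) \<longleftrightarrow> a > 0"
  "((a, b), r) \<in> range (raise Second) \<longleftrightarrow> b > 0"
  "(h, r) \<in> range (raise Both) \<longleftrightarrow> h = (0, 0) \<and> r \<noteq> []"
proof -
  show "((a, b), r) \<in> range (raise First) \<longleftrightarrow> a > 0"
    by (cases a) (auto simp: image_iff intro: exI[of _ "((_, b), r)"])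
  show "((a, b), r) \<in> range (raise Second) \<longleftrightarrow> b > 0"
    by (cases b) (auto simp: image_iff intro: exI[of _ "((a, _), r)"])
  show "(h, r) \<in> range (raise Both) \<longleftrightarrow> h = (0, 0) \<and> r \<noteq> []"
    by (cases r) (auto simp: image_iff intro: exI[of _ "(_, _)"])
qed

lemma inv_raise [simp]: "inv (raise t) (raise t s) = s"
  by (simp add: inj_raise)

lemma adjacency_raise:
  "adjacency (raise First) f ((a, b), r) = f ((Suc a, b), r) + (case a of 0 \<Rightarrow> 0 | Suc a' \<Rightarrow> f ((a', b), r))"
  "adjacency (raise Second) f ((a, b), r) = f ((a, Suc b), r) + (case b of 0 \<Rightarrow> 0 | Suc b' \<Rightarrow> f ((a, b'), r))"
proof -
  show "adjacency (raise First) f ((a, b), r) = f ((Suc a, b), r) + (case a of 0 \<Rightarrow> 0 | Suc a' \<Rightarrow> f ((a', b), r))"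
    using adjacency_simps(1)[OF inj_raise, of First f "((_, b), r)"]
      adjacency_simps(2)[of "((a, b), r)" "raise First" f]
    by (cases a) (simp_all add: range_raise)
  show "adjacency (raise Second) f ((a, b), r) = f ((a, Suc b), r) + (case b of 0 \<Rightarrow> 0 | Suc b' \<Rightarrow> f ((a, b'), r))"
    using adjacency_simps(1)[OF inj_raise, of Second f "((a, _), r)"]
      adjacency_simps(2)[of "((a, b), r)" "raise Second" f]
    by (cases b) (simp_all add: range_raise)
qed

text \<open>The Boolean index matches the indeterminates in \<open>free_convolution\<close>:
  \<open>False\<close> is the scaled sum of the two commuting semicircular operators,
  \<open>True\<close> the scaled free one.\<close>

definition model_op :: "real \<Rightarrow> real \<Rightarrow> bool \<Rightarrow> (shape \<Rightarrow> complex) \<Rightarrow> shape \<Rightarrow> complex" where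
  "model_op \<alpha> \<beta> i f s = (if i then of_real \<beta> * adjacency (raise Both) f s
     else of_real \<alpha> * adjacency (raise First) f s + of_real \<alpha> * adjacency (raise Second) f s)"

lemma model_op_simps:
  "model_op \<alpha> \<beta> True f s = of_real \<beta> * adjacency (raise Both) f s"
  "model_op \<alpha> \<beta> False f s = of_real \<alpha> * (adjacency (raise First) f s + adjacency (raise Second) f s)"
  by (simp_all add: model_op_def distrib_left)

lemma sym_op_model_op: "sym_op (model_op \<alpha> \<beta> i)"
  using sym_op_lincomb[OF sym_op_adjacency[OF inj_raise] sym_op_adjacency[OF inj_raise],
      of \<alpha> First \<alpha> Second]
    sym_op_lincomb[OF sym_op_adjacency[OF inj_raise] sym_op_adjacency[OF inj_raise],
      of \<beta> Both 0 Both]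
  by (cases i) (simp_all add: model_op_def[abs_def])

lemma op_bound_mono:
  assumes "op_bound T K" "K \<le> L"
  shows "op_bound T L"
  unfolding op_bound_def
proof (intro allI impI)
  fix f :: "'a \<Rightarrow> complex" assume f: "fin_supp f"
  have "K * Re (l2_inner f f) \<le> L * Re (l2_inner f f)"
    using l2_inner_self[OF f] assms(2) by (simp add: complex_nonneg_Reals_iff mult_right_mono)
  then show "cmod (l2_inner f (T f)) \<le> L * Re (l2_inner f f)"
    using assms(1) f by (meson op_bound_def order_trans)
qed

lemma op_bound_model_op:
  assumes "\<alpha> \<ge> 0" "\<beta> \<ge> 0"
  shows "op_bound (model_op \<alpha> \<beta> i) (4 * \<alpha> + 2 * \<beta>)"
proof -
  note * = op_bound_lincomb[OF sym_op_adjacency[OF inj_raise] sym_op_adjacency[OF inj_raise]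
    op_bound_adjacency[OF inj_raise] op_bound_adjacency[OF inj_raise]]
  show ?thesis
  proof (cases i)
    case True
    then show ?thesis
      \<comment> \<open>\<open>order_refl\<close> fixes the second coefficient to \<open>0\<close>,
        which leaves a single operator.\<close>
      using *[OF assms(2) order_refl, of Both Both] assms
      by (auto simp: model_op_def[abs_def] elim!: op_bound_mono)
  next
    case False
    then show ?thesis
      using *[OF assms(1,1), of First Second] assms
      by (auto simp: model_op_def[abs_def] elim!: op_bound_mono)
  qed
qed

abbreviation "model_state \<alpha> \<beta> \<equiv> vector_state (model_op \<alpha> \<beta>) vacuum"

section \<open>Freeness of the model operators\<close>

lemma nc_act_alg_poly_pCons:
  assumes "\<And>i. lin_op (T i)"
  shows "nc_act T (alg_poly (pCons c p) (nc_var i)) f s =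
    c * f s + T i (nc_act T (alg_poly p (nc_var i)) f) s"
  by (simp add: nc_act_add nc_act_scale nc_act_one nc_act_mult[OF assms] nc_act_var)

lemma nc_act_zero [simp]: "nc_act T 0 f s = 0"
  by (simp add: nc_act_def zero_ncpoly.rep_eq)

text \<open>Starting from vectors with empty head, the commuting pair changes only the head and
  never sees the tail \<open>r\<close>, so it acts as on the vacuum, tensored with
  \<open>r\<close>.\<close>

lemma model_act_False:
  assumes f: "\<And>a b r. (a, b) \<noteq> (0, 0) \<Longrightarrow> f ((a, b), r) = 0"
  shows "nc_act (model_op \<alpha> \<beta>) (alg_poly p (nc_var False)) f ((a, b), r) =
    nc_act (model_op \<alpha> \<beta>) (alg_poly p (nc_var False)) (unit_vec vacuum) ((a, b), []) * f ((0, 0), r)"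
proof (induction p arbitrary: a b)
  case (pCons c p)
  show ?case
    unfolding nc_act_alg_poly_pCons[OF sym_opD(1)[OF sym_op_model_op]] model_op_simps adjacency_raise
      pCons.IH[of _ _ ]
    using f[of a b r]
    by (cases "(a, b) = (0, 0)")
      (auto simp: unit_vec_def vacuum_def algebra_simps pCons.IH split: nat.splits)
qed simp

lemma vacuum_not_raise_Both: "vacuum \<notin> range (raise Both)"
  by (simp add: vacuum_def range_raise)

text \<open>Every basis vector is uniquely \<open>C^k s\<close> with \<open>s\<close> not starting
  with \<open>C\<close>. If \<open>f\<close> lives on such \<open>s\<close>, the operator of
  \<open>C\<close> moves only \<open>k\<close>, exactly as on the vacuum.\<close>

lemma model_act_True:
  assumes f: "\<And>s. s \<in> range (raise Both) \<Longrightarrow> f s = 0" and s: "s \<notin> range (raise Both)"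
  shows "nc_act (model_op \<alpha> \<beta>) (alg_poly p (nc_var True)) f ((raise Both ^^ k) s) =
    nc_act (model_op \<alpha> \<beta>) (alg_poly p (nc_var True)) (unit_vec vacuum) ((raise Both ^^ k) vacuum) * f s"
proof (induction p arbitrary: k)
  case (pCons c p)
  let ?g = "nc_act (model_op \<alpha> \<beta>) (alg_poly p (nc_var True))"
  have f0: "c * f ((raise Both ^^ k) s) = c * unit_vec vacuum ((raise Both ^^ k) vacuum) * f s"
    using f vacuum_not_raise_Both
    by (cases k) (auto simp: unit_vec_def dest: sym)
  show ?case
  proof (cases k)
    case 0
    then show ?thesis
      using f0 pCons.IH[of 1]
      by (simp add: nc_act_alg_poly_pCons[OF sym_opD(1)[OF sym_op_model_op]] model_op_simps
          adjacency_simps(2)[OF s] adjacency_simps(2)[OF vacuum_not_raise_Both] distrib_right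
          del: alg_poly_pCons)
  next
    case (Suc k')
    then show ?thesis
      using f0 pCons.IH[of k'] pCons.IH[of "Suc (Suc k')"]
      by (simp add: nc_act_alg_poly_pCons[OF sym_opD(1)[OF sym_op_model_op]] model_op_simps
          adjacency_simps(1)[OF inj_raise] algebra_simps del: alg_poly_pCons)
  qed
qed simp

text \<open>Applied to the vacuum, an alternating centred product yields only basis vectors whose
  first letter belongs to the leftmost factor: a \<open>C\<close> for \<open>True\<close>, an
  \<open>A\<close> or \<open>B\<close> for \<open>False\<close>. Centring removes the component
  without such a letter, and the vacuum is none of these vectors.\<close>

lemma freely_independent_model: "freely_independent (model_state \<alpha> \<beta>) UNIV nc_var"
  unfolding freely_independent_def
proof (intro allI impI)
  fix ks and ps :: "bool ncpoly list"
  let ?act = "nc_act (model_op \<alpha> \<beta>)" and ?\<Omega> = "unit_vec vacuum"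
  note act_mult = nc_act_mult[OF sym_opD(1)[OF sym_op_model_op]]
  have centred: "?act p ?\<Omega> vacuum = 0" if "model_state \<alpha> \<beta> p = 0" for p
    using that by (simp add: vector_state_def)
  assume "ks \<noteq> []" "length ps = length ks" "set ks \<subseteq> UNIV" "distinct_adj ks"
    "\<forall>j<length ks. ps ! j \<in> generated_algebra {nc_var (ks ! j)} \<and> model_state \<alpha> \<beta> (ps ! j) = 0"
  then have "\<forall>s. ?act (prod_list ps) ?\<Omega> s \<noteq> 0 \<longrightarrow>
     (if hd ks then s \<in> range (raise Both) else fst s \<noteq> (0, 0))"
  proof (induction ks arbitrary: ps)
    case (Cons k ks)
    then obtain p ps' where ps: "ps = p # ps'" by (cases ps) auto
    have p: "p \<in> generated_algebra {nc_var k}" "model_state \<alpha> \<beta> p = 0"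
      using Cons.prems(5) ps by auto
    obtain P where P: "p = alg_poly P (nc_var k)"
      using p(1) by (rule generated_algebra_singleton_obtain)
    let ?f = "?act (prod_list ps') ?\<Omega>"
    \<comment> \<open>The remaining factors are either absent, which gives the vacuum, or begin with
      the other index, so no vector in \<open>?f\<close> starts with a letter of
      \<open>k\<close>.\<close>
    have f: "?f = ?\<Omega> \<or> (\<forall>s. ?f s \<noteq> 0 \<longrightarrow> (if \<not> k then s \<in> range (raise Both) else fst s \<noteq> (0, 0)))"
    proof (cases "ks = []")
      case True
      then have "ps' = []" using Cons.prems(2) ps by simp
      then show ?thesis by (simp add: nc_act_one)
    next
      case False
      have "hd ks \<noteq> k" using False Cons.prems(4) by (cases ks) auto
      moreover have "\<forall>s. ?f s \<noteq> 0 \<longrightarrow> (if hd ks then s \<in> range (raise Both) else fst s \<noteq> (0, 0))"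
      proof (rule Cons.IH)
        show "distinct_adj ks" using Cons.prems(4) by (cases ks) auto
        show "\<forall>j<length ks. ps' ! j \<in> generated_algebra {nc_var (ks ! j)} \<and> model_state \<alpha> \<beta> (ps' ! j) = 0"
          using Cons.prems(5) unfolding ps by fastforce
      qed (use Cons.prems(2) ps False in simp_all)
      ultimately show ?thesis by (cases k) auto
    qed
    show ?case
    proof (cases k)
      case False
      have "?f ((a, b), r) = 0" if "(a, b) \<noteq> (0, 0)" for a b r
      proof -
        have "((a, b), r) \<noteq> vacuum" using that by (auto simp: vacuum_def)
        moreover have "((a, b), r) \<notin> range (raise Both)" using that by (auto simp: range_raise)
        ultimately show ?thesis using f False by (metis (full_types) unit_vec_def)
      qed
      from model_act_False[of ?f \<alpha> \<beta> P 0 0, OF this] centred[OF p(2)] False P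
      show ?thesis by (auto simp: ps act_mult vacuum_def intro!: gr0I)
    next
      case True
      have f0: "?f s = 0" if "s \<in> range (raise Both)" for s
      proof -
        have "s \<noteq> vacuum" using that vacuum_not_raise_Both by blast
        moreover have "fst s = (0, 0)" using that by (cases s) (simp add: range_raise)
        ultimately show ?thesis using f True by (metis (full_types) unit_vec_def)
      qed
      have f1: "?act p ?f s = 0" if "s \<notin> range (raise Both)" for s
        using model_act_True[of ?f s \<alpha> \<beta> P 0, OF f0 that] centred[OF p(2)] True P by simp
      show ?thesis
        unfolding ps prod_list.Cons act_mult list.sel if_P[OF True] using f1 by blast
    qed
  qed simp
  moreover have "\<not> (if hd ks then vacuum \<in> range (raise Both) else fst vacuum \<noteq> (0, 0))"
    by (simp add: vacuum_def range_raise)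
  ultimately show "model_state \<alpha> \<beta> (prod_list ps) = 0"
    unfolding vector_state_def by blast
qed

section \<open>Semicircular moments\<close>

text \<open>Chebyshev polynomials of the second kind at \<open>t / 2\<close>, the orthonormal
  polynomials of the semicircle. Multiplication by \<open>t\<close> acts on them as the adjacency
  operator of the one-sided shift, which links Fock space coefficients to integrals.\<close>

fun chebyshev :: "nat \<Rightarrow> real \<Rightarrow> real" where
  "chebyshev 0 t = 1"
| "chebyshev (Suc 0) t = t"
| "chebyshev (Suc (Suc n)) t = t * chebyshev (Suc n) t - chebyshev n t"

lemma chebyshev_mult: "t * chebyshev n t = chebyshev (Suc n) t + (case n of 0 \<Rightarrow> 0 | Suc m \<Rightarrow> chebyshev m t)"
  by (cases n) simp_all

lemma continuous_on_chebyshev [continuous_intros]: "continuous_on A (chebyshev n)"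
proof (induction n rule: induct_nat_012)
  case (ge2 n)
  have "chebyshev (Suc (Suc n)) = (\<lambda>t. t * chebyshev (Suc n) t - chebyshev n t)" by auto
  with ge2 show ?case by (simp add: continuous_on_diff continuous_on_mult)
qed (simp_all add: fun_eq_iff[THEN iffD2, of "chebyshev 0" "\<lambda>_. 1"]
    fun_eq_iff[THEN iffD2, of "chebyshev (Suc 0)" "\<lambda>t. t"])

text \<open>The classical identity of \<open>U_n(cos \<theta>) sin \<theta>\<close> and
  \<open>sin((n + 1) \<theta>)\<close>; the minus sign makes the later substitution
  \<open>t = - 2 cos \<theta>\<close> increasing on \<open>{0..pi}\<close>.\<close>

lemma chebyshev_minus_cos: "chebyshev n (- 2 * cos \<theta>) * sin \<theta> = (- 1) ^ n * sin (real (Suc n) * \<theta>)"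
proof (induction n rule: induct_nat_012)
  case 1
  show ?case using sin_double[of \<theta>] by (simp add: mult.commute)
next
  case (ge2 n)
  have "sin (real (Suc (Suc (Suc n))) * \<theta>) + sin (real (Suc n) * \<theta>) = 2 * cos \<theta> * sin (real (Suc (Suc n)) * \<theta>)"
    using sin_times_cos[of "real (Suc (Suc n)) * \<theta>" \<theta>] by (simp add: algebra_simps)
  then have e: "sin (real (Suc (Suc (Suc n))) * \<theta>) = 2 * cos \<theta> * sin (real (Suc (Suc n)) * \<theta>) - sin (real (Suc n) * \<theta>)"
    by linarith
  have "chebyshev (Suc (Suc n)) (- 2 * cos \<theta>) * sin \<theta> =
     (- 2 * cos \<theta>) * (chebyshev (Suc n) (- 2 * cos \<theta>) * sin \<theta>) - chebyshev n (- 2 * cos \<theta>) * sin \<theta>"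
    by (simp add: algebra_simps)
  also have "\<dots> = (- 1) ^ Suc (Suc n) * sin (real (Suc (Suc (Suc n))) * \<theta>)"
    unfolding ge2.IH e by (simp add: algebra_simps)
  finally show ?case .
qed simp

lemma integral_sin_mult_sin:
  "((\<lambda>\<theta>. sin (real (Suc n) * \<theta>) * sin \<theta>) has_integral (if n = 0 then pi / 2 else 0)) {0..pi}"
proof (cases "n = 0")
  case True
  have "((\<lambda>\<theta>. sin \<theta> * sin \<theta>) has_integral (pi / 2 - sin (2 * pi) / 4) - (0 / 2 - sin (2 * 0) / 4)) {0..pi}"
  proof (rule fundamental_theorem_of_calculus)
    fix x :: real
    have "((\<lambda>x. x / 2 - sin (2 * x) / 4) has_real_derivative (1 / 2 - (cos (2 * x) * 2) / 4)) (at x within {0..pi})"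
      by (auto intro!: derivative_eq_intros)
    moreover have "1 / 2 - (cos (2 * x) * 2) / 4 = sin x * sin x"
      using cos_double_sin[of x] by (simp add: power2_eq_square field_simps)
    ultimately show "((\<lambda>x. x / 2 - sin (2 * x) / 4) has_vector_derivative sin x * sin x) (at x within {0..pi})"
      by (simp add: has_real_derivative_iff_has_vector_derivative)
  qed simp
  then show ?thesis using True by simp
next
  case False
  \<comment> \<open>The antiderivative divides by \<open>n\<close>, hence the separate case
    \<open>n = 0\<close>; its boundary values are sines at multiples of \<open>pi\<close>.\<close>
  let ?F = "\<lambda>x. sin (real n * x) / (2 * real n) - sin (real (n + 2) * x) / (2 * real (n + 2))"
  have "((\<lambda>\<theta>. sin (real (Suc n) * \<theta>) * sin \<theta>) has_integral ?F pi - ?F 0) {0..pi}"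
  proof (rule fundamental_theorem_of_calculus)
    fix x :: real
    have d: "((\<lambda>x. sin (k * x) / (2 * k)) has_real_derivative cos (k * x) / 2) (at x within {0..pi})"
      if "k \<noteq> 0" for k
      using that by (auto intro!: derivative_eq_intros)
    have "(?F has_real_derivative cos (real n * x) / 2 - cos (real (n + 2) * x) / 2) (at x within {0..pi})"
      by (intro DERIV_diff d) (use False in simp_all)
    moreover have "cos (real n * x) / 2 - cos (real (n + 2) * x) / 2 = sin (real (Suc n) * x) * sin x"
      using sin_times_sin[of "real (Suc n) * x" x] by (simp add: algebra_simps)
    ultimately show "(?F has_vector_derivative sin (real (Suc n) * x) * sin x) (at x within {0..pi})"
      by (simp add: has_real_derivative_iff_has_vector_derivative)
  qed simp
  moreover have "?F pi - ?F 0 = 0"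
    by (simp only: sin_npi mult_zero_right sin_zero)
  ultimately show ?thesis using False by simp
qed

lemma integral_chebyshev_semicircle:
  "integral {-2..2} (\<lambda>t. chebyshev n t * sqrt (4 - t\<^sup>2)) = (if n = 0 then 2 * pi else 0)"
proof -
  let ?f = "\<lambda>t. chebyshev n t * sqrt (4 - t\<^sup>2)"
  have "((\<lambda>\<theta>. (2 * sin \<theta>) *\<^sub>R ?f (- 2 * cos \<theta>)) has_integral
     integral {- 2 * cos 0 .. - 2 * cos pi} ?f) {0..pi}"
  proof (rule has_integral_substitution)
    show "(\<lambda>\<theta>. - 2 * cos \<theta>) ` {0..pi} \<subseteq> {-2..2}"
    proof safe
      fix \<theta> :: real
      show "- 2 * cos \<theta> \<in> {-2..2}" using cos_le_one[of \<theta>] cos_ge_minus_one[of \<theta>]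
        unfolding atLeastAtMost_iff by linarith
    qed
    show "continuous_on {-2..2} ?f" by (intro continuous_intros)
    show "((\<lambda>\<theta>. - 2 * cos \<theta>) has_real_derivative 2 * sin x) (at x within {0..pi})" for x
      by (auto intro!: derivative_eq_intros)
  qed auto
  moreover have "(2 * sin \<theta>) *\<^sub>R ?f (- 2 * cos \<theta>) = 4 * (-1) ^ n * (sin (real (Suc n) * \<theta>) * sin \<theta>)"
    if "\<theta> \<in> {0..pi}" for \<theta>
  proof -
    have "4 - (- 2 * cos \<theta>)\<^sup>2 = (2 * sin \<theta>)\<^sup>2"
      by (simp add: power_mult_distrib cos_squared_eq)
    then have "sqrt (4 - (- 2 * cos \<theta>)\<^sup>2) = 2 * sin \<theta>"
      using that sin_ge_zero[of \<theta>] by (simp only: real_sqrt_abs) simp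
    then have "(2 * sin \<theta>) *\<^sub>R ?f (- 2 * cos \<theta>) = 4 * sin \<theta> * (chebyshev n (- 2 * cos \<theta>) * sin \<theta>)"
      by simp
    then show ?thesis unfolding chebyshev_minus_cos by simp
  qed
  ultimately have "((\<lambda>\<theta>. 4 * (-1) ^ n * (sin (real (Suc n) * \<theta>) * sin \<theta>)) has_integral integral {-2..2} ?f) {0..pi}"
    by (subst has_integral_cong[symmetric]) auto
  moreover have "((\<lambda>\<theta>. 4 * (-1) ^ n * (sin (real (Suc n) * \<theta>) * sin \<theta>)) has_integral
      4 * (-1) ^ n * (if n = 0 then pi / 2 else 0)) {0..pi}"
    by (intro has_integral_mult_right integral_sin_mult_sin)
  ultimately have "integral {-2..2} ?f = 4 * (-1) ^ n * (if n = 0 then pi / 2 else 0)"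
    by (rule has_integral_unique)
  then show ?thesis by simp
qed

lemma semicircle_density_nonneg: "0 \<le> indicator {-2..2} x * sqrt (4 - x\<^sup>2) / (2 * pi)" for x :: real
proof (cases "x \<in> {-2..2}")
  case True
  then have "x\<^sup>2 \<le> 2\<^sup>2" by (intro power2_le_iff_abs_le[THEN iffD2]) auto
  then show ?thesis by simp
qed simp

lemma integrable_semicircle_density:
  assumes "continuous_on UNIV g"
  shows "set_integrable lborel {-2..2} (\<lambda>t. g t * sqrt (4 - t\<^sup>2) :: real)"
  by (intro borel_integrable_atLeastAtMost' continuous_intros continuous_on_subset[OF assms]) simp

lemma integral_semicircle:
  assumes "continuous_on UNIV (g :: real \<Rightarrow> real)"
  shows "integrable semicircle g"
    "(\<integral>t. g t \<partial>semicircle) = integral {-2..2} (\<lambda>t. g t * sqrt (4 - t\<^sup>2)) / (2 * pi)"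
proof -
  have [measurable]: "g \<in> borel_measurable borel"
    by (rule borel_measurable_continuous_onI[OF assms])
  let ?d = "\<lambda>x. indicator {-2..2} x * sqrt (4 - x\<^sup>2) / (2 * pi)"
  have e: "?d x *\<^sub>R g x = (indicator {-2..2} x *\<^sub>R (g x * sqrt (4 - x\<^sup>2))) / (2 * pi)" for x
    by simp
  note int = integrable_semicircle_density[OF assms]
  have "integrable lborel (\<lambda>x. ?d x *\<^sub>R g x)"
    unfolding e using int unfolding set_integrable_def by simp
  then show "integrable semicircle g"
    unfolding semicircle_def
    by (subst integrable_density) (auto intro!: semicircle_density_nonneg)
  have "(\<integral>t. g t \<partial>semicircle) = (\<integral>x. ?d x *\<^sub>R g x \<partial>lborel)"
    unfolding semicircle_def
    by (subst integral_density) (auto intro!: semicircle_density_nonneg)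
  also have "\<dots> = (LINT x:{-2..2}|lborel. g x * sqrt (4 - x\<^sup>2)) / (2 * pi)"
    unfolding e set_lebesgue_integral_def by simp
  finally show "(\<integral>t. g t \<partial>semicircle) = integral {-2..2} (\<lambda>t. g t * sqrt (4 - t\<^sup>2)) / (2 * pi)"
    using set_borel_integral_eq_integral(2)[OF int] by simp
qed

lemma chebyshev_semicircle: "(\<integral>t. chebyshev n t \<partial>semicircle) = (if n = 0 then 1 else 0)"
  by (subst integral_semicircle) (auto simp: integral_chebyshev_semicircle continuous_on_chebyshev)

lemma sets_semicircle [measurable_cong, simp]: "sets semicircle = sets borel"
  by (simp add: semicircle_def)

lemma space_semicircle [simp]: "space semicircle = UNIV"
  by (simp add: semicircle_def)

lemma prob_space_semicircle: "prob_space semicircle"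
proof (rule prob_spaceI)
  have m: "measure semicircle UNIV = 1"
    using chebyshev_semicircle[of 0] by simp
  \<comment> \<open>An infinite mass would have \<open>measure\<close> equal to
    \<open>0\<close>.\<close>
  moreover from m have "emeasure semicircle UNIV \<noteq> \<infinity>" by (auto simp: measure_def)
  ultimately show "emeasure semicircle (space semicircle) = 1"
    by (simp add: emeasure_eq_ennreal_measure)
qed

lemma AE_semicircle: "AE t in semicircle. \<bar>t\<bar> \<le> 2"
  unfolding semicircle_def
  by (subst AE_density) (auto simp: indicator_def)

section \<open>Distributions of the model operators\<close>

abbreviation "semicircle2 \<equiv> semicircle \<Otimes>\<^sub>M semicircle"

lemma prob_space_semicircle2: "prob_space semicircle2"
  by (rule prob_space_pair) (rule prob_space_semicircle)+

text \<open>Up to a null set the mass lies in a compact square, where a continuous function is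
  bounded.\<close>

lemma integrable_semicircle2:
  assumes g: "continuous_on UNIV (g :: real \<times> real \<Rightarrow> real)"
  shows "integrable semicircle2 g"
proof -
  interpret P: prob_space semicircle2 by (rule prob_space_semicircle2)
  interpret S: prob_space semicircle by (rule prob_space_semicircle)
  interpret Q: pair_sigma_finite semicircle semicircle ..
  have "compact (g ` cbox (-2, -2) (2, 2))"
    by (intro compact_continuous_image continuous_on_subset[OF g] compact_cbox) simp
  then obtain B where "\<forall>y\<in>g ` cbox (-2, -2) (2, 2). norm y \<le> B"
    using compact_imp_bounded bounded_iff by blast
  then have B: "norm (g z) \<le> B" if "z \<in> cbox (-2, -2) (2, 2)" for z using that by blast
  have "AE z in semicircle2. \<bar>fst z\<bar> \<le> 2 \<and> \<bar>snd z\<bar> \<le> 2"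
  proof (rule Q.AE_pair_measure)
    show "AE x in semicircle. AE y in semicircle. \<bar>fst (x, y)\<bar> \<le> 2 \<and> \<bar>snd (x, y)\<bar> \<le> 2"
      using AE_semicircle
    proof eventually_elim
      case (elim x)
      show ?case using AE_semicircle by eventually_elim (use elim in simp)
    qed
  qed measurable
  then have "AE z in semicircle2. norm (g z) \<le> B"
  proof eventually_elim
    case (elim z)
    then show ?case by (intro B) (auto simp: cbox_Pair_eq mem_Times_iff abs_le_iff)
  qed
  moreover have "g \<in> borel_measurable semicircle2"
    using borel_measurable_continuous_onI[OF g]
    by (simp add: measurable_cong_sets[OF sets_pair_measure_cong[OF sets_semicircle sets_semicircle] refl] borel_prod)
  ultimately show ?thesis by (rule P.integrable_const_bound)
qed

text \<open>The coefficient at \<open>A^a B^b\<close> of the \<open>m\<close>-th power of the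
  commuting sum applied to the vacuum, read in the orthonormal basis of products of Chebyshev
  polynomials.\<close>

definition pair_moment :: "nat \<Rightarrow> nat \<Rightarrow> nat \<Rightarrow> real" where
  "pair_moment m a b = (\<integral>z. chebyshev a (fst z) * chebyshev b (snd z) * (fst z + snd z) ^ m \<partial>semicircle2)"

lemma continuous_on_chebyshev_comp:
  "continuous_on A f \<Longrightarrow> continuous_on A (\<lambda>z. chebyshev n (f z))"
  by (rule continuous_on_compose2[OF continuous_on_chebyshev[of UNIV]]) auto

lemma integrable_pair_moment:
  "integrable semicircle2 (\<lambda>z. chebyshev a (fst z) * chebyshev b (snd z) * (fst z + snd z) ^ m)"
  by (intro integrable_semicircle2 continuous_on_mult continuous_on_chebyshev_comp continuous_on_power
      continuous_on_add continuous_on_fst continuous_on_snd continuous_on_id)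

lemma pair_moment_0: "pair_moment 0 a b = (if a = 0 \<and> b = 0 then 1 else 0)"
proof -
  interpret S: prob_space semicircle by (rule prob_space_semicircle)
  interpret P: pair_sigma_finite semicircle semicircle ..
  have "pair_moment 0 a b = (\<integral>x. \<integral>y. chebyshev a x * chebyshev b y \<partial>semicircle \<partial>semicircle)"
    using P.integral_fst'[OF integrable_pair_moment[of a b 0]] by (simp add: pair_moment_def)
  then show ?thesis by (simp add: chebyshev_semicircle)
qed

text \<open>Multiplying by \<open>x + y\<close> moves one of the Chebyshev indices up or down by
  one, which is the recursion of \<open>adjacency_raise\<close>.\<close>

lemma pair_moment_Suc:
  "pair_moment (Suc m) a b =
     pair_moment m (Suc a) b + (case a of 0 \<Rightarrow> 0 | Suc a' \<Rightarrow> pair_moment m a' b) +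
     (pair_moment m a (Suc b) + (case b of 0 \<Rightarrow> 0 | Suc b' \<Rightarrow> pair_moment m a b'))"
proof -
  let ?P = "\<lambda>a b z. chebyshev a (fst z) * chebyshev b (snd z) * (fst z + snd z) ^ m"
  let ?D = "\<lambda>f n. case n of 0 \<Rightarrow> 0 :: real | Suc n' \<Rightarrow> f n'"
  have "chebyshev a (fst z) * chebyshev b (snd z) * (fst z + snd z) ^ Suc m =
      (fst z * chebyshev a (fst z)) * chebyshev b (snd z) * (fst z + snd z) ^ m +
      chebyshev a (fst z) * (snd z * chebyshev b (snd z)) * (fst z + snd z) ^ m" for z
    by (simp add: algebra_simps)
  also have "\<dots> z = ?P (Suc a) b z + ?D (\<lambda>a'. ?P a' b z) a + (?P a (Suc b) z + ?D (\<lambda>b'. ?P a b' z) b)" for z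
    unfolding chebyshev_mult by (cases a; cases b) (simp_all add: algebra_simps)
  finally have "pair_moment (Suc m) a b =
     (\<integral>z. ?P (Suc a) b z + ?D (\<lambda>a'. ?P a' b z) a + (?P a (Suc b) z + ?D (\<lambda>b'. ?P a b' z) b) \<partial>semicircle2)"
    unfolding pair_moment_def by simp
  moreover have d: "integrable semicircle2 (\<lambda>z. ?D (\<lambda>a'. ?P a' b z) a)"
    "integrable semicircle2 (\<lambda>z. ?D (\<lambda>b'. ?P a b' z) b)"
    by (cases a; simp add: integrable_pair_moment; fail) (cases b; simp add: integrable_pair_moment)
  ultimately have "pair_moment (Suc m) a b = pair_moment m (Suc a) b + (\<integral>z. ?D (\<lambda>a'. ?P a' b z) a \<partial>semicircle2) +
     (pair_moment m a (Suc b) + (\<integral>z. ?D (\<lambda>b'. ?P a b' z) b \<partial>semicircle2))"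
    by (simp add: pair_moment_def integrable_pair_moment d)
  moreover have "(\<integral>z. ?D (\<lambda>a'. ?P a' b z) a \<partial>semicircle2) = (case a of 0 \<Rightarrow> 0 | Suc a' \<Rightarrow> pair_moment m a' b)"
    by (simp add: pair_moment_def split: nat.split)
  moreover have "(\<integral>z. ?D (\<lambda>b'. ?P a b' z) b \<partial>semicircle2) = (case b of 0 \<Rightarrow> 0 | Suc b' \<Rightarrow> pair_moment m a b')"
    by (simp add: pair_moment_def split: nat.split)
  ultimately show ?thesis by simp
qed

lemma model_False_power:
  "(model_op \<alpha> \<beta> False ^^ m) (unit_vec vacuum) ((a, b), []) = of_real (\<alpha> ^ m * pair_moment m a b)"
proof (induction m arbitrary: a b)
  case 0
  show ?case by (simp add: pair_moment_0 unit_vec_def vacuum_def)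
next
  case (Suc m)
  let ?f = "(model_op \<alpha> \<beta> False ^^ m) (unit_vec vacuum)"
  have "(model_op \<alpha> \<beta> False ^^ Suc m) (unit_vec vacuum) ((a, b), []) =
      of_real \<alpha> * (adjacency (raise First) ?f ((a, b), []) + adjacency (raise Second) ?f ((a, b), []))"
    unfolding funpow.simps comp_def by (rule model_op_simps)
  then show ?case
    by (simp add: adjacency_raise Suc pair_moment_Suc distrib_left split: nat.split)
qed

text \<open>The one-variable analogue of \<open>pair_moment\<close>, for the basis vectors
  \<open>C^k\<close>.\<close>

definition semicircle_moment :: "nat \<Rightarrow> nat \<Rightarrow> real" where
  "semicircle_moment m k = (\<integral>t. chebyshev k t * t ^ m \<partial>semicircle)"

lemma integrable_semicircle_moment: "integrable semicircle (\<lambda>t. chebyshev k t * t ^ m)"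
  by (intro integral_semicircle continuous_on_mult continuous_on_chebyshev continuous_on_power continuous_on_id)

lemma semicircle_moment_Suc:
  "semicircle_moment (Suc m) k =
     semicircle_moment m (Suc k) + (case k of 0 \<Rightarrow> 0 | Suc k' \<Rightarrow> semicircle_moment m k')"
proof -
  let ?P = "\<lambda>k t. chebyshev k t * t ^ m"
  have "chebyshev k t * t ^ Suc m = (t * chebyshev k t) * t ^ m" for t by simp
  also have "\<dots> t = ?P (Suc k) t + (case k of 0 \<Rightarrow> 0 | Suc k' \<Rightarrow> ?P k' t)" for t
    unfolding chebyshev_mult by (cases k) (simp_all add: algebra_simps)
  finally have "semicircle_moment (Suc m) k = (\<integral>t. ?P (Suc k) t + (case k of 0 \<Rightarrow> 0 | Suc k' \<Rightarrow> ?P k' t) \<partial>semicircle)"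
    unfolding semicircle_moment_def by simp
  also have "\<dots> = semicircle_moment m (Suc k) + (\<integral>t. (case k of 0 \<Rightarrow> 0 | Suc k' \<Rightarrow> ?P k' t) \<partial>semicircle)"
    unfolding semicircle_moment_def
    by (intro Bochner_Integration.integral_add integrable_semicircle_moment)
      (cases k; simp add: integrable_semicircle_moment)
  finally show ?thesis by (simp add: semicircle_moment_def split: nat.splits)
qed

lemma model_True_power:
  "(model_op \<alpha> \<beta> True ^^ m) (unit_vec vacuum) ((raise Both ^^ k) vacuum) = of_real (\<beta> ^ m * semicircle_moment m k)"
proof (induction m arbitrary: k)
  case 0
  have "(raise Both ^^ k) vacuum = vacuum \<longleftrightarrow> k = 0"
    using vacuum_not_raise_Both by (cases k) (auto dest: sym)
  then show ?case by (simp add: semicircle_moment_def chebyshev_semicircle unit_vec_def)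
next
  case (Suc m)
  let ?f = "(model_op \<alpha> \<beta> True ^^ m) (unit_vec vacuum)"
  have step: "(model_op \<alpha> \<beta> True ^^ Suc m) (unit_vec vacuum) s = of_real \<beta> * adjacency (raise Both) ?f s" for s
    unfolding funpow.simps comp_def by (rule model_op_simps)
  show ?case
  proof (cases k)
    case 0
    then show ?thesis using step[of vacuum] Suc.IH[of 1]
      by (simp add: adjacency_simps(2)[OF vacuum_not_raise_Both] semicircle_moment_Suc)
  next
    case (Suc k')
    then show ?thesis using step[of "(raise Both ^^ Suc k') vacuum"] Suc.IH[of "Suc (Suc k')"] Suc.IH[of k']
      by (simp add: adjacency_simps(1)[OF inj_raise] semicircle_moment_Suc distrib_left)
  qed
qed

lemma model_state_var_power:
  "model_state \<alpha> \<beta> (nc_var i ^ m) = (model_op \<alpha> \<beta> i ^^ m) (unit_vec vacuum) vacuum"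
  by (simp add: vector_state_def nc_act_power[OF sym_opD(1)[OF sym_op_model_op]] nc_act_var[abs_def])

lemma has_distribution_model_True:
  "has_distribution (model_state \<alpha> \<beta>) (nc_var True) (dilation \<beta> semicircle)"
  unfolding has_distribution_def
proof (intro allI conjI)
  fix m
  have "integrable semicircle (\<lambda>t. (\<beta> * t) ^ m)"
    by (intro integral_semicircle continuous_intros)
  then show "integrable (dilation \<beta> semicircle) (\<lambda>t. t ^ m)"
    unfolding dilation_def by (subst integrable_distr_eq) auto
  have "(\<integral>t. t ^ m \<partial>dilation \<beta> semicircle) = (\<integral>t. (\<beta> * t) ^ m \<partial>semicircle)"
    unfolding dilation_def by (rule integral_distr) auto
  then show "model_state \<alpha> \<beta> (nc_var True ^ m) = of_real (\<integral>t. t ^ m \<partial>dilation \<beta> semicircle)"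
    using model_True_power[where k = 0 and m = m and \<alpha> = \<alpha> and \<beta> = \<beta>]
    by (simp add: model_state_var_power power_mult_distrib semicircle_moment_def)
qed

lemma has_distribution_model_False:
  "has_distribution (model_state (c / sqrt 2) \<beta>) (nc_var False)
     (dilation c (convolution (dilation (1 / sqrt 2) semicircle) (dilation (1 / sqrt 2) semicircle)))"
    (is "has_distribution _ _ ?\<mu>")
proof -
  let ?D = "dilation (1 / sqrt 2) semicircle"
  interpret S: prob_space semicircle by (rule prob_space_semicircle)
  have D: "prob_space ?D" unfolding dilation_def by (rule S.prob_space_distr) simp
  then interpret D: prob_space ?D .
  have pair: "?D \<Otimes>\<^sub>M ?D = distr semicircle2 (borel \<Otimes>\<^sub>M borel) (\<lambda>(x, y). (1 / sqrt 2 * x, 1 / sqrt 2 * y))"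
    unfolding dilation_def
    by (intro pair_measure_distr D.sigma_finite_measure_axioms[unfolded dilation_def]) simp_all
  have "?\<mu> = distr semicircle2 borel (\<lambda>z. c / sqrt 2 * (fst z + snd z))"
    unfolding dilation_def[of c] convolution_def pair
    by (subst distr_distr) (auto simp: distr_distr o_def case_prod_unfold algebra_simps add_divide_distrib)
  then have \<mu>: "?\<mu> = distr semicircle2 borel (\<lambda>z. c / sqrt 2 * (fst z + snd z))" .
  have meas: "(\<lambda>z. c / sqrt 2 * (fst z + snd z)) \<in> borel_measurable semicircle2" by measurable
  show ?thesis
    unfolding has_distribution_def
  proof (intro allI conjI)
    fix m
    have "integrable semicircle2 (\<lambda>z. (c / sqrt 2 * (fst z + snd z)) ^ m)"
      by (intro integrable_semicircle2 continuous_intros)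
    then show "integrable ?\<mu> (\<lambda>t. t ^ m)"
      unfolding \<mu> by (subst integrable_distr_eq[OF meas]) auto
    have "(\<integral>t. t ^ m \<partial>?\<mu>) = (\<integral>z. (c / sqrt 2 * (fst z + snd z)) ^ m \<partial>semicircle2)"
      unfolding \<mu> by (rule integral_distr[OF meas]) auto
    also have "\<dots> = (c / sqrt 2) ^ m * pair_moment m 0 0"
      by (simp only: pair_moment_def power_mult_distrib chebyshev.simps mult_1 Bochner_Integration.integral_mult_right_zero)
    finally show "model_state (c / sqrt 2) \<beta> (nc_var False ^ m) = of_real (\<integral>t. t ^ m \<partial>?\<mu>)"
      using model_False_power[where a = 0 and b = 0 and m = m and \<alpha> = "c / sqrt 2" and \<beta> = \<beta>]
      unfolding model_state_var_power by (simp add: vacuum_def)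
  qed
qed

section \<open>Compactly supported measures with given moments\<close>

text \<open>\<open>\<mu> k l\<close> plays the role of the integral of \<open>t\<^sup>k (1 - t)\<^sup>l\<close>. The measures with weight
  \<open>(n choose k) \<mu> k (n - k)\<close> at \<open>k / n\<close> have moments converging to \<open>\<mu> j 0\<close>.\<close>

locale hausdorff_moments =
  fixes \<mu> :: "nat \<Rightarrow> nat \<Rightarrow> real"
  assumes nonneg: "\<mu> k l \<ge> 0" and split: "\<mu> k l = \<mu> (Suc k) l + \<mu> k (Suc l)" and unit: "\<mu> 0 0 = 1"
begin

text \<open>With \<mu> read as an integral, this expands \<open>(t + (1 - t)) ^ n = 1\<close>; the
  proof combines Pascal's rule with \<open>split\<close>.\<close>

lemma binomial_sum: "(\<Sum>k\<le>n. real (n choose k) * \<mu> (a + k) (b + (n - k))) = \<mu> a b"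
proof (induction n arbitrary: a b)
  case (Suc n)
  have "(\<Sum>k\<le>Suc n. real (Suc n choose k) * \<mu> (a + k) (b + (Suc n - k)))
      = \<mu> a (b + Suc n) + (\<Sum>k\<le>n. real (Suc n choose Suc k) * \<mu> (a + Suc k) (b + (n - k)))"
    by (subst sum.atMost_Suc_shift) simp
  also have "\<dots> = (\<mu> a (b + Suc n) + (\<Sum>k\<le>n. real (n choose Suc k) * \<mu> (a + Suc k) (b + (n - k))))
      + (\<Sum>k\<le>n. real (n choose k) * \<mu> (Suc a + k) (b + (n - k)))"
    by (simp add: sum.distrib distrib_right)
  also have "\<mu> a (b + Suc n) + (\<Sum>k\<le>n. real (n choose Suc k) * \<mu> (a + Suc k) (b + (n - k)))
      = (\<Sum>k\<le>Suc n. real (n choose k) * \<mu> (a + k) (b + (Suc n - k)))"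
    by (subst sum.atMost_Suc_shift) simp
  also have "\<dots> = (\<Sum>k\<le>n. real (n choose k) * \<mu> (a + k) (Suc b + (n - k)))"
    by (simp add: Suc_diff_le)
  finally show ?case using Suc[of a "Suc b"] Suc[of "Suc a" b] split[of a b] by simp
qed simp

definition weight :: "nat \<Rightarrow> nat \<Rightarrow> real" where
  "weight n k = (if k \<le> n then real (n choose k) * \<mu> k (n - k) else 0)"

definition weight_pmf :: "nat \<Rightarrow> nat pmf" where
  "weight_pmf n = embed_pmf (weight n)"

lemma pmf_weight: "pmf (weight_pmf n) k = weight n k"
  unfolding weight_pmf_def
proof (rule pmf_embed_pmf)
  show "0 \<le> weight n k" for k by (simp add: weight_def nonneg)
  have "(\<integral>\<^sup>+k. ennreal (weight n k) \<partial>count_space UNIV) = (\<Sum>k\<le>n. ennreal (weight n k))"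
    by (rule nn_integral_count_space'[of "{..n}"]) (auto simp: weight_def)
  also have "\<dots> = ennreal (\<Sum>k\<le>n. weight n k)"
    by (rule sum_ennreal) (simp add: weight_def nonneg)
  also have "(\<Sum>k\<le>n. weight n k) = 1"
    using binomial_sum[of n 0 0] unit by (simp add: weight_def)
  finally show "(\<integral>\<^sup>+k. ennreal (weight n k) \<partial>count_space UNIV) = 1" by simp
qed

text \<open>For \<open>n = 0\<close> all mass sits at \<open>0 / 0 = 0\<close>, so this is a
  probability measure on the unit interval for every \<open>n\<close>.\<close>

definition approx :: "nat \<Rightarrow> real measure" where
  "approx n = distr (weight_pmf n) borel (\<lambda>k. real k / real n)"

lemma set_weight_pmf: "set_pmf (weight_pmf n) \<subseteq> {..n}"
  by (auto simp: set_pmf_eq pmf_weight weight_def split: if_splits)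

lemma integral_approx:
  assumes [measurable]: "f \<in> borel_measurable borel"
  shows "(\<integral>t. f t \<partial>approx n) = (\<Sum>k\<le>n. weight n k * f (real k / real n))"
proof -
  have "(\<integral>t. f t \<partial>approx n) = (\<integral>k. f (real k / real n) \<partial>weight_pmf n)"
    unfolding approx_def by (rule integral_distr) auto
  also have "\<dots> = (\<Sum>k\<le>n. weight n k * f (real k / real n))"
    by (subst integral_measure_pmf[of "{..n}"]) (use set_weight_pmf in \<open>auto simp: pmf_weight\<close>)
  finally show ?thesis .
qed

lemma real_distribution_approx: "real_distribution (approx n)"
  unfolding approx_def by (rule prob_space.real_distribution_distr) (auto simp: prob_space_measure_pmf)

lemma tight_approx: "tight approx"
  unfolding tight_def
proof (intro conjI allI impI)
  show "real_distribution (approx n)" for n by (rule real_distribution_approx)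
  fix \<epsilon> :: real assume \<epsilon>: "0 < \<epsilon>"
  \<comment> \<open>Tightness asks for intervals open on the left; \<open>-1\<close> keeps a
    possible atom at \<open>0\<close> inside.\<close>
  have "measure (approx n) {-1<..1} = 1" for n
  proof -
    have "measure (approx n) {-1<..1} = (\<integral>t. indicator {-1<..1} t \<partial>approx n)"
      using real_distribution.axioms(1)[OF real_distribution_approx, of n]
      by (simp add: approx_def)
    also have "\<dots> = (\<Sum>k\<le>n. weight n k * indicator {-1<..1} (real k / real n))"
      by (rule integral_approx) simp
    also have "\<dots> = (\<Sum>k\<le>n. weight n k)"
      by (rule sum.cong) (auto simp: indicator_def divide_le_eq_1 less_le_trans[of "-1" 0])
    also have "\<dots> = 1" using binomial_sum[of n 0 0] unit by (simp add: weight_def)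
    finally show ?thesis .
  qed
  with \<epsilon> show "\<exists>a b. a < b \<and> (\<forall>n. 1 - \<epsilon> < measure (approx n) {a<..b})"
    by (intro exI[of _ "-1"] exI[of _ 1]) auto
qed

text \<open>Choosing \<open>k\<close> out of \<open>n\<close> and then \<open>j\<close> out of
  \<open>k\<close> amounts to choosing \<open>j\<close> first and \<open>k - j\<close> from the
  rest; the remaining sum is \<open>binomial_sum\<close>. Binomial moments are thus exact, without
  an error term.\<close>

lemma factorial_moment:
  assumes "j \<le> n"
  shows "(\<Sum>k\<le>n. weight n k * real (k choose j)) = real (n choose j) * \<mu> j 0"
proof -
  have "(\<Sum>k\<le>n. weight n k * real (k choose j)) = (\<Sum>k=j..n. weight n k * real (k choose j))"
    by (rule sum.mono_neutral_right) auto
  also have "\<dots> = (\<Sum>k\<le>n - j. weight n (k + j) * real ((k + j) choose j))"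
    by (rule sum.reindex_bij_witness[of _ "\<lambda>k. k + j" "\<lambda>k. k - j"]) (use assms in auto)
  also have "\<dots> = (\<Sum>k\<le>n - j. real (n choose j) * (real ((n - j) choose k) * \<mu> (j + k) (0 + ((n - j) - k))))"
  proof (rule sum.cong)
    fix k assume "k \<in> {..n - j}"
    then have k: "k + j \<le> n" using assms by auto
    have "(n choose (k + j)) * ((k + j) choose j) = (n choose j) * ((n - j) choose k)"
      using choose_mult[of j "k + j" n] k by simp
    then have "real (n choose (k + j)) * real ((k + j) choose j) = real (n choose j) * real ((n - j) choose k)"
      by (metis of_nat_mult)
    then show "weight n (k + j) * real ((k + j) choose j) =
        real (n choose j) * (real ((n - j) choose k) * \<mu> (j + k) (0 + ((n - j) - k)))"
      using k by (simp add: weight_def add.commute diff_diff_eq)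
  qed simp
  also have "\<dots> = real (n choose j) * \<mu> j 0"
    unfolding sum_distrib_left[symmetric] binomial_sum ..
  finally show ?thesis .
qed

lemma falling_prod: "(\<Prod>i<j. (real k - real i) / real n) = fact j / real n ^ j * real (k choose j)"
  by (simp add: binomial_gbinomial gbinomial_prod_rev prod_dividef atLeast0LessThan)

text \<open>The power of \<open>k / n\<close> differs from the normalised falling factorial
  \<open>?p k n\<close>, whose mean is exact, by at most \<open>j\<^sup>2 / n\<close>; and
  \<open>?p n n\<close> tends to \<open>1\<close>.\<close>

lemma approx_moment: "(\<lambda>n. \<Sum>k\<le>n. weight n k * (real k / real n) ^ j) \<longlonglongrightarrow> \<mu> j 0"
proof -
  let ?p = "\<lambda>k n. \<Prod>i<j. (real k - real i) / real n"
  have "eventually (\<lambda>n. norm ((\<Sum>k\<le>n. weight n k * (real k / real n) ^ j) - ?p n n * \<mu> j 0)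
      \<le> real j * real j / real n) sequentially"
    using eventually_gt_at_top[of j]
  proof eventually_elim
    case (elim n)
    have w1: "(\<Sum>k\<le>n. weight n k) = 1" using binomial_sum[of n 0 0] unit by (simp add: weight_def)
    have "?p n n * \<mu> j 0 = (\<Sum>k\<le>n. weight n k * ?p k n)"
    proof -
      have "(\<Sum>k\<le>n. weight n k * ?p k n) = fact j / real n ^ j * (\<Sum>k\<le>n. weight n k * real (k choose j))"
        unfolding falling_prod sum_distrib_left by (simp add: mult_ac)
      then show ?thesis using factorial_moment[of j n] elim unfolding falling_prod by simp
    qed
    then have "(\<Sum>k\<le>n. weight n k * (real k / real n) ^ j) - ?p n n * \<mu> j 0
        = (\<Sum>k\<le>n. weight n k * ((real k / real n) ^ j - ?p k n))"
      by (simp add: sum_subtractf right_diff_distrib)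
    also have "norm \<dots> \<le> (\<Sum>k\<le>n. weight n k * (real j * real j / real n))"
    proof (rule sum_norm_le)
      fix k assume k: "k \<in> {..n}"
      have "norm ((\<Prod>i<j. real k / real n) - ?p k n) \<le> (\<Sum>i<j. norm (real k / real n - (real k - real i) / real n))"
      proof (rule norm_prod_diff)
        show "norm ((real k - real i) / real n) \<le> 1" if "i \<in> {..<j}" for i
          using k elim that by (auto simp: divide_le_eq_1 abs_le_iff)
        show "norm (real k / real n) \<le> 1" for i :: nat
          using k by (auto simp: divide_le_eq_1)
      qed
      also have "\<dots> \<le> (\<Sum>i<j. real j / real n)"
        by (intro sum_mono) (auto simp: diff_divide_distrib divide_right_mono)
      finally have "norm ((real k / real n) ^ j - ?p k n) \<le> real j * real j / real n" by simp
      then show "norm (weight n k * ((real k / real n) ^ j - ?p k n)) \<le> weight n k * (real j * real j / real n)"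
        unfolding norm_mult by (intro mult_mono) (auto simp: weight_def nonneg)
    qed
    also have "\<dots> = real j * real j / real n" unfolding sum_distrib_right[symmetric] w1 by simp
    finally show ?case .
  qed
  moreover have "(\<lambda>n. real j * real j / real n) \<longlonglongrightarrow> 0" by (rule lim_const_over_n)
  ultimately have "(\<lambda>n. (\<Sum>k\<le>n. weight n k * (real k / real n) ^ j) - ?p n n * \<mu> j 0) \<longlonglongrightarrow> 0"
    by (rule Lim_null_comparison)
  moreover have "(\<lambda>n. ?p n n * \<mu> j 0) \<longlonglongrightarrow> (\<Prod>i<j. 1) * \<mu> j 0"
  proof (intro tendsto_mult tendsto_prod tendsto_const)
    fix i
    have "(\<lambda>n. 1 - real i / real n) \<longlonglongrightarrow> 1 - 0"
      by (intro tendsto_diff tendsto_const lim_const_over_n)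
    then have "(\<lambda>n. 1 - real i / real n) \<longlonglongrightarrow> 1" by simp
    then show "(\<lambda>n. (real n - real i) / real n) \<longlonglongrightarrow> 1"
      by (rule Lim_transform_eventually)
        (use eventually_gt_at_top[of 0] in \<open>eventually_elim; simp add: diff_divide_distrib\<close>)
  qed
  ultimately show ?thesis using tendsto_add by fastforce
qed

theorem representing_measure:
  obtains \<rho> where "real_distribution \<rho>" "AE t in \<rho>. t \<in> {0..1}" "\<And>j. (\<integral>t. t ^ j \<partial>\<rho>) = \<mu> j 0"
proof -
  \<comment> \<open>Clamping makes \<open>t ^ j\<close> bounded and continuous, as weak convergence
    demands, fixes the atoms of \<open>approx n\<close>, and forces the limit law into
    \<open>{0..1}\<close>.\<close>
  define clamp :: "real \<Rightarrow> real" where "clamp t = max 0 (min 1 t)" for t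
  have clamp: "clamp t \<in> {0..1}" for t by (simp add: clamp_def)
  have cont: "isCont clamp t" for t unfolding clamp_def by (intro continuous_intros)
  have [measurable]: "clamp \<in> borel_measurable borel"
    using cont by (intro borel_measurable_continuous_onI) (simp add: continuous_at_imp_continuous_on)
  obtain r M where r: "strict_mono (r :: nat \<Rightarrow> nat)" and M: "real_distribution M"
    and conv: "weak_conv_m (approx \<circ> r) M"
    using tight_imp_convergent_subsubsequence[OF tight_approx strict_mono_id] by (auto simp: o_def)
  interpret M: real_distribution M by (rule M)
  have r_top: "filterlim r at_top sequentially" by (rule filterlim_subseq[OF r])
  have moment: "(\<integral>t. clamp t ^ j \<partial>M) = \<mu> j 0" for j
  proof (rule LIMSEQ_unique)
    show "(\<lambda>n. \<integral>t. clamp t ^ j \<partial>(approx \<circ> r) n) \<longlonglongrightarrow> (\<integral>t. clamp t ^ j \<partial>M)"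
    proof (rule weak_conv_imp_integral_bdd_continuous_conv[OF _ M conv])
      show "norm (clamp t ^ j) \<le> 1" for t
        using clamp[of t] by (simp add: power_le_one)
    qed (auto intro!: real_distribution_approx continuous_power cont)
    have "(\<integral>t. clamp t ^ j \<partial>approx n) = (\<Sum>k\<le>n. weight n k * (real k / real n) ^ j)" for n
    proof -
      have "clamp (real k / real n) = real k / real n" if "k \<le> n" for k
      proof -
        have "real k / real n \<le> 1" using that by (cases "n = 0") (auto simp: divide_le_eq_1)
        then show ?thesis by (simp add: clamp_def)
      qed
      then show ?thesis by (subst integral_approx) (auto intro!: sum.cong)
    qed
    then show "(\<lambda>n. \<integral>t. clamp t ^ j \<partial>(approx \<circ> r) n) \<longlonglongrightarrow> \<mu> j 0"
      using filterlim_compose[OF approx_moment r_top, of j] by simp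
  qed
  show ?thesis
  proof
    show "real_distribution (distr M borel clamp)" by simp
    show "AE t in distr M borel clamp. t \<in> {0..1}"
      using clamp by (subst AE_distr_iff) auto
    show "(\<integral>t. t ^ j \<partial>distr M borel clamp) = \<mu> j 0" for j
      using moment[of j] by (subst integral_distr) auto
  qed
qed

end

text \<open>Bounded support makes the Taylor remainder of the characteristic function at most
  \<open>2 (|t| |K|)^n / n!\<close>, so the moments determine it, and Levy's uniqueness theorem
  applies.\<close>

lemma compact_moments_unique:
  assumes M: "real_distribution M1" "real_distribution M2"
    and supp: "AE t in M1. \<bar>t\<bar> \<le> K1" "AE t in M2. \<bar>t\<bar> \<le> K2"
    and mom: "\<And>m::nat. (\<integral>t. t ^ m \<partial>M1) = (\<integral>t. t ^ m \<partial>M2)"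
  shows "M1 = M2"
proof (rule Levy_uniqueness[OF M])
  have char: "(\<lambda>n. \<Sum>k\<le>n. ((\<i> * t) ^ k / fact k) * (\<integral>x. x ^ k \<partial>M)) \<longlonglongrightarrow> char M t"
    if M: "real_distribution M" and K: "AE t in M. \<bar>t\<bar> \<le> K" for M K t
  proof -
    interpret real_distribution M by (rule M)
    have bound: "AE x in M. norm (\<bar>x\<bar> ^ n) \<le> \<bar>K\<bar> ^ n" for n
      using K by eventually_elim (auto intro!: power_mono)
    have int: "integrable M (\<lambda>x. \<bar>x\<bar> ^ n)" for n
      using bound[of n] by (rule integrable_const_bound) simp
    have int': "integrable M (\<lambda>x. x ^ n)" for n
      using bound[of n] by (intro integrable_const_bound[of _ "\<bar>K\<bar> ^ n"]) (simp_all add: power_abs)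
    have "\<forall>n. norm ((\<Sum>k\<le>n. ((\<i> * t) ^ k / fact k) * (\<integral>x. x ^ k \<partial>M)) - char M t) \<le> 2 * (\<bar>t\<bar> * \<bar>K\<bar>) ^ n / fact n"
    proof
      fix n
      have "(\<integral>x. \<bar>x\<bar> ^ n \<partial>M) \<le> (\<integral>x. \<bar>K\<bar> ^ n \<partial>M)"
        using bound[of n] by (intro integral_mono_AE int) auto
      moreover have "prob UNIV = 1" using prob_space by simp
      ultimately have "(\<integral>x. \<bar>x\<bar> ^ n \<partial>M) \<le> \<bar>K\<bar> ^ n" by simp
      then have "2 * \<bar>t\<bar> ^ n / fact n * (\<integral>x. \<bar>x\<bar> ^ n \<partial>M) \<le> 2 * \<bar>t\<bar> ^ n / fact n * \<bar>K\<bar> ^ n"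
        by (intro mult_left_mono) auto
      then show "norm ((\<Sum>k\<le>n. ((\<i> * t) ^ k / fact k) * (\<integral>x. x ^ k \<partial>M)) - char M t) \<le> 2 * (\<bar>t\<bar> * \<bar>K\<bar>) ^ n / fact n"
        using char_approx1[of n t, OF int'] by (subst norm_minus_commute) (simp add: power_mult_distrib)
    qed
    moreover have "(\<lambda>n. 2 * (\<bar>t\<bar> * \<bar>K\<bar>) ^ n / fact n) \<longlonglongrightarrow> 0"
      using tendsto_mult_right_zero[OF summable_LIMSEQ_zero[OF summable_exp[of "\<bar>t\<bar> * \<bar>K\<bar>"]], of 2]
      by (simp add: field_simps)
    ultimately have "(\<lambda>n. (\<Sum>k\<le>n. ((\<i> * t) ^ k / fact k) * (\<integral>x. x ^ k \<partial>M)) - char M t) \<longlonglongrightarrow> 0"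
      by (rule Lim_null_comparison[OF always_eventually])
    then show ?thesis by (simp add: LIM_zero_iff)
  qed
  show "char M1 = char M2"
  proof
    fix t
    show "char M1 t = char M2 t"
      using char[OF M(1) supp(1), of t] char[OF M(2) supp(2), of t] unfolding mom by (rule LIMSEQ_unique)
  qed
qed

section \<open>Spectral measures of bounded symmetric operators\<close>

definition pos_op :: "(('s \<Rightarrow> complex) \<Rightarrow> 's \<Rightarrow> complex) \<Rightarrow> bool" where
  "pos_op T \<longleftrightarrow> (\<forall>f. fin_supp f \<longrightarrow> l2_inner f (T f) \<in> \<real>\<^sub>\<ge>\<^sub>0)"

lemma cnj_l2_inner:
  assumes "fin_supp f"
  shows "cnj (l2_inner f g) = l2_inner g f"
proof -
  have fin: "finite {s. f s \<noteq> 0}" using assms by (simp add: fin_supp_def)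
  have "l2_inner f g = (\<Sum>\<^sub>\<infinity>s\<in>{s. f s \<noteq> 0}. cnj (f s) * g s)"
    unfolding l2_inner_def by (rule infsum_cong_neutral) auto
  moreover have "l2_inner g f = (\<Sum>\<^sub>\<infinity>s\<in>{s. f s \<noteq> 0}. cnj (g s) * f s)"
    unfolding l2_inner_def by (rule infsum_cong_neutral) auto
  ultimately show ?thesis using fin by (simp add: mult.commute)
qed

text \<open>\<open>T\<close> and \<open>R\<close> play the roles of \<open>t\<close> and
  \<open>1 - t\<close>. Symmetry moves one factor of an equal pair to the other side, which lowers
  \<open>k + l\<close> by two. Besides the immediate cases only \<open>T R\<close> remains, and it
  equals \<open>T R T + R T R\<close>.\<close>

lemma pos_op_power_mult:
  assumes T: "sym_op T" and R: "sym_op R" and commute: "\<And>f. T (R f) = R (T f)"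
    and one: "\<And>f. (\<lambda>s. T f s + R f s) = f" and pos: "pos_op T" "pos_op R"
    and f: "fin_supp f"
  shows "l2_inner f ((T ^^ k) ((R ^^ l) f)) \<in> \<real>\<^sub>\<ge>\<^sub>0"
  using f
proof (induction "k + l" arbitrary: k l f rule: less_induct)
  case less
  have RT: "(R ^^ l) (T f) = T ((R ^^ l) f)" for l f
    by (induction l) (simp_all add: commute)
  have TR: "(T ^^ k) (R f) = R ((T ^^ k) f)" for k f
    by (induction k) (simp_all add: commute)
  have fin: "fin_supp ((T ^^ k) ((R ^^ l) f))" for k l
    using less.prems T R by (intro sym_op_comp_pow)
  consider "k \<ge> 2" | "l \<ge> 2" | "k = 0" "l = 0" | "k = 1" "l = 0" | "k = 0" "l = 1" | "k = 1" "l = 1"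
    by linarith
  then show ?case
  proof cases
    case 1
    then obtain k' where k: "k = Suc (Suc k')" by (metis add_2_eq_Suc le_Suc_ex)
    have "l2_inner f ((T ^^ k) ((R ^^ l) f)) = l2_inner (T f) ((T ^^ Suc k') ((R ^^ l) f))"
      using sym_opD(3)[OF T less.prems fin[of "Suc k'" l]] k by simp
    also have "(T ^^ Suc k') ((R ^^ l) f) = (T ^^ k') ((R ^^ l) (T f))"
      by (simp add: RT funpow_swap1)
    finally show ?thesis using less.hyps[of k' l "T f"] sym_opD(2)[OF T less.prems] k by simp
  next
    case 2
    then obtain l' where l: "l = Suc (Suc l')" by (metis add_2_eq_Suc le_Suc_ex)
    have "(T ^^ k) ((R ^^ l) f) = R ((T ^^ k) ((R ^^ Suc l') f))"
      by (simp add: l TR)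
    then have "l2_inner f ((T ^^ k) ((R ^^ l) f)) = l2_inner (R f) ((T ^^ k) ((R ^^ Suc l') f))"
      using sym_opD(3)[OF R less.prems fin[of k "Suc l'"]] by simp
    also have "(R ^^ Suc l') f = (R ^^ l') (R f)"
      by (simp add: funpow_swap1)
    finally show ?thesis using less.hyps[of k l' "R f"] sym_opD(2)[OF R less.prems] l by simp
  next
    case 6
    have "T (R f) = (\<lambda>s. T (R (T f)) s + T (R (R f)) s)"
      using one[of "T (R f)"] commute by metis
    then have "l2_inner f (T (R f)) = l2_inner f (T (R (T f))) + l2_inner f (T (R (R f)))"
      using less.prems by (simp add: l2_inner_add sym_opD(2)[OF T] sym_opD(2)[OF R])
    also have "l2_inner f (T (R (T f))) = l2_inner (T f) (R (T f))"
      using less.prems by (intro sym_opD(3)[OF T, symmetric] sym_opD(2)[OF T] sym_opD(2)[OF R])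
    also have "l2_inner f (T (R (R f))) = l2_inner (R f) (T (R f))"
      unfolding commute using less.prems
      by (intro sym_opD(3)[OF R, symmetric] sym_opD(2)[OF T] sym_opD(2)[OF R])
    finally show ?thesis
      using 6 pos less.prems sym_opD(2)[OF T less.prems] sym_opD(2)[OF R less.prems]
      unfolding pos_op_def by (simp add: nonneg_Reals_add_I)
  qed (use pos less.prems l2_inner_self[OF less.prems] in \<open>simp_all add: pos_op_def\<close>)
qed

text \<open>\<open>T = (1 + Z/K)/2\<close> and \<open>R = (1 - Z/K)/2\<close> are positive, commute
  and add up to the identity, so the values of \<open>T^k R^l\<close> at \<open>v\<close> are
  Hausdorff data on the unit interval; the map \<open>t \<mapsto> 2Kt - K\<close> carries the
  resulting law back to \<open>Z\<close>.\<close>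

theorem spectral_measure_exists:
  fixes Z :: "('s \<Rightarrow> complex) \<Rightarrow> 's \<Rightarrow> complex"
  assumes Z: "sym_op Z" and bound: "op_bound Z K" and K: "K > 0"
  obtains \<rho> where "real_distribution \<rho>" "AE t in \<rho>. \<bar>t\<bar> \<le> K"
    "\<And>m. (Z ^^ m) (unit_vec v) v = of_real (\<integral>t. t ^ m \<partial>\<rho>)"
proof -
  note lin = sym_opD(1)[OF Z]
  define T where "T f s = of_real (1 / 2) * f s + of_real (1 / (2 * K)) * Z f s" for f :: "'s \<Rightarrow> complex" and s
  define R where "R f s = of_real (1 / 2) * f s + of_real (- 1 / (2 * K)) * Z f s" for f :: "'s \<Rightarrow> complex" and s
  have id: "sym_op (\<lambda>f :: 's \<Rightarrow> complex. f)" by (simp add: sym_op_def lin_op_def)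
  have T: "sym_op T" and R: "sym_op R"
    using sym_op_lincomb[OF id Z, of "1 / 2" "1 / (2 * K)"] sym_op_lincomb[OF id Z, of "1 / 2" "- 1 / (2 * K)"]
    unfolding T_def[abs_def] R_def[abs_def] by auto
  have commute: "T (R f) = R (T f)" for f
    unfolding T_def[abs_def] R_def[abs_def] lin_opD[OF lin] by (simp add: fun_eq_iff algebra_simps)
  have one: "(\<lambda>s. T f s + R f s) = f" for f
    unfolding T_def R_def by (simp add: fun_eq_iff algebra_simps)
  \<comment> \<open>The quadratic form of a symmetric operator is real and here at most
    \<open>K\<close> times the squared norm, so either sign of \<open>c\<close> leaves a nonnegative
    value.\<close>
  have pos: "l2_inner f (\<lambda>s. of_real (1 / 2) * f s + of_real c * Z f s) \<in> \<real>\<^sub>\<ge>\<^sub>0"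
    if f: "fin_supp f" and c: "\<bar>c\<bar> = 1 / (2 * K)" for f c
  proof -
    have "cnj (l2_inner f (Z f)) = l2_inner f (Z f)"
      using sym_opD(3)[OF Z f f] cnj_l2_inner[OF f] by simp
    then obtain x where x: "l2_inner f (Z f) = of_real x"
      using complex_is_Real_iff by (metis Reals_cases Reals_cnj_iff)
    obtain y where y: "l2_inner f f = of_real y" "y \<ge> 0"
      using l2_inner_self[OF f] by (metis nonneg_Reals_cases)
    have "\<bar>x\<bar> \<le> K * y" using bound f x y unfolding op_bound_def by force
    then have "\<bar>c * x\<bar> \<le> 1 / (2 * K) * (K * y)"
      unfolding abs_mult c using K by (intro mult_left_mono) auto
    also have "\<dots> = y / 2" using K by simp
    finally have "0 \<le> y / 2 + c * x" by linarith
    moreover have "l2_inner f (\<lambda>s. of_real (1 / 2) * f s + of_real c * Z f s) = of_real (y / 2 + c * x)"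
      by (simp only: l2_inner_add l2_inner_scale fin_supp_mult sym_opD(2)[OF Z] f x y(1)) simp
    ultimately show ?thesis by (simp only: nonneg_Reals_of_real_iff)
  qed
  have "pos_op T" "pos_op R"
    unfolding pos_op_def T_def[abs_def] R_def[abs_def] by (intro allI impI pos; use K in simp)+
  note nn = pos_op_power_mult[OF T R commute one this fin_supp_unit_vec[of v], unfolded l2_inner_unit_vec]
  define \<mu> where "\<mu> k l = Re ((T ^^ k) ((R ^^ l) (unit_vec v)) v)" for k l
  have \<mu>: "(T ^^ k) ((R ^^ l) (unit_vec v)) v = of_real (\<mu> k l)" for k l
    using nn[of k l] unfolding \<mu>_def by (metis Re_complex_of_real nonneg_Reals_cases)
  interpret hausdorff_moments \<mu>
  proof
    show "\<mu> k l \<ge> 0" for k l using nn[of k l] unfolding \<mu> by (simp only: nonneg_Reals_of_real_iff)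
    show "\<mu> k l = \<mu> (Suc k) l + \<mu> k (Suc l)" for k l
    proof -
      have "(T ^^ k) (R f) = R ((T ^^ k) f)" for f by (induction k) (simp_all add: commute)
      then have "complex_of_real (\<mu> (Suc k) l + \<mu> k (Suc l)) = of_real (\<mu> k l)"
        unfolding of_real_add \<mu>[symmetric] using one[of "(T ^^ k) ((R ^^ l) (unit_vec v))"]
        by (simp add: fun_eq_iff)
      then show ?thesis by (simp only: of_real_eq_iff)
    qed
    show "\<mu> 0 0 = 1" by (simp add: \<mu>_def unit_vec_def)
  qed
  obtain \<rho> where \<rho>: "real_distribution \<rho>" "AE t in \<rho>. t \<in> {0..1}" "\<And>j. (\<integral>t. t ^ j \<partial>\<rho>) = \<mu> j 0"
    using representing_measure by blast
  interpret real_distribution \<rho> by (rule \<rho>(1))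
  have int: "integrable \<rho> (\<lambda>t. (2 * K * t - K) ^ m * t ^ k)" for m k
  proof (rule integrable_const_bound)
    show "AE t in \<rho>. norm ((2 * K * t - K) ^ m * t ^ k) \<le> K ^ m"
      using \<rho>(2)
    proof eventually_elim
      case (elim t)
      have "2 * K * t \<le> 2 * K" using elim K by simp
      then have "\<bar>2 * K * t - K\<bar> \<le> K" using elim K by (simp add: abs_le_iff)
      then have "\<bar>2 * K * t - K\<bar> ^ m * \<bar>t\<bar> ^ k \<le> K ^ m * 1"
        using elim K by (intro mult_mono power_mono power_le_one) auto
      then show ?case by (simp add: abs_mult power_abs)
    qed
  qed simp
  have Zpow: "lin_op (Z ^^ m)" for m using lin by (induction m) (auto simp: lin_op_def)
  \<comment> \<open>The extra factor \<open>T^k\<close> makes the induction close: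
    \<open>Z = 2K T - K\<close> trades one \<open>Z\<close> for one more \<open>T\<close>, matching
    \<open>2Kt - K\<close> under the integral.\<close>
  have moments: "(Z ^^ m) ((T ^^ k) (unit_vec v)) v = of_real (\<integral>t. (2 * K * t - K) ^ m * t ^ k \<partial>\<rho>)" for m k
  proof (induction m arbitrary: k)
    case 0
    show ?case using \<mu>[of k 0] \<rho>(3) by simp
  next
    case (Suc m)
    have Z_eq: "Z f = (\<lambda>s. of_real (2 * K) * T f s + of_real (- K) * f s)" for f
      using K by (simp add: T_def fun_eq_iff field_simps)
    have "(Z ^^ Suc m) ((T ^^ k) (unit_vec v)) = (Z ^^ m) (Z ((T ^^ k) (unit_vec v)))"
      by (simp add: funpow_swap1)
    also have "\<dots> = (\<lambda>s. of_real (2 * K) * (Z ^^ m) ((T ^^ Suc k) (unit_vec v)) s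
        + of_real (- K) * (Z ^^ m) ((T ^^ k) (unit_vec v)) s)"
      unfolding Z_eq[of "(T ^^ k) (unit_vec v)"] lin_opD[OF Zpow] by simp
    finally have e: "(Z ^^ Suc m) ((T ^^ k) (unit_vec v)) = (\<lambda>s. of_real (2 * K) * (Z ^^ m) ((T ^^ Suc k) (unit_vec v)) s
        + of_real (- K) * (Z ^^ m) ((T ^^ k) (unit_vec v)) s)" .
    have "(Z ^^ Suc m) ((T ^^ k) (unit_vec v)) v =
        of_real (2 * K * (\<integral>t. (2 * K * t - K) ^ m * t ^ Suc k \<partial>\<rho>) + (- K) * (\<integral>t. (2 * K * t - K) ^ m * t ^ k \<partial>\<rho>))"
      unfolding e Suc.IH by simp
    also have "2 * K * (\<integral>t. (2 * K * t - K) ^ m * t ^ Suc k \<partial>\<rho>) + (- K) * (\<integral>t. (2 * K * t - K) ^ m * t ^ k \<partial>\<rho>)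
        = (\<integral>t. 2 * K * ((2 * K * t - K) ^ m * t ^ Suc k) + (- K) * ((2 * K * t - K) ^ m * t ^ k) \<partial>\<rho>)"
      using int[of m "Suc k"] int[of m k] by simp
    also have "\<dots> = (\<integral>t. (2 * K * t - K) ^ Suc m * t ^ k \<partial>\<rho>)"
      by (rule Bochner_Integration.integral_cong) (simp_all add: algebra_simps)
    finally show ?case .
  qed
  show ?thesis
  proof
    show "real_distribution (distr \<rho> borel (\<lambda>t. 2 * K * t - K))" by simp
    show "AE t in distr \<rho> borel (\<lambda>t. 2 * K * t - K). \<bar>t\<bar> \<le> K"
    proof (subst AE_distr_iff)
      show "AE t in \<rho>. \<bar>2 * K * t - K\<bar> \<le> K"
        using \<rho>(2)
      proof eventually_elim
        case (elim t)
        have "2 * K * t \<le> 2 * K" using elim K by simp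
        then show ?case using elim K by (simp add: abs_le_iff)
      qed
    qed auto
    show "(Z ^^ m) (unit_vec v) v = of_real (\<integral>t. t ^ m \<partial>distr \<rho> borel (\<lambda>t. 2 * K * t - K))" for m
      using moments[of m 0] by (subst integral_distr) auto
  qed
qed

section \<open>Moments of \<open>\<mu>\<^sub>q\<close>\<close>

lemma free_sum_moments_unique:
  fixes \<phi> :: "'a::complex_algebra_1 \<Rightarrow> complex" and \<phi>' :: "'b::complex_algebra_1 \<Rightarrow> complex"
    and x :: "bool \<Rightarrow> 'a" and y :: "bool \<Rightarrow> 'b"
  assumes lin: "clinear \<phi>" "clinear \<phi>'" and one: "\<phi> 1 = 1" "\<phi>' 1 = 1"
    and free: "freely_independent \<phi> UNIV x" "freely_independent \<phi>' UNIV y"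
    and mom: "\<And>i m. \<phi> (x i ^ m) = \<phi>' (y i ^ m)"
  shows "\<phi> ((x False + x True) ^ m) = \<phi>' ((y False + y True) ^ m)"
proof -
  \<comment> \<open>The word on the right collects the factors split off the power, one summand at a
    time.\<close>
  have "\<phi> ((x False + x True) ^ m * poly_word x l) = \<phi>' ((y False + y True) ^ m * poly_word y l)" for l
  proof (induction m arbitrary: l)
    case 0
    show ?case using free_joint_moments_unique[OF lin one free mom, of l] by simp
  next
    case (Suc m)
    have "(z False + z True) ^ Suc m * poly_word z l =
        (z False + z True) ^ m * poly_word z ((False, [:0, 1:]) # l) +
        (z False + z True) ^ m * poly_word z ((True, [:0, 1:]) # l)"
      for z :: "bool \<Rightarrow> 'c::complex_algebra_1"
      by (simp add: power_Suc2 distrib_left distrib_right mult.assoc scaleC_one del: power_Suc)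
    note step = this[of x] this[of y]
    show ?case
      unfolding step clinear_functional(1)[OF lin(1)] clinear_functional(1)[OF lin(2)] Suc.IH ..
  qed
  from this[of "[]"] show ?thesis by simp
qed

theorem mu_q_moment:
  fixes q :: real
  assumes q: "0 \<le> q" "q \<le> 1"
  defines "\<alpha> \<equiv> sqrt q / sqrt 2" and "\<beta> \<equiv> sqrt (1 - q)"
  shows "((\<lambda>f s. model_op \<alpha> \<beta> False f s + model_op \<alpha> \<beta> True f s) ^^ m) (unit_vec vacuum) vacuum
    = of_real (\<integral>x. x ^ m \<partial>mu_q q)"
proof -
  define Z where "Z = (\<lambda>f s. model_op \<alpha> \<beta> False f s + model_op \<alpha> \<beta> True f s)"
  let ?\<mu> = "dilation (sqrt q) (convolution (dilation (1 / sqrt 2) semicircle) (dilation (1 / sqrt 2) semicircle))"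
    and ?\<nu> = "dilation (sqrt (1 - q)) semicircle"
  let ?K = "4 * \<alpha> + 2 * \<beta>"
  let ?P = "\<lambda>\<rho>. real_distribution \<rho> \<and> (\<exists>K. AE t in \<rho>. \<bar>t\<bar> \<le> K) \<and>
     (\<exists>\<psi> :: bool ncpoly \<Rightarrow> complex. state \<psi> \<and> freely_independent \<psi> UNIV nc_var \<and>
        has_distribution \<psi> (nc_var False) ?\<mu> \<and> has_distribution \<psi> (nc_var True) ?\<nu> \<and>
        has_distribution \<psi> (nc_var False + nc_var True) \<rho>)"
  have nonneg: "\<alpha> \<ge> 0" "\<beta> \<ge> 0" using q by (simp_all add: \<alpha>_def \<beta>_def)
  have Z: "sym_op Z"
    using sym_op_lincomb[OF sym_op_model_op sym_op_model_op, of 1 \<alpha> \<beta> False 1 \<alpha> \<beta> True]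
    by (simp add: Z_def)
  have "op_bound Z (?K + ?K)"
    using op_bound_lincomb[OF sym_op_model_op sym_op_model_op op_bound_model_op[OF nonneg]
        op_bound_model_op[OF nonneg], of 1 1 False True]
    by (simp add: Z_def)
  \<comment> \<open>The added \<open>1\<close> supplies the strict positivity that
    \<open>spectral_measure_exists\<close> asks for.\<close>
  then have "op_bound Z (?K + ?K + 1)" by (rule op_bound_mono) simp
  moreover have "?K + ?K + 1 > 0" using nonneg by simp
  ultimately obtain \<rho> where \<rho>: "real_distribution \<rho>" "AE t in \<rho>. \<bar>t\<bar> \<le> ?K + ?K + 1"
    "\<And>m. (Z ^^ m) (unit_vec vacuum) vacuum = of_real (\<integral>t. t ^ m \<partial>\<rho>)"
    using spectral_measure_exists[OF Z] by blast
  have state: "state (model_state \<alpha> \<beta>)" by (rule state_vector_state[OF sym_op_model_op])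
  have sum: "model_state \<alpha> \<beta> ((nc_var False + nc_var True) ^ m) = (Z ^^ m) (unit_vec vacuum) vacuum" for m
  proof -
    have "nc_act (model_op \<alpha> \<beta>) (nc_var False + nc_var True) = Z"
      by (simp add: fun_eq_iff Z_def nc_act_add nc_act_var)
    then show ?thesis
      by (simp add: vector_state_def nc_act_power[OF sym_opD(1)[OF sym_op_model_op]])
  qed
  have "integrable \<rho> (\<lambda>t. t ^ m)" for m
  proof -
    interpret real_distribution \<rho> by (rule \<rho>(1))
    have "AE t in \<rho>. norm (t ^ m) \<le> (?K + ?K + 1) ^ m"
      using \<rho>(2) by eventually_elim (simp add: power_abs power_mono)
    then show ?thesis by (rule integrable_const_bound) simp
  qed
  then have "has_distribution (model_state \<alpha> \<beta>) (nc_var False + nc_var True) \<rho>"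
    by (simp add: has_distribution_def sum \<rho>(3))
  then have P: "?P \<rho>"
    using \<rho>(1,2) state freely_independent_model has_distribution_model_False[of "sqrt q" \<beta>]
      has_distribution_model_True[of \<alpha> \<beta>]
    unfolding \<alpha>_def \<beta>_def by blast
  have unique: "\<rho>' = \<rho>" if \<rho>': "?P \<rho>'" for \<rho>'
  proof -
    obtain K and \<psi> :: "bool ncpoly \<Rightarrow> complex" where
      r: "real_distribution \<rho>'" "AE t in \<rho>'. \<bar>t\<bar> \<le> K" and
      \<psi>: "state \<psi>" "freely_independent \<psi> UNIV nc_var" and
      d: "has_distribution \<psi> (nc_var False) ?\<mu>" "has_distribution \<psi> (nc_var True) ?\<nu>"
        "has_distribution \<psi> (nc_var False + nc_var True) \<rho>'"
      using \<rho>' by blast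
    obtain \<psi>' :: "bool ncpoly \<Rightarrow> complex" where
      \<psi>': "state \<psi>'" "freely_independent \<psi>' UNIV nc_var" and
      d': "has_distribution \<psi>' (nc_var False) ?\<mu>" "has_distribution \<psi>' (nc_var True) ?\<nu>"
        "has_distribution \<psi>' (nc_var False + nc_var True) \<rho>"
      using P by blast
    have eq: "\<psi> (nc_var i ^ m) = \<psi>' (nc_var i ^ m)" for i m
      using d(1,2) d'(1,2) by (cases i) (simp_all add: has_distribution_def)
    have "clinear \<psi>" "clinear \<psi>'" "\<psi> 1 = 1" "\<psi>' 1 = 1"
      using \<psi>(1) \<psi>'(1) by (simp_all add: state_def)
    then have "\<psi> ((nc_var False + nc_var True) ^ m) = \<psi>' ((nc_var False + nc_var True) ^ m)" for m
      using \<psi>(2) \<psi>'(2) eq by (rule free_sum_moments_unique)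
    then have "(\<integral>t. t ^ m \<partial>\<rho>') = (\<integral>t. t ^ m \<partial>\<rho>)" for m
      using d(3) d'(3) by (simp add: has_distribution_def)
    then show ?thesis using compact_moments_unique[OF r(1) \<rho>(1) r(2) \<rho>(2)] by blast
  qed
  have "mu_q q = \<rho>"
    unfolding mu_q_def free_convolution_def
  proof (rule the_equality)
    show "?P \<rho>" by (rule P)
    show "\<rho>' = \<rho>" if "?P \<rho>'" for \<rho>' using that by (rule unique)
  qed
  then show ?thesis using \<rho>(3)[of m] by (simp add: Z_def)
qed

section \<open>Counting pair words\<close>

text \<open>A shape whose letters carry indices: the open pairs of a word that is read from right to left.\<close>

type_synonym stacks = "(nat list \<times> nat list) \<times> (nat \<times> nat list \<times> nat list) list"

fun push :: "kind \<Rightarrow> nat \<Rightarrow> stacks \<Rightarrow> stacks" where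
  "push First i ((\<alpha>, \<beta>), r) = ((i # \<alpha>, \<beta>), r)"
| "push Second i ((\<alpha>, \<beta>), r) = ((\<alpha>, i # \<beta>), r)"
| "push Both i ((\<alpha>, \<beta>), r) = (([], []), (i, \<alpha>, \<beta>) # r)"

fun shape_of :: "stacks \<Rightarrow> shape" where
  "shape_of ((\<alpha>, \<beta>), r) = ((length \<alpha>, length \<beta>), map (\<lambda>(i, \<alpha>, \<beta>). (length \<alpha>, length \<beta>)) r)"

fun open_indices :: "stacks \<Rightarrow> nat list" where
  "open_indices ((\<alpha>, \<beta>), r) = \<alpha> @ \<beta> @ concat (map (\<lambda>(i, \<alpha>, \<beta>). i # \<alpha> @ \<beta>) r)"

text \<open>The reduced word of the first leg, newest letter first: the open indices of kinds
  \<open>First\<close> and \<open>Both\<close>. \<open>tracked_reduce\<close> confirms this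
  reading.\<close>

fun first_stack :: "stacks \<Rightarrow> nat list" where
  "first_stack ((\<alpha>, \<beta>), r) = \<alpha> @ concat (map (\<lambda>(i, \<alpha>, \<beta>). i # \<alpha>) r)"

fun second_stack :: "stacks \<Rightarrow> nat list" where
  "second_stack ((\<alpha>, \<beta>), r) = \<beta> @ concat (map (\<lambda>(i, \<alpha>, \<beta>). i # \<beta>) r)"

fun shape_size :: "shape \<Rightarrow> nat" where
  "shape_size ((a, b), r) = a + b + sum_list (map (\<lambda>(a, b). Suc (a + b)) r)"

lemma push_inject: "push t i z = push t j y \<longleftrightarrow> i = j \<and> z = y"
  by (cases t; cases z rule: shape_of.cases; cases y rule: shape_of.cases) auto

lemma shape_of_push: "shape_of (push t i z) = raise t (shape_of z)"
  by (cases t; cases z rule: shape_of.cases) auto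

lemma shape_of_eq_raise:
  assumes "shape_of y = raise t s"
  obtains i z where "y = push t i z" "shape_of z = s"
proof -
  obtain \<alpha> \<beta> r where y: "y = ((\<alpha>, \<beta>), r)" by (cases y) auto
  obtain a b r' where s: "s = ((a, b), r')" by (cases s) auto
  show ?thesis
  proof (cases t)
    case First
    with assms y s obtain i \<alpha>' where "\<alpha> = i # \<alpha>'" "length \<alpha>' = a" by (cases \<alpha>) auto
    then show ?thesis using that[of i "((\<alpha>', \<beta>), r)"] assms y s First by auto
  next
    case Second
    with assms y s obtain i \<beta>' where "\<beta> = i # \<beta>'" "length \<beta>' = b" by (cases \<beta>) auto
    then show ?thesis using that[of i "((\<alpha>, \<beta>'), r)"] assms y s Second by auto
  next
    case Both
    with assms y s obtain i \<alpha>' \<beta>' r'' where "r = (i, \<alpha>', \<beta>') # r''" by (cases r) auto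
    then show ?thesis using that[of i "((\<alpha>', \<beta>'), r'')"] assms y s Both by auto
  qed
qed

lemma open_indices_push:
  "set (open_indices (push t i z)) = insert i (set (open_indices z))"
  "distinct (open_indices (push t i z)) \<longleftrightarrow> i \<notin> set (open_indices z) \<and> distinct (open_indices z)"
  "length (open_indices (push t i z)) = Suc (length (open_indices z))"
  by (cases t; cases z rule: shape_of.cases; auto)+

lemma shape_size_raise: "shape_size (raise t s) = Suc (shape_size s)"
  by (cases t; cases s rule: shape_size.cases) auto

lemma shape_size_shape_of: "shape_size (shape_of z) = length (open_indices z)"
proof (cases z rule: shape_of.cases)
  case (1 \<alpha> \<beta> r)
  have "sum_list (map (\<lambda>(a, b). Suc (a + b)) (map (\<lambda>(i, \<alpha>, \<beta>). (length \<alpha>, length \<beta>)) r)) =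
      length (concat (map (\<lambda>(i, \<alpha>, \<beta>). i # \<alpha> @ \<beta>) r))"
    by (induction r) auto
  then show ?thesis using 1 by simp
qed

lemma stacks_push:
  "first_stack (push t i z) = (if t = Second then first_stack z else i # first_stack z)"
  "second_stack (push t i z) = (if t = First then second_stack z else i # second_stack z)"
  by (cases t; cases z rule: shape_of.cases; auto)+

section \<open>Index words of the two legs and the stacks that track them\<close>

definition first_indices :: "(nat \<times> kind) list \<Rightarrow> nat list" where
  "first_indices w = map fst (filter (\<lambda>x. snd x \<noteq> Second) w)"

definition second_indices :: "(nat \<times> kind) list \<Rightarrow> nat list" where
  "second_indices w = map fst (filter (\<lambda>x. snd x \<noteq> First) w)"

lemma indices_simps [simp]:
  "first_indices [] = []" "second_indices [] = []"
  "first_indices ((i, t) # w) = (if t = Second then first_indices w else i # first_indices w)"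
  "second_indices ((i, t) # w) = (if t = First then second_indices w else i # second_indices w)"
  "first_indices (u @ w) = first_indices u @ first_indices w"
  "second_indices (u @ w) = second_indices u @ second_indices w"
  by (simp_all add: first_indices_def second_indices_def)

lemma set_indices: "set (first_indices w) \<subseteq> fst ` set w" "set (second_indices w) \<subseteq> fst ` set w"
  by (auto simp: first_indices_def second_indices_def)

lemma count_indices:
  "count_list (first_indices w) i \<le> count_list (map fst w) i"
  "count_list (second_indices w) i \<le> count_list (map fst w) i"
  by (induction w) auto

text \<open>Words grow at the left, so they are read from the right. \<open>push\<close> requires an
  index unseen in all of \<open>w\<close>, so a closed index never reopens; \<open>pop\<close>
  closes an index only with its own kind and on top, up to \<open>A B = B A\<close>.\<close>

inductive tracked :: "(nat \<times> kind) list \<Rightarrow> stacks \<Rightarrow> bool" where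
  empty: "tracked [] (([], []), [])"
| push: "tracked w z \<Longrightarrow> i \<notin> fst ` set w \<Longrightarrow> tracked ((i, t) # w) (push t i z)"
| pop: "tracked w (push t i z) \<Longrightarrow> tracked ((i, t) # w) z"

lemma tracked_open:
  assumes "tracked w z"
  shows "distinct (open_indices z) \<and>
    (\<forall>i. (i \<in> set (open_indices z) \<longleftrightarrow> count_list (map fst w) i = 1) \<and> count_list (map fst w) i \<le> 2)"
  using assms
proof induction
  case (push w z i t)
  then have "count_list (map fst w) i = 0" by (simp add: count_list_0_iff)
  with push show ?case by (auto simp: open_indices_push)
next
  case (pop w t i z)
  then show ?case by (auto simp: open_indices_push)
qed simp

text \<open>Closed indices occur twice and open ones once.\<close>

lemma tracked_card:
  "tracked w z \<Longrightarrow> 2 * card (fst ` set w) = length w + length (open_indices z)"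
proof (induction rule: tracked.induct)
  case (pop w t i z)
  have "i \<in> fst ` set w"
    using tracked_open[OF pop.hyps] count_list_0_iff[of "map fst w" i]
    by (auto simp: open_indices_push)
  with pop show ?case by (simp add: open_indices_push insert_absorb)
qed (simp_all add: open_indices_push)

lemma tracked_push_mem: "tracked w (push t i z) \<Longrightarrow> i \<in> fst ` set w"
  using tracked_open[of w "push t i z"] count_list_0_iff[of "map fst w" i]
  by (auto simp: open_indices_push)

text \<open>The leftmost letter decides the rule: \<open>push\<close> needs an unseen index and
  \<open>pop\<close> a seen one; \<open>push_inject\<close> settles the rest.\<close>

lemma tracked_unique: "tracked w z \<Longrightarrow> tracked w y \<Longrightarrow> z = y"
proof (induction arbitrary: y rule: tracked.induct)
  case empty
  then show ?case by cases auto
next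
  case (push w z i t)
  from push.prems show ?case
  proof cases
    case (push z')
    then show ?thesis using push.IH by blast
  next
    case pop
    then show ?thesis using push.hyps tracked_push_mem by blast
  qed
next
  case (pop w t i z)
  from pop.prems show ?case
  proof cases
    case push
    then show ?thesis using pop.hyps tracked_push_mem by blast
  next
    case pop
    then show ?thesis using pop.IH push_inject by blast
  qed
qed

lemma stack_reduce_push: "i \<notin> set (stack_reduce v) \<Longrightarrow> stack_reduce (i # v) = i # stack_reduce v"
  by (auto split: list.splits)

lemma tracked_reduce:
  "tracked w z \<Longrightarrow> stack_reduce (first_indices w) = first_stack z \<and> stack_reduce (second_indices w) = second_stack z"
proof (induction rule: tracked.induct)
  case (push w z i t)
  then have "i \<notin> set (stack_reduce (first_indices w))" "i \<notin> set (stack_reduce (second_indices w))"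
    using set_stack_reduce[of "first_indices w"] set_stack_reduce[of "second_indices w"] set_indices[of w]
    by blast+
  with push show ?case by (simp add: stack_reduce_push stacks_push del: stack_reduce.simps)
next
  case (pop w t i z)
  then show ?case by (cases t) (simp_all add: stacks_push)
qed simp

text \<open>If an open index is met where it closes no pair, it survives in one of the two reduced words,
  where it can no longer be cancelled.\<close>

lemma illegal_step:
  assumes "distinct (open_indices z)" "i \<in> set (open_indices z)" "\<nexists>y. z = push t i y"
    and "stack_reduce u = first_stack z" "stack_reduce v = second_stack z"
  shows "i \<in> set (stack_reduce (if t = Second then u else i # u)) \<union>
    set (stack_reduce (if t = First then v else i # v))"
proof -
  obtain \<alpha> \<beta> r where z: "z = ((\<alpha>, \<beta>), r)" by (cases z) auto
  have "\<not> (t = First \<and> (\<exists>\<alpha>'. \<alpha> = i # \<alpha>'))" "\<not> (t = Second \<and> (\<exists>\<beta>'. \<beta> = i # \<beta>'))"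
    "\<not> (t = Both \<and> \<alpha> = [] \<and> \<beta> = [] \<and> (\<exists>\<alpha>' \<beta>' r'. r = (i, \<alpha>', \<beta>') # r'))"
    using assms(3) unfolding z by (metis push.simps)+
  then show ?thesis
    using assms(1,2,4,5) unfolding z
    by (cases t; cases \<alpha>; cases \<beta>; cases r) auto
qed

text \<open>A first occurrence opens, and a second one must close legally: after an illegal one the
  index has no further occurrence to the left and stays in a reduced leg. At the end no index is
  open, since each occurs twice.\<close>

lemma pair_word_tracked:
  assumes pair: "\<And>i. i \<in> fst ` set w \<Longrightarrow> count_list (map fst w) i = 2"
    and red: "stack_reduce (first_indices w) = []" "stack_reduce (second_indices w) = []"
  shows "tracked w (([], []), [])"
proof -
  have "w = u @ v \<Longrightarrow> \<exists>z. tracked v z" for u v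
  proof (induction v arbitrary: u)
    case Nil
    show ?case using tracked.empty by blast
  next
    case (Cons x v)
    obtain i t where x: "x = (i, t)" by (cases x)
    obtain z where z: "tracked v z" using Cons.IH[of "u @ [x]"] Cons.prems by auto
    show ?case
    proof (cases "i \<in> fst ` set v")
      case False
      then show ?thesis using tracked.push[OF z False] x by blast
    next
      case True
      have "count_list (map fst u) i + Suc (count_list (map fst v) i) = 2"
        using pair[of i] Cons.prems x by simp
      moreover have "count_list (map fst v) i \<noteq> 0" using True by (simp add: count_list_0_iff)
      ultimately have c: "count_list (map fst v) i = 1" "count_list (map fst u) i = 0" by auto
      then have u: "i \<notin> fst ` set u" by (simp add: count_list_0_iff)
      have i: "i \<in> set (open_indices z)" "distinct (open_indices z)"
        using tracked_open[OF z] c by auto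
      show ?thesis
      proof (cases "\<exists>y. z = push t i y")
        case True
        then show ?thesis using tracked.pop z x by blast
      next
        case False
        have "i \<in> set (stack_reduce (first_indices ((i, t) # v))) \<union> set (stack_reduce (second_indices ((i, t) # v)))"
          using illegal_step[OF i(2,1) False] tracked_reduce[OF z] by simp
        then have "i \<in> set (stack_reduce (first_indices w)) \<union> set (stack_reduce (second_indices w))"
          using stack_reduce_persist[of i "first_indices u"] stack_reduce_persist[of i "second_indices u"]
            set_indices[of u] u
          unfolding Cons.prems x by (auto simp del: stack_reduce.simps indices_simps(3,4))
        then show ?thesis using red by simp
      qed
    qed
  qed
  then obtain z where z: "tracked w z" by (metis append_Nil)
  have "i \<notin> set (open_indices z)" for i
  proof
    assume "i \<in> set (open_indices z)"
    then have c: "count_list (map fst w) i = 1" using tracked_open[OF z] by blast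
    then have "i \<in> fst ` set w" using count_list_0_iff[of "map fst w" i] by auto
    with pair c show False by fastforce
  qed
  then have "open_indices z = []" by (metis last_in_set)
  then have "z = (([], []), [])"
  proof (cases z rule: shape_of.cases)
    case (1 \<alpha> \<beta> r)
    then show ?thesis using \<open>open_indices z = []\<close> by (cases r) auto
  qed
  with z show ?thesis by simp
qed

section \<open>Counting tracked words with prescribed kinds\<close>

definition path_weight :: "kind list \<Rightarrow> shape \<Rightarrow> complex" where
  "path_weight \<tau> = foldr (\<lambda>t. adjacency (raise t)) \<tau> (unit_vec vacuum)"

definition tracked_words :: "nat \<Rightarrow> kind list \<Rightarrow> shape \<Rightarrow> ((nat \<times> kind) list \<times> stacks) set" where
  "tracked_words n \<tau> s =
     {(w, z). tracked w z \<and> map snd w = \<tau> \<and> fst ` set w \<subseteq> {1..n} \<and> shape_of z = s}"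

text \<open>The number of ordered choices of \<open>p\<close> distinct indices. Complex factors
  avoid truncated subtraction, and the value is \<open>0\<close> for \<open>p > n\<close>.\<close>

definition falling :: "nat \<Rightarrow> nat \<Rightarrow> complex" where
  "falling n p = (\<Prod>k<p. of_nat n - of_nat k)"

lemma finite_tracked_words: "finite (tracked_words n \<tau> s)"
proof (rule finite_imageD)
  have "fst ` tracked_words n \<tau> s \<subseteq> {w. set w \<subseteq> {1..n} \<times> set \<tau> \<and> length w = length \<tau>}"
    by (force simp: tracked_words_def)
  then show "finite (fst ` tracked_words n \<tau> s)"
    by (rule finite_subset) (rule finite_lists_length_eq, simp)
  show "inj_on fst (tracked_words n \<tau> s)"
    using tracked_unique by (auto simp: inj_on_def tracked_words_def)
qed

lemma tracked_words_card:
  assumes "(w, z) \<in> tracked_words n \<tau> s"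
  shows "card (fst ` set w) = (length \<tau> + shape_size s) div 2" "card (fst ` set w) \<le> n"
proof -
  have w: "tracked w z" "map snd w = \<tau>" "fst ` set w \<subseteq> {1..n}" "shape_of z = s"
    using assms by (auto simp: tracked_words_def)
  have "2 * card (fst ` set w) = length \<tau> + shape_size s"
    using tracked_card[OF w(1)] w(2,4) shape_size_shape_of[of z] by auto
  then show "card (fst ` set w) = (length \<tau> + shape_size s) div 2" by simp
  show "card (fst ` set w) \<le> n" using card_mono[OF _ w(3)] by simp
qed

lemma tracked_words_Cons:
  "tracked_words n (t # \<tau>) s =
     (\<lambda>((w, z), i). ((i, t) # w, push t i z)) `
        (SIGMA (w, z):{(w, z). raise t (shape_of z) = s \<and> (w, z) \<in> tracked_words n \<tau> (shape_of z)}. {1..n} - fst ` set w) \<union>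
     {((i, t) # w, z) | i w z. (w, push t i z) \<in> tracked_words n \<tau> (raise t s)}"
    (is "?L = ?R")
proof
  show "?L \<subseteq> ?R"
  proof
    fix x assume "x \<in> ?L"
    then obtain v y where x: "x = (v, y)" and v: "tracked v y" "map snd v = t # \<tau>" "fst ` set v \<subseteq> {1..n}" "shape_of y = s"
      by (auto simp: tracked_words_def)
    from v(1) show "x \<in> ?R"
    proof cases
      case (push w z i t')
      then have "((w, z), i) \<in> (SIGMA (w, z):{(w, z). raise t (shape_of z) = s \<and> (w, z) \<in> tracked_words n \<tau> (shape_of z)}. {1..n} - fst ` set w)"
        using v by (auto simp: tracked_words_def shape_of_push)
      then show ?thesis using push v(2) x by (intro UnI1 image_eqI[of _ _ "((w, z), i)"]) auto
    next
      case (pop w t' i)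
      then have "(w, push t i y) \<in> tracked_words n \<tau> (raise t s)" "v = (i, t) # w"
        using v by (simp_all add: tracked_words_def shape_of_push)
      then show ?thesis using x by blast
    qed (use v in auto)
  qed
  show "?R \<subseteq> ?L"
  proof
    fix x assume "x \<in> ?R"
    then show "x \<in> ?L"
    proof
      assume "x \<in> (\<lambda>((w, z), i). ((i, t) # w, push t i z)) `
        (SIGMA (w, z):{(w, z). raise t (shape_of z) = s \<and> (w, z) \<in> tracked_words n \<tau> (shape_of z)}. {1..n} - fst ` set w)"
      then obtain w z i where x: "x = ((i, t) # w, push t i z)" and w: "raise t (shape_of z) = s" "tracked w z"
        "map snd w = \<tau>" "fst ` set w \<subseteq> {1..n}" and i: "i \<in> {1..n}" "i \<notin> fst ` set w"
        by (auto simp: tracked_words_def simp del: shape_of.simps)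
      then show ?thesis by (simp add: tracked_words_def shape_of_push tracked.push del: shape_of.simps)
    next
      assume "x \<in> {((i, t) # w, z) | i w z. (w, push t i z) \<in> tracked_words n \<tau> (raise t s)}"
      then obtain i w z where x: "x = ((i, t) # w, z)" and w: "tracked w (push t i z)" "map snd w = \<tau>"
        "fst ` set w \<subseteq> {1..n}" "raise t (shape_of z) = raise t s"
        by (auto simp: tracked_words_def shape_of_push)
      have "shape_of z = s" using w(4) injD[OF inj_raise] by blast
      moreover have "i \<in> {1..n}" using tracked_push_mem[OF w(1)] w(3) by blast
      ultimately show ?thesis using w tracked.pop by (auto simp: x tracked_words_def)
    qed
  qed
qed

theorem card_tracked_words:
  "of_nat (card (tracked_words n \<tau> s)) = path_weight \<tau> s * falling n ((length \<tau> + shape_size s) div 2)"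
proof (induction \<tau> arbitrary: s)
  case Nil
  have "tracked_words n [] s = (if s = vacuum then {([], (([], []), []))} else {})"
    by (auto simp: tracked_words_def vacuum_def elim: tracked.cases intro: tracked.empty)
  then show ?case by (simp add: path_weight_def unit_vec_def falling_def vacuum_def)
next
  case (Cons t \<tau>)
  let ?p = "(length (t # \<tau>) + shape_size s) div 2"
  let ?D = "SIGMA (w, z):{(w, z). raise t (shape_of z) = s \<and> (w, z) \<in> tracked_words n \<tau> (shape_of z)}. {1..n} - fst ` set w"
  let ?A = "(\<lambda>((w, z), i). ((i, t) # w, push t i z)) ` ?D"
  let ?B = "{((i, t) # w, z) | i w z. (w, push t i z) \<in> tracked_words n \<tau> (raise t s)}"
  have inj: "inj_on (\<lambda>((w, z), i). ((i, t) # w, push t i z)) ?D"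
    by (auto simp: inj_on_def push_inject)
  let ?a = "if s \<in> range (raise t) then path_weight \<tau> (inv (raise t) s) else 0"
  have A: "finite ?A \<and> of_nat (card ?A) = ?a * falling n ?p"
  proof (cases "s \<in> range (raise t)")
    case False
    then have "?D = {}" by auto
    then have "?A = {}" by simp
    then show ?thesis
      using False by simp
  next
    case True
    then obtain s' where s: "s = raise t s'" by blast
    let ?p' = "(length \<tau> + shape_size s') div 2"
    have "?D = (SIGMA x:tracked_words n \<tau> s'. {1..n} - fst ` set (fst x))"
      by (auto simp: s tracked_words_def inj_eq[OF inj_raise] simp del: shape_of.simps)
    moreover have "card (SIGMA x:tracked_words n \<tau> s'. {1..n} - fst ` set (fst x))
        = (\<Sum>x\<in>tracked_words n \<tau> s'. card ({1..n} - fst ` set (fst x)))"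
      by (rule card_SigmaI) (auto simp: finite_tracked_words)
    moreover have "card ({1..n} - fst ` set (fst x)) = n - ?p' \<and> ?p' \<le> n" if "x \<in> tracked_words n \<tau> s'" for x
    proof -
      obtain w z where x: "x = (w, z)" by (cases x)
      have "fst ` set w \<subseteq> {1..n}" using that x by (auto simp: tracked_words_def)
      then have "card ({1..n} - fst ` set w) = n - card (fst ` set w)"
        by (subst card_Diff_subset) auto
      then show ?thesis using tracked_words_card[of w z n \<tau> s'] that x by simp
    qed
    ultimately have card: "card ?D = card (tracked_words n \<tau> s') * (n - ?p')"
      and le: "tracked_words n \<tau> s' \<noteq> {} \<Longrightarrow> ?p' \<le> n" and D: "finite ?D"
      using finite_tracked_words[of n \<tau> s'] by auto
    have cD: "of_nat (card ?D) = path_weight \<tau> s' * falling n ?p' * (of_nat n - of_nat ?p')"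
    proof -
      have "(of_nat (card ?D) :: complex) = of_nat (card (tracked_words n \<tau> s')) * of_nat (n - ?p')"
        by (simp only: card of_nat_mult)
      also have "\<dots> = of_nat (card (tracked_words n \<tau> s')) * (of_nat n - of_nat ?p')"
        \<comment> \<open>If a word exists at all, its indices fit into \<open>{1..n}\<close> and
          the subtraction is exact; otherwise both sides vanish.\<close>
        using le by (cases "tracked_words n \<tau> s' = {}") (simp_all only: card.empty of_nat_0 mult_zero_left of_nat_diff simp_thms)
      finally show ?thesis by (simp only: Cons.IH)
    qed
    have p: "?p = Suc ?p'" by (simp add: s shape_size_raise)
    have "of_nat (card ?A) = path_weight \<tau> s' * falling n ?p"
      unfolding card_image[OF inj] cD p by (simp add: falling_def)
    moreover have "finite ?A" using D by (rule finite_imageI)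
    moreover have "(if s \<in> range (raise t) then path_weight \<tau> (inv (raise t) s) else 0) = path_weight \<tau> s'"
      by (simp add: s)
    ultimately show ?thesis
      by (simp only:)
  qed
  have B: "of_nat (card ?B) = path_weight \<tau> (raise t s) * falling n ?p" and finB: "finite ?B"
  proof -
    \<comment> \<open>\<open>g\<close> undoes the last \<open>push\<close>;
      \<open>push_inject\<close> makes the choice unambiguous.\<close>
    define g where "g = (\<lambda>((w :: (nat \<times> kind) list), y). let (i, z) = (SOME x. y = push t (fst x) (snd x)) in ((i, t) # w, z))"
    have g: "g (w, push t i z) = ((i, t) # w, z)" for w i z
    proof -
      have "(SOME x. push t i z = push t (fst x) (snd x)) = (i, z)"
        by (rule some_equality) (auto simp: push_inject)
      then show ?thesis by (simp add: g_def)
    qed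
    have rep: "\<exists>i z. snd x = push t i z" if "x \<in> tracked_words n \<tau> (raise t s)" for x
    proof -
      have "shape_of (snd x) = raise t s" using that by (auto simp: tracked_words_def)
      then show ?thesis by (rule shape_of_eq_raise) blast
    qed
    have "bij_betw g (tracked_words n \<tau> (raise t s)) ?B"
      unfolding bij_betw_def
    proof
      show "inj_on g (tracked_words n \<tau> (raise t s))"
      proof (rule inj_onI)
        fix x y assume *: "x \<in> tracked_words n \<tau> (raise t s)" "y \<in> tracked_words n \<tau> (raise t s)" "g x = g y"
        obtain i z j z' where "x = (fst x, push t i z)" "y = (fst y, push t j z')"
          using rep[OF *(1)] rep[OF *(2)] by (metis prod.collapse)
        then show "x = y" using *(3) g by (metis list.inject prod.inject)
      qed
      show "g ` tracked_words n \<tau> (raise t s) = ?B"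
      proof
        show "g ` tracked_words n \<tau> (raise t s) \<subseteq> ?B"
        proof
          fix u assume "u \<in> g ` tracked_words n \<tau> (raise t s)"
          then obtain x where x: "x \<in> tracked_words n \<tau> (raise t s)" "u = g x" by blast
          obtain i z where "x = (fst x, push t i z)" using rep[OF x(1)] by (metis prod.collapse)
          then show "u \<in> ?B" using x g by (metis (mono_tags, lifting) mem_Collect_eq)
        qed
        show "?B \<subseteq> g ` tracked_words n \<tau> (raise t s)"
        proof
          fix u assume "u \<in> ?B"
          then obtain i w z where "u = ((i, t) # w, z)" "(w, push t i z) \<in> tracked_words n \<tau> (raise t s)" by blast
          then show "u \<in> g ` tracked_words n \<tau> (raise t s)" using g by (metis image_eqI)
        qed
      qed
    qed
    then have "card ?B = card (tracked_words n \<tau> (raise t s))" "finite ?B"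
      using finite_tracked_words by (auto simp: bij_betw_same_card[symmetric] bij_betw_finite[symmetric])
    then show "of_nat (card ?B) = path_weight \<tau> (raise t s) * falling n ?p" "finite ?B"
      using Cons.IH[of "raise t s"] by (simp_all add: shape_size_raise)
  qed
  have "?A \<inter> ?B = {}"
  proof (rule equals0I)
    fix x assume x: "x \<in> ?A \<inter> ?B"
    then have "x \<in> ?A" by (rule IntD1)
    then obtain i w z where 1: "x = ((i, t) # w, push t i z)" "i \<notin> fst ` set w"
      by (elim imageE SigmaE) auto
    from x obtain i' w' z' where 2: "x = ((i', t) # w', z')" "tracked w' (push t i' z')"
      by (auto simp: tracked_words_def)
    show False using 1 2(1) tracked_push_mem[OF 2(2)] by simp
  qed
  then have "card (tracked_words n (t # \<tau>) s) = card ?A + card ?B"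
    unfolding tracked_words_Cons using A finB by (intro card_Un_disjoint) auto
  then have "of_nat (card (tracked_words n (t # \<tau>) s)) =
      ((if s \<in> range (raise t) then path_weight \<tau> (inv (raise t) s) else 0) + path_weight \<tau> (raise t s)) * falling n ?p"
    using A B by (simp add: distrib_right)
  also have "(if s \<in> range (raise t) then path_weight \<tau> (inv (raise t) s) else 0) + path_weight \<tau> (raise t s) = path_weight (t # \<tau>) s"
    by (simp add: path_weight_def adjacency_def)
  finally show ?case .
qed

text \<open>Every step of kind \<open>t\<close> changes the grading \<open>g\<close> by
  \<open>h t\<close>, upwards or downwards, so parity is preserved along a path. Counting all
  letters kills the odd moments; counting only \<open>First\<close> and \<open>Second\<close>
  removes the sign of the weights.\<close>

lemma path_weight_even:
  assumes g: "\<And>t s. g (raise t s) = g s + h t" "g vacuum = 0" and "path_weight \<tau> s \<noteq> 0"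
  shows "even (sum_list (map h \<tau>) + g s :: nat)"
  using assms(3)
proof (induction \<tau> arbitrary: s)
  case Nil
  then show ?case using g(2) by (simp add: path_weight_def unit_vec_def split: if_splits)
next
  case (Cons t \<tau>)
  have "path_weight (t # \<tau>) s = path_weight \<tau> (raise t s) + (if s \<in> range (raise t) then path_weight \<tau> (inv (raise t) s) else 0)"
    by (simp add: path_weight_def adjacency_def)
  then have "path_weight \<tau> (raise t s) \<noteq> 0 \<or> s \<in> range (raise t) \<and> path_weight \<tau> (inv (raise t) s) \<noteq> 0"
    using Cons.prems by (auto split: if_splits)
  then consider "path_weight \<tau> (raise t s) \<noteq> 0" | s' where "s = raise t s'" "path_weight \<tau> s' \<noteq> 0"
    by (metis f_inv_into_f)
  then show ?case
  proof cases
    case 1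
    then show ?thesis using Cons.IH[OF 1] by (auto simp: g(1))
  next
    case (2 s')
    then show ?thesis using Cons.IH[OF 2(2)] by (auto simp: g(1))
  qed
qed

section \<open>The central limit theorem for tensor products of free families\<close>

lemma UNIV_kind: "UNIV = {First, Second, Both}"
proof (rule UNIV_eq_I)
  show "t \<in> {First, Second, Both}" for t by (cases t) simp_all
qed

instance kind :: finite
  by standard (simp add: UNIV_kind)

section \<open>Powers of sums as sums over words\<close>

definition words :: "'x set \<Rightarrow> nat \<Rightarrow> 'x list set" where
  "words X m = {w. set w \<subseteq> X \<and> length w = m}"

lemma finite_words: "finite X \<Longrightarrow> finite (words X m)"
  unfolding words_def by (rule finite_lists_length_eq)

lemma sum_words_Suc:
  assumes "finite X"
  shows "(\<Sum>w\<in>words X (Suc m). g w) = (\<Sum>x\<in>X. \<Sum>w\<in>words X m. g (x # w))"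
proof -
  have "words X (Suc m) = (\<lambda>(x, w). x # w) ` (X \<times> words X m)"
    by (auto simp: words_def length_Suc_conv)
  moreover have "inj_on (\<lambda>(x, w). x # w) (X \<times> words X m)" by (auto simp: inj_on_def)
  ultimately show ?thesis
    by (simp add: sum.reindex case_prod_unfold sum.cartesian_product)
qed

lemma words_0 [simp]: "words X 0 = {[]}"
  by (auto simp: words_def)

lemma sum_power_words:
  fixes f :: "'x \<Rightarrow> 'a::semiring_1"
  assumes "finite X"
  shows "(\<Sum>x\<in>X. f x) ^ m = (\<Sum>w\<in>words X m. prod_list (map f w))"
proof (induction m)
  case (Suc m)
  show ?case
    by (simp add: Suc sum_words_Suc[OF assms] sum_product)
qed simp

lemma adjacency_power_words:
  fixes c :: "kind \<Rightarrow> complex"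
  shows "((\<lambda>f s. \<Sum>t\<in>UNIV. c t * adjacency (raise t) f s) ^^ m) (unit_vec vacuum) =
    (\<lambda>s. \<Sum>\<tau>\<in>words UNIV m. prod_list (map c \<tau>) * path_weight \<tau> s)"
proof (induction m)
  case 0
  show ?case by (simp add: path_weight_def)
next
  case (Suc m)
  have "adjacency (raise t) (\<lambda>s. \<Sum>\<tau>\<in>words UNIV m. prod_list (map c \<tau>) * path_weight \<tau> s) =
    (\<lambda>s. \<Sum>\<tau>\<in>words UNIV m. prod_list (map c \<tau>) * path_weight (t # \<tau>) s)" for t
    by (simp add: lin_op_sum[OF lin_op_adjacency] path_weight_def)
  then show ?case
    by (simp add: Suc sum_words_Suc sum_distrib_left mult.assoc)
qed

lemma scaleC_power: "(c *\<^sub>C (x :: 'a::complex_algebra_1)) ^ m = c ^ m *\<^sub>C x ^ m"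
  by (induction m) (simp_all add: scaleC_one mult_scaleC_left mult_scaleC_right scaleC_scaleC mult.commute[of c])

text \<open>A word with at most \<open>d\<close> indices is a pattern over \<open>d\<close> symbols
  together with a map from the symbols to \<open>{1..n}\<close>; the number of patterns does not
  depend on \<open>n\<close>.\<close>

lemma few_indices_card:
  "card {w \<in> words ({1..n} \<times> (UNIV :: kind set)) m. w \<noteq> [] \<and> card (fst ` set w) \<le> d}
    \<le> card (words ({..<d} \<times> (UNIV :: kind set)) m) * n ^ d"
proof -
  let ?W = "{w \<in> words ({1..n} \<times> (UNIV :: kind set)) m. w \<noteq> [] \<and> card (fst ` set w) \<le> d}"
  let ?F = "({..<d} \<rightarrow>\<^sub>E {1..n}) \<times> words ({..<d} \<times> (UNIV :: kind set)) m"
  let ?h = "\<lambda>(f, v). map (map_prod f id) v"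
  have "?W \<subseteq> ?h ` ?F"
  proof
    fix w assume "w \<in> ?W"
    then have w: "fst ` set w \<subseteq> {1..n}" "length w = m" "w \<noteq> []" "card (fst ` set w) \<le> card {..<d}"
      by (auto simp: words_def)
    then obtain g where g: "inj_on g (fst ` set w)" "g ` fst ` set w \<subseteq> {..<d}"
      using inj_on_iff_card_le[of "fst ` set w" "{..<d}"] by auto
    obtain i0 where i0: "i0 \<in> {1..n}" using w(1,3) by (cases w) auto
    define f where "f = (\<lambda>k\<in>{..<d}. if k \<in> g ` fst ` set w then inv_into (fst ` set w) g k else i0)"
    have "f \<in> {..<d} \<rightarrow>\<^sub>E {1..n}"
      unfolding f_def restrict_PiE_iff
    proof
      fix k
      show "(if k \<in> g ` fst ` set w then inv_into (fst ` set w) g k else i0) \<in> {1..n}"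
        using i0 w(1) inv_into_into[of k g "fst ` set w"] by (cases "k \<in> g ` fst ` set w") (simp_all only: if_True if_False, blast)
    qed
    moreover have "map (map_prod g id) w \<in> words ({..<d} \<times> UNIV) m"
      using g(2) w(2) by (force simp: words_def)
    moreover have "map (map_prod f id) (map (map_prod g id) w) = w"
    proof -
      have fg: "f (g i) = i" if "i \<in> fst ` set w" for i
        using that g(2) inv_into_f_f[OF g(1) that] unfolding f_def by force
      have "map (map_prod f id \<circ> map_prod g id) w = w"
      proof (rule map_idI)
        fix x assume "x \<in> set w"
        then have "f (g (fst x)) = fst x" by (intro fg) simp
        then show "(map_prod f id \<circ> map_prod g id) x = x" by (cases x) simp
      qed
      then show ?thesis by simp
    qed
    ultimately show "w \<in> ?h ` ?F" by (intro image_eqI[of _ _ "(f, map (map_prod g id) w)"]) auto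
  qed
  moreover have fin: "finite ?F" by (intro finite_cartesian_product finite_PiE finite_words) auto
  ultimately have "card ?W \<le> card (?h ` ?F)" by (intro card_mono finite_imageI)
  also have "\<dots> \<le> card ?F" by (rule card_image_le[OF fin])
  also have "\<dots> = card (words ({..<d} \<times> (UNIV :: kind set)) m) * n ^ d"
    by (simp add: card_cartesian_product card_PiE)
  finally show ?thesis .
qed

section \<open>Values of words in the summands and the moment limit\<close>

locale free_tensor_families =
  fixes \<phi> :: "'a::complex_algebra_1 \<Rightarrow> complex" and a b :: "nat \<Rightarrow> 'a" and lam \<sigma> :: real
  assumes lin: "clinear \<phi>" and one: "\<phi> 1 = 1"
    and free_a: "freely_independent \<phi> {1..} a" and free_b: "freely_independent \<phi> {1..} b"
    and same_a: "\<And>i j m. i \<ge> 1 \<Longrightarrow> j \<ge> 1 \<Longrightarrow> \<phi> (a i ^ m) = \<phi> (a j ^ m)"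
    and same_b: "\<And>i j m. i \<ge> 1 \<Longrightarrow> j \<ge> 1 \<Longrightarrow> \<phi> (b i ^ m) = \<phi> (b j ^ m)"
    and mean: "\<And>i. i \<ge> 1 \<Longrightarrow> \<phi> (a i) = of_real lam" "\<And>i. i \<ge> 1 \<Longrightarrow> \<phi> (b i) = of_real lam"
    and var_a: "\<And>i. i \<ge> 1 \<Longrightarrow> \<phi> (a i ^ 2) = of_real (\<sigma>\<^sup>2) + (of_real lam)\<^sup>2"
    and var_b: "\<And>i. i \<ge> 1 \<Longrightarrow> \<phi> (b i ^ 2) = of_real (\<sigma>\<^sup>2) + (of_real lam)\<^sup>2"
begin

definition scalar :: "kind \<Rightarrow> real" where
  "scalar t = (if t = Both then 1 else lam)"

text \<open>The three terms of \<open>a \<otimes> b - \<lambda> 1 \<otimes> \<lambda> 1\<close> in the centred variables \<open>a - \<lambda> 1\<close> and \<open>b - \<lambda> 1\<close>.\<close>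

definition summand :: "nat \<times> kind \<Rightarrow> ('a, 'a) tensor" where
  "summand x = of_real (scalar (snd x)) *\<^sub>C
     ((if snd x = Second then 1 else a (fst x) - of_real lam *\<^sub>C 1) \<otimes>\<^sub>t
      (if snd x = First then 1 else b (fst x) - of_real lam *\<^sub>C 1))"

text \<open>The product state factorises over the legs, so no joint moment of the two families
  occurs.\<close>

definition word_value :: "(nat \<times> kind) list \<Rightarrow> complex" where
  "word_value w = of_real (prod_list (map (scalar \<circ> snd) w)) *
     (\<phi> (centred_word (of_real lam) a (first_indices w)) * \<phi> (centred_word (of_real lam) b (second_indices w)))"

lemma sum_summand:
  "a k \<otimes>\<^sub>t b k - (of_real lam *\<^sub>C 1) \<otimes>\<^sub>t (of_real lam *\<^sub>C 1) = (\<Sum>t\<in>UNIV. summand (k, t))"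
proof -
  let ?l = "of_real lam *\<^sub>C (1::'a)"
  let ?p = "a k - ?l" and ?r = "b k - ?l"
  have "a k \<otimes>\<^sub>t b k = (?p + ?l) \<otimes>\<^sub>t (?r + ?l)" by simp
  also have "\<dots> = ?p \<otimes>\<^sub>t ?r + ?p \<otimes>\<^sub>t ?l + (?l \<otimes>\<^sub>t ?r + ?l \<otimes>\<^sub>t ?l)"
    by (simp only: cbilinear_simps(1,2)[OF cbilinear_tensor]) (simp add: algebra_simps)
  also have "?p \<otimes>\<^sub>t ?l = of_real lam *\<^sub>C (?p \<otimes>\<^sub>t 1)"
    by (rule cbilinear_simps(4)[OF cbilinear_tensor])
  also have "?l \<otimes>\<^sub>t ?r = of_real lam *\<^sub>C (1 \<otimes>\<^sub>t ?r)"
    by (rule cbilinear_simps(3)[OF cbilinear_tensor])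
  finally show ?thesis
    by (simp add: UNIV_kind summand_def scalar_def scaleC_one algebra_simps)
qed

lemma functional_summand_word: "tensor_functional \<phi> \<phi> (prod_list (map summand w)) = word_value w"
proof -
  have "prod_list (map summand w) = of_real (prod_list (map (scalar \<circ> snd) w)) *\<^sub>C
     (centred_word (of_real lam) a (first_indices w) \<otimes>\<^sub>t centred_word (of_real lam) b (second_indices w))"
  proof (induction w)
    case Nil
    show ?case by (simp add: one_tensor_eq scaleC_one)
  next
    case (Cons x w)
    obtain i t where "x = (i, t)" by (cases x)
    then show ?case
      unfolding list.map prod_list.Cons Cons.IH
      by (simp add: summand_def mult_scaleC_left mult_scaleC_right scaleC_scaleC tensor_mult mult.commute)
  qed
  then show ?thesis
    by (simp add: word_value_def clinear_functional[OF clinear_tensor_functional] tensor_functional_tensor[OF lin lin])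
qed

lemma functional_sum_power:
  "tensor_functional \<phi> \<phi> ((\<Sum>k=1..n. a k \<otimes>\<^sub>t b k - (of_real lam *\<^sub>C 1) \<otimes>\<^sub>t (of_real lam *\<^sub>C 1)) ^ m)
     = (\<Sum>w\<in>words ({1..n} \<times> UNIV) m. word_value w)"
proof -
  have "(\<Sum>k=1..n. a k \<otimes>\<^sub>t b k - (of_real lam *\<^sub>C 1) \<otimes>\<^sub>t (of_real lam *\<^sub>C 1)) = (\<Sum>x\<in>{1..n} \<times> UNIV. summand x)"
    by (simp add: sum_summand sum.cartesian_product)
  then show ?thesis
    by (simp add: sum_power_words clinear_sum[OF clinear_tensor_functional] functional_summand_word)
qed

text \<open>Every letter enters at least one leg, and no index is more frequent in a leg than in the
  word, so the index is a singleton in some leg.\<close>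

lemma word_value_singleton:
  assumes w: "fst ` set w \<subseteq> {1..}" and i: "count_list (map fst w) i = 1"
  shows "word_value w = 0"
proof -
  have i1: "i \<ge> 1" using w i count_list_0_iff[of "map fst w" i] by auto
  have cnt: "count_list (first_indices w) i = 1 \<or> count_list (second_indices w) i = 1"
  proof -
    have "count_list (map fst w) i \<le> count_list (first_indices w) i + count_list (second_indices w) i"
      by (induction w) auto
    moreover have "count_list (first_indices w) i \<le> 1" "count_list (second_indices w) i \<le> 1"
      using count_indices[of w i] i by auto
    ultimately show ?thesis using i by linarith
  qed
  have "set (first_indices w) \<subseteq> {1..}" "set (second_indices w) \<subseteq> {1..}"
    using set_indices[of w] w by auto
  then have "\<phi> (centred_word (of_real lam) a (first_indices w)) = 0 \<or> \<phi> (centred_word (of_real lam) b (second_indices w)) = 0"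
    using cnt centred_word_singleton[OF lin one free_a _ _ mean(1)[OF i1]]
      centred_word_singleton[OF lin one free_b _ _ mean(2)[OF i1]] by blast
  then show ?thesis by (auto simp: word_value_def)
qed

text \<open>A closed pair yields the variance \<open>\<sigma>\<^sup>2\<close> in each leg it enters;
  each of its two letters is assigned one factor \<sigma> per leg, times its
  \<open>scalar\<close>.\<close>

definition weight :: "kind \<Rightarrow> real" where
  "weight t = (if t = Both then \<sigma>\<^sup>2 else lam * \<sigma>)"

lemma word_value_pair:
  assumes w: "fst ` set w \<subseteq> {1..}" and pair: "\<And>i. i \<in> fst ` set w \<Longrightarrow> count_list (map fst w) i = 2"
  shows "word_value w = (if tracked w (([], []), []) then of_real (prod_list (map weight (map snd w))) else 0)"
proof -
  have cnt: "count_list (map fst w) i \<le> 2" for i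
    using pair[of i] by (cases "i \<in> fst ` set w") (auto simp: count_list_0_iff[THEN iffD2])
  have A: "\<phi> (centred_word (of_real lam) a (first_indices w)) =
      (if stack_reduce (first_indices w) = [] then of_real \<sigma> ^ length (first_indices w) else 0)"
    by (rule centred_word_moment[OF lin one free_a])
      (use set_indices[of w] w order_trans[OF count_indices(1) cnt] mean var_a in auto)
  have B: "\<phi> (centred_word (of_real lam) b (second_indices w)) =
      (if stack_reduce (second_indices w) = [] then of_real \<sigma> ^ length (second_indices w) else 0)"
    by (rule centred_word_moment[OF lin one free_b])
      (use set_indices[of w] w order_trans[OF count_indices(2) cnt] mean var_b in auto)
  have prod: "prod_list (map (scalar \<circ> snd) w) * (\<sigma> ^ length (first_indices w) * \<sigma> ^ length (second_indices w))
      = prod_list (map weight (map snd w))"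
  proof (induction w)
    case (Cons x w)
    obtain i t where "x = (i, t)" by (cases x)
    then have "prod_list (map (scalar \<circ> snd) (x # w)) * (\<sigma> ^ length (first_indices (x # w)) * \<sigma> ^ length (second_indices (x # w)))
        = (scalar t * (if t = Second then 1 else \<sigma>) * (if t = First then 1 else \<sigma>)) *
          (prod_list (map (scalar \<circ> snd) w) * (\<sigma> ^ length (first_indices w) * \<sigma> ^ length (second_indices w)))"
      by (simp add: mult_ac)
    also have "scalar t * (if t = Second then 1 else \<sigma>) * (if t = First then 1 else \<sigma>) = weight t"
      by (cases t) (simp_all add: scalar_def weight_def power2_eq_square)
    finally show ?case using \<open>x = (i, t)\<close> by (simp only: Cons.IH) simp
  qed simp
  have "tracked w (([], []), []) \<longleftrightarrow> stack_reduce (first_indices w) = [] \<and> stack_reduce (second_indices w) = []"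
  proof
    assume "tracked w (([], []), [])"
    from tracked_reduce[OF this] show "stack_reduce (first_indices w) = [] \<and> stack_reduce (second_indices w) = []"
      by simp
  next
    assume "stack_reduce (first_indices w) = [] \<and> stack_reduce (second_indices w) = []"
    then show "tracked w (([], []), [])" using pair_word_tracked[OF pair] by blast
  qed
  then show ?thesis
    unfolding word_value_def A B prod[symmetric] by (simp del: map_map)
qed

lemma word_value_bounded:
  obtains K where "\<And>w. fst ` set w \<subseteq> {1..} \<Longrightarrow> length w = m \<Longrightarrow> norm (word_value w) \<le> K"
proof -
  obtain Ka where Ka: "\<And>v. set v \<subseteq> {1..} \<Longrightarrow> length v \<le> m \<Longrightarrow> norm (\<phi> (centred_word (of_real lam) a v)) \<le> Ka"
    using centred_word_bounded[OF lin one free_a same_a, of m "of_real lam"] by blast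
  obtain Kb where Kb: "\<And>v. set v \<subseteq> {1..} \<Longrightarrow> length v \<le> m \<Longrightarrow> norm (\<phi> (centred_word (of_real lam) b v)) \<le> Kb"
    using centred_word_bounded[OF lin one free_b same_b, of m "of_real lam"] by blast
  have "norm (word_value w) \<le> (1 + \<bar>lam\<bar>) ^ m * (Ka * Kb)" if w: "fst ` set w \<subseteq> {1..}" "length w = m" for w
  proof -
    have "\<bar>prod_list (map (scalar \<circ> snd) w)\<bar> \<le> (1 + \<bar>lam\<bar>) ^ length w"
    proof (induction w)
      case (Cons x w)
      have "\<bar>scalar (snd x)\<bar> \<le> 1 + \<bar>lam\<bar>" by (simp add: scalar_def)
      then show ?case using Cons by (simp add: abs_mult mult_mono)
    qed simp
    moreover have "set (first_indices w) \<subseteq> {1..}" "set (second_indices w) \<subseteq> {1..}"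
      using set_indices[of w] w by auto
    moreover have "length (first_indices w) \<le> m" "length (second_indices w) \<le> m"
      using w by (auto simp: first_indices_def second_indices_def)
    ultimately have "norm (\<phi> (centred_word (of_real lam) a (first_indices w))) \<le> Ka"
      "norm (\<phi> (centred_word (of_real lam) b (second_indices w))) \<le> Kb"
      "\<bar>prod_list (map (scalar \<circ> snd) w)\<bar> \<le> (1 + \<bar>lam\<bar>) ^ m"
      using w Ka Kb by auto
    then show ?thesis
      unfolding word_value_def norm_mult norm_of_real
      by (intro mult_mono mult_nonneg_nonneg) (auto intro: order_trans[OF norm_ge_zero])
  qed
  then show ?thesis using that by blast
qed

lemma sum_word_value_pair:
  "(\<Sum>w | w \<in> words ({1..n} \<times> UNIV) m \<and> (\<forall>i\<in>fst ` set w. count_list (map fst w) i = 2). word_value w) =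
   (\<Sum>\<tau>\<in>words UNIV m. of_real (prod_list (map weight \<tau>)) * path_weight \<tau> vacuum) * falling n (m div 2)"
proof -
  let ?W = "words ({1..n} \<times> (UNIV :: kind set)) m" and ?e = "(([], []), []) :: stacks"
  let ?P = "\<lambda>w. \<forall>i\<in>fst ` set w. count_list (map fst w) i = 2"
  have fin: "finite ?W" by (rule finite_words) simp
  have dom: "fst ` set w \<subseteq> {1..n}" if "w \<in> ?W" for w using that by (force simp: words_def)
  have tracked_pair: "?P w" if "tracked w ?e" for w
  proof
    fix i assume "i \<in> fst ` set w"
    then have "count_list (map fst w) i \<noteq> 0" by (simp add: count_list_0_iff)
    moreover have "count_list (map fst w) i \<noteq> 1" "count_list (map fst w) i \<le> 2"
      using tracked_open[OF that] by auto
    ultimately show "count_list (map fst w) i = 2" by linarith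
  qed
  have "(\<Sum>w | w \<in> ?W \<and> ?P w. word_value w) =
      (\<Sum>w | w \<in> ?W \<and> ?P w. if tracked w ?e then of_real (prod_list (map weight (map snd w))) else 0)"
    using dom by (intro sum.cong refl word_value_pair) force+
  also have "\<dots> = (\<Sum>w | w \<in> ?W \<and> tracked w ?e. of_real (prod_list (map weight (map snd w))))"
    using fin tracked_pair by (intro sum.mono_neutral_cong_right) auto
  \<comment> \<open>The value of a tracked word depends only on its kinds, so words are grouped by
    kinds and counted.\<close>
  also have "\<dots> = (\<Sum>\<tau>\<in>words UNIV m. \<Sum>w | w \<in> {w. w \<in> ?W \<and> tracked w ?e} \<and> map snd w = \<tau>.
      of_real (prod_list (map weight (map snd w))))"
  proof (rule sum.group[symmetric])
    show "finite {w. w \<in> ?W \<and> tracked w ?e}" using fin by simp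
    show "finite (words (UNIV :: kind set) m)" by (rule finite_words) simp
    show "map snd ` {w. w \<in> ?W \<and> tracked w ?e} \<subseteq> words UNIV m" by (auto simp: words_def)
  qed
  also have "\<dots> = (\<Sum>\<tau>\<in>words UNIV m. of_real (prod_list (map weight \<tau>)) * path_weight \<tau> vacuum * falling n (m div 2))"
  proof (rule sum.cong)
    fix \<tau> :: "kind list" assume \<tau>: "\<tau> \<in> words UNIV m"
    let ?V = "{w. w \<in> {w. w \<in> ?W \<and> tracked w ?e} \<and> map snd w = \<tau>}"
    have e: "shape_of z = vacuum \<longleftrightarrow> z = ?e" for z
      by (cases z rule: shape_of.cases) (auto simp: vacuum_def)
    have "tracked_words n \<tau> vacuum = (\<lambda>w. (w, ?e)) ` ?V"
    proof (rule set_eqI)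
      fix x :: "(nat \<times> kind) list \<times> stacks"
      obtain w z where x: "x = (w, z)" by (cases x)
      have W: "v \<in> ?W \<longleftrightarrow> fst ` set v \<subseteq> {1..n} \<and> length v = m" for v
        unfolding words_def by force
      have "map snd w = \<tau> \<Longrightarrow> length w = m" using \<tau> by (auto simp: words_def)
      then show "x \<in> tracked_words n \<tau> vacuum \<longleftrightarrow> x \<in> (\<lambda>w. (w, ?e)) ` ?V"
        unfolding x tracked_words_def mem_Collect_eq prod.case e W image_iff Bex_def prod.inject by blast
    qed
    then have "card (tracked_words n \<tau> vacuum) = card ?V"
      by (simp add: card_image inj_on_def)
    moreover have "shape_size vacuum = 0" by (simp add: vacuum_def)
    ultimately have "of_nat (card ?V) = path_weight \<tau> vacuum * falling n (m div 2)"
      using card_tracked_words[of n \<tau> vacuum] \<tau> by (simp add: words_def)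
    moreover have "(\<Sum>w\<in>?V. of_real (prod_list (map weight (map snd w))) :: complex) =
        of_nat (card ?V) * of_real (prod_list (map weight \<tau>))"
      by (subst sum.cong[OF refl, of _ _ "\<lambda>_. of_real (prod_list (map weight \<tau>))"]) auto
    ultimately show "(\<Sum>w\<in>?V. of_real (prod_list (map weight (map snd w)))) =
        of_real (prod_list (map weight \<tau>)) * path_weight \<tau> vacuum * falling n (m div 2)"
      by (simp add: mult_ac)
  qed simp
  finally show ?thesis by (simp add: sum_distrib_right)
qed

text \<open>A word without singletons that is not a pair word has an index occurring at least three
  times, hence fewer than \<open>m / 2\<close> indices. For \<open>m > 0\<close> there are
  \<open>O(n^d)\<close> such words with \<open>2 d + 1 \<le> m\<close>; the factor
  \<open>sqrt n\<close> expresses the gain of half a power of \<open>n\<close> without fractional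
  exponents.\<close>

lemma sum_word_value_remainder:
  obtains C where "\<And>n. n \<ge> 1 \<Longrightarrow>
    norm ((\<Sum>w\<in>words ({1..n} \<times> UNIV) m. word_value w) -
      (\<Sum>w | w \<in> words ({1..n} \<times> UNIV) m \<and> (\<forall>i\<in>fst ` set w. count_list (map fst w) i = 2). word_value w))
      * sqrt (real n) \<le> C * sqrt (real n) ^ m"
proof -
  obtain K where K: "\<And>w. fst ` set w \<subseteq> {1..} \<Longrightarrow> length w = m \<Longrightarrow> norm (word_value w) \<le> K"
    using word_value_bounded by blast
  \<comment> \<open>The largest integer below \<open>m / 2\<close>, and \<open>0\<close> for
    \<open>m = 0\<close>.\<close>
  define d where "d = (m - 1) div 2"
  define C where "C = card (words ({..<d} \<times> (UNIV :: kind set)) m)"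
  have "norm ((\<Sum>w\<in>words ({1..n} \<times> UNIV) m. word_value w) -
      (\<Sum>w | w \<in> words ({1..n} \<times> UNIV) m \<and> (\<forall>i\<in>fst ` set w. count_list (map fst w) i = 2). word_value w))
      * sqrt (real n) \<le> (real C * \<bar>K\<bar>) * sqrt (real n) ^ m" if n: "n \<ge> 1" for n
  proof -
    let ?W = "words ({1..n} \<times> (UNIV :: kind set)) m"
    let ?P = "\<lambda>w. \<forall>i\<in>fst ` set w. count_list (map fst w) i = 2"
    let ?R = "{w \<in> ?W. w \<noteq> [] \<and> card (fst ` set w) \<le> d}"
    have fin: "finite ?W" by (rule finite_words) simp
    have dom: "fst ` set w \<subseteq> {1..}" if "w \<in> ?W" for w using that by (force simp: words_def)
    let ?d = "(\<Sum>w\<in>?W. word_value w) - (\<Sum>w | w \<in> ?W \<and> ?P w. word_value w)"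
    have E1: "?d = (\<Sum>w\<in>?W - {w. w \<in> ?W \<and> ?P w}. word_value w)"
      using fin by (intro sum_diff[symmetric]) auto
    have E2: "(\<Sum>w\<in>?W - {w. w \<in> ?W \<and> ?P w}. word_value w) = (\<Sum>w\<in>?R - {w. ?P w}. word_value w)"
    proof (rule sum.mono_neutral_right)
      show "\<forall>w\<in>?W - {w. w \<in> ?W \<and> ?P w} - (?R - {w. ?P w}). word_value w = 0"
      proof
        fix w assume w: "w \<in> ?W - {w. w \<in> ?W \<and> ?P w} - (?R - {w. ?P w})"
        \<comment> \<open>The empty word is vacuously a pair word, so it cannot occur here.\<close>
        then have ne: "w \<noteq> []" and big: "d < card (fst ` set w)" and np: "\<not> ?P w" and wW: "w \<in> ?W" by auto
        have "\<exists>i\<in>set (map fst w). count_list (map fst w) i < 2"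
        proof (rule ccontr)
          assume "\<not> (\<exists>i\<in>set (map fst w). count_list (map fst w) i < 2)"
          then have ge: "\<forall>i\<in>set (map fst w). 2 \<le> count_list (map fst w) i" by (meson not_le)
          moreover have "\<exists>i\<in>set (map fst w). 2 < count_list (map fst w) i"
            using ge np by (auto simp: le_less)
          ultimately have "(\<Sum>i\<in>set (map fst w). 2) < (\<Sum>i\<in>set (map fst w). count_list (map fst w) i)"
            by (intro sum_strict_mono_ex1) auto
          also have "\<dots> = m" using wW sum_count_set[of "map fst w" "set (map fst w)"] by (simp add: words_def)
          finally have "2 * card (fst ` set w) < m" by simp
          then show False using big by (simp add: d_def)
        qed
        then obtain i where i: "i \<in> set (map fst w)" "count_list (map fst w) i < 2" by blast
        then have "count_list (map fst w) i = 1" using count_list_0_iff[of "map fst w" i] by linarith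
        then show "word_value w = 0" using word_value_singleton dom[OF wW] by blast
      qed
    qed (use fin in auto)
    have "norm ?d \<le> (\<Sum>w\<in>?R - {w. ?P w}. \<bar>K\<bar>)"
      unfolding E1 E2
    proof (rule sum_norm_le)
      fix w assume "w \<in> ?R - {w. ?P w}"
      then have "w \<in> ?W" by simp
      then show "norm (word_value w) \<le> \<bar>K\<bar>"
        using K[OF dom] by (force simp: words_def)
    qed
    also have "\<dots> \<le> real (card ?R) * \<bar>K\<bar>"
    proof -
      have "finite ?R" by (rule finite_subset[OF _ fin]) blast
      then have "card (?R - {w. ?P w}) \<le> card ?R" by (rule card_mono) (rule Diff_subset)
      then show ?thesis unfolding sum_constant by (intro mult_right_mono) auto
    qed
    also have "\<dots> \<le> (if m = 0 then 0 else real (C * n ^ d)) * \<bar>K\<bar>"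
    proof (rule mult_right_mono)
      show "real (card ?R) \<le> (if m = 0 then 0 else real (C * n ^ d))"
      proof (cases "m = 0")
        case True
        then have "?R = {}" by auto
        then show ?thesis using True by simp
      next
        case False
        have "card ?R \<le> C * n ^ d" unfolding C_def by (rule few_indices_card)
        then show ?thesis using False by (simp only: if_False of_nat_le_iff)
      qed
    qed simp
    finally have "norm ?d * sqrt (real n)
      \<le> (if m = 0 then 0 else real (C * n ^ d)) * \<bar>K\<bar> * sqrt (real n)"
      by (intro mult_right_mono) auto
    also have "\<dots> \<le> (real C * \<bar>K\<bar>) * sqrt (real n) ^ m"
    proof (cases "m = 0")
      case False
      have "real n ^ d = sqrt (real n) ^ (2 * d)" by (simp add: power_mult)
      then have "real n ^ d * sqrt (real n) = sqrt (real n) ^ (2 * d + 1)" by simp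
      also have "\<dots> \<le> sqrt (real n) ^ m"
        using n False by (intro power_increasing) (auto simp: d_def)
      finally have "real C * \<bar>K\<bar> * (real n ^ d * sqrt (real n)) \<le> real C * \<bar>K\<bar> * sqrt (real n) ^ m"
        by (intro mult_left_mono) auto
      then show ?thesis using False by (simp add: mult_ac)
    qed simp
    finally show ?thesis .
  qed
  then show ?thesis using that by blast
qed

lemma falling_tendsto:
  "(\<lambda>n. falling n p / of_nat n ^ p) \<longlonglongrightarrow> 1"
proof -
  have "(\<lambda>n. \<Prod>k<p. (of_nat n - of_nat k) / of_nat n :: complex) \<longlonglongrightarrow> (\<Prod>k<p. 1)"
  proof (rule tendsto_prod)
    fix k
    have "(\<lambda>n. 1 - of_nat k / of_nat n :: complex) \<longlonglongrightarrow> 1 - 0"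
      by (intro tendsto_diff tendsto_const lim_const_over_n)
    then have "(\<lambda>n. 1 - of_nat k / of_nat n :: complex) \<longlonglongrightarrow> 1" by simp
    then show "(\<lambda>n. (of_nat n - of_nat k) / of_nat n :: complex) \<longlonglongrightarrow> 1"
      by (rule Lim_transform_eventually)
        (use eventually_gt_at_top[of 0] in \<open>eventually_elim; simp add: diff_divide_distrib\<close>)
  qed
  then show ?thesis by (simp add: falling_def prod_dividef)
qed

text \<open>\<open>M\<close> is the contribution of the pair words. For even \<open>m\<close> its
  factor \<open>falling n (m div 2)\<close> grows like \<open>n^(m/2)\<close>; for odd
  \<open>m\<close> no path of length \<open>m\<close> returns to the vacuum and the limit is
  \<open>0\<close>.\<close>

theorem moment_limit:
  fixes \<delta> :: real
  assumes \<delta>: "\<delta> \<noteq> 0"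
  shows "(\<lambda>n. tensor_functional \<phi> \<phi> ((of_real (1 / (\<delta> * sqrt (real n))) *\<^sub>C
      (\<Sum>k=1..n. a k \<otimes>\<^sub>t b k - (of_real lam *\<^sub>C 1) \<otimes>\<^sub>t (of_real lam *\<^sub>C 1))) ^ m))
    \<longlonglongrightarrow> (\<Sum>\<tau>\<in>words UNIV m. of_real (prod_list (map weight \<tau>)) * path_weight \<tau> vacuum) / of_real \<delta> ^ m"
    (is "?L \<longlonglongrightarrow> ?G / _")
proof -
  define T where "T n = (\<Sum>w\<in>words ({1..n} \<times> (UNIV :: kind set)) m. word_value w)" for n
  have L: "?L n = T n / (of_real \<delta> ^ m * of_real (sqrt (real n)) ^ m)" for n
    unfolding scaleC_power clinear_functional(2)[OF clinear_tensor_functional] functional_sum_power T_def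
    by (simp add: power_divide power_mult_distrib)
  define M where "M n = ?G * falling n (m div 2)" for n
  have odd: "?G = 0" if "odd m"
  proof (rule sum.neutral, rule ballI)
    fix \<tau> :: "kind list" assume \<tau>: "\<tau> \<in> words UNIV m"
    have "path_weight \<tau> vacuum = 0"
    proof (rule ccontr)
      assume "path_weight \<tau> vacuum \<noteq> 0"
      then have "even (sum_list (map (\<lambda>_. 1) \<tau>) + shape_size vacuum :: nat)"
        by (intro path_weight_even) (auto simp: shape_size_raise vacuum_def)
      then show False using \<tau> that by (simp add: words_def vacuum_def sum_list_triv)
    qed
    then show "of_real (prod_list (map weight \<tau>)) * path_weight \<tau> vacuum = 0" by simp
  qed
  have "(\<lambda>n. M n / of_real (sqrt (real n)) ^ m) \<longlonglongrightarrow> ?G"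
  proof (cases "even m")
    case True
    then obtain p where p: "m = 2 * p" by blast
    have "(complex_of_real (sqrt (real n))) ^ m = of_nat n ^ p" for n
    proof -
      have "sqrt (real n) ^ m = real n ^ p" by (simp add: p power_mult)
      then show ?thesis by (metis of_real_of_nat_eq of_real_power)
    qed
    then have "M n / of_real (sqrt (real n)) ^ m = ?G * (falling n p / of_nat n ^ p)" for n
      by (simp add: M_def p)
    moreover have "(\<lambda>n. ?G * (falling n p / of_nat n ^ p)) \<longlonglongrightarrow> ?G * 1"
      by (intro tendsto_mult tendsto_const falling_tendsto)
    ultimately show ?thesis by simp
  next
    case False
    then show ?thesis unfolding M_def by (simp add: odd)
  qed
  moreover have "(\<lambda>n. (T n - M n) / of_real (sqrt (real n)) ^ m) \<longlonglongrightarrow> 0"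
  proof -
    obtain C where C: "\<And>n. n \<ge> 1 \<Longrightarrow> norm (T n - M n) * sqrt (real n) \<le> C * sqrt (real n) ^ m"
      using sum_word_value_remainder[of m] unfolding T_def M_def sum_word_value_pair by blast
    have bound: "eventually (\<lambda>n. norm ((T n - M n) / of_real (sqrt (real n)) ^ m) \<le> C * (1 / sqrt (real n))) sequentially"
      using eventually_ge_at_top[of 1]
    proof eventually_elim
      case (elim n)
      then have "sqrt (real n) > 0" by simp
      then show ?case using C[OF elim] by (simp add: norm_divide norm_power field_simps)
    qed
    have "(\<lambda>n. C * (1 / sqrt (real n))) \<longlonglongrightarrow> C * 0"
      by (intro tendsto_mult tendsto_const)
        (use tendsto_inverse_0_at_top[OF filterlim_compose[OF sqrt_at_top filterlim_real_sequentially]]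
          in \<open>simp add: divide_inverse\<close>)
    then have "(\<lambda>n. C * (1 / sqrt (real n))) \<longlonglongrightarrow> 0" by simp
    with bound show ?thesis by (rule Lim_null_comparison)
  qed
  ultimately have "(\<lambda>n. M n / of_real (sqrt (real n)) ^ m + (T n - M n) / of_real (sqrt (real n)) ^ m) \<longlonglongrightarrow> ?G + 0"
    by (rule tendsto_add)
  then have "(\<lambda>n. T n / of_real (sqrt (real n)) ^ m) \<longlonglongrightarrow> ?G"
    by (simp add: add_divide_distrib[symmetric])
  then have "(\<lambda>n. T n / of_real (sqrt (real n)) ^ m / of_real \<delta> ^ m) \<longlonglongrightarrow> ?G / of_real \<delta> ^ m"
    by (rule tendsto_divide) (use \<delta> in auto)
  then show ?thesis unfolding L by (simp add: mult.commute)
qed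

text \<open>The letters \<open>First\<close> and \<open>Second\<close> together occur an even number of times in a closed path, so the
  sign of \<open>lam * \<sigma>\<close> plays no role.\<close>

lemma weight_sum_eq_mu_q:
  assumes \<sigma>: "\<sigma>\<^sup>2 \<noteq> 0" and \<delta>: "\<delta> = sqrt (\<sigma>\<^sup>2 * (\<sigma>\<^sup>2 + 2 * lam\<^sup>2))" and q: "q = 2 * lam\<^sup>2 / (\<sigma>\<^sup>2 + 2 * lam\<^sup>2)"
  shows "(\<Sum>\<tau>\<in>words UNIV m. of_real (prod_list (map weight \<tau>)) * path_weight \<tau> vacuum) / of_real \<delta> ^ m
    = of_real (\<integral>x. x ^ m \<partial>mu_q q)"
proof -
  have pos: "\<sigma>\<^sup>2 > 0" "\<sigma>\<^sup>2 + 2 * lam\<^sup>2 > 0" using \<sigma> by (simp_all add: add_pos_nonneg)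
  have \<delta>2: "\<delta>\<^sup>2 = \<sigma>\<^sup>2 * (\<sigma>\<^sup>2 + 2 * lam\<^sup>2)" "\<delta> > 0" using pos by (simp_all add: \<delta>)
  have q01: "0 \<le> q" "q \<le> 1" using pos by (simp_all add: q)
  define c where "c t = (if t = Both then sqrt (1 - q) else sqrt q / sqrt 2)" for t
  \<comment> \<open>Comparing squares leaves only the sign of \<open>lam * \<sigma>\<close> to be
    dealt with.\<close>
  have c2: "c t ^ 2 = (weight t / \<delta>) ^ 2" for t
  proof -
    have "(\<sigma>\<^sup>2)\<^sup>2 / \<delta>\<^sup>2 = \<sigma>\<^sup>2 / (\<sigma>\<^sup>2 + 2 * lam\<^sup>2)"
      using pos unfolding \<delta>2 by (simp add: power2_eq_square)
    also have "\<dots> = 1 - q" using pos by (simp add: q field_simps)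
    finally have both: "(\<sigma>\<^sup>2 / \<delta>)\<^sup>2 = 1 - q" by (simp only: power_divide)
    have "(lam * \<sigma>)\<^sup>2 / \<delta>\<^sup>2 = lam\<^sup>2 / (\<sigma>\<^sup>2 + 2 * lam\<^sup>2)"
      using pos unfolding \<delta>2 by (simp add: power_mult_distrib)
    also have "\<dots> = q / 2"
    proof -
      define D where "D = \<sigma>\<^sup>2 + 2 * lam\<^sup>2"
      show ?thesis unfolding q D_def[symmetric] by simp
    qed
    finally have single: "(lam * \<sigma> / \<delta>)\<^sup>2 = q / 2" by (simp only: power_divide)
    have "(sqrt (1 - q))\<^sup>2 = 1 - q" "(sqrt q / sqrt 2)\<^sup>2 = q / 2"
      using q01 by (simp_all add: power_divide)
    then show ?thesis
      unfolding c_def weight_def by (cases "t = Both") (simp_all only: simp_thms if_True if_False both single)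
  qed
  have cB: "c Both = weight Both / \<delta>"
    using c2[of Both] \<delta>2(2) q01 by (simp add: power2_eq_iff_nonneg c_def weight_def)
  have cc: "\<bar>weight t / \<delta>\<bar> = c t" for t
    using c2[of t] q01 by (metis abs_of_nonneg c_def divide_nonneg_nonneg diff_ge_0_iff_ge power2_eq_iff_nonneg
        power2_abs abs_ge_zero real_sqrt_ge_zero zero_le_numeral)
  have c_sign: "prod_list (map (\<lambda>t. weight t / \<delta>) \<tau>) = prod_list (map c \<tau>)" if "path_weight \<tau> vacuum \<noteq> 0" for \<tau>
  proof -
    \<comment> \<open>\<open>h\<close> singles out the letters that carry the sign, and
      \<open>g\<close> counts these letters in a shape; \<open>C\<close> has grade
      \<open>0\<close>.\<close>
    define h :: "kind \<Rightarrow> nat" where "h t = (if t = Both then 0 else 1)" for t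
    define g :: "shape \<Rightarrow> nat" where "g s = fst (fst s) + snd (fst s) + sum_list (map (\<lambda>(a, b). a + b) (snd s))" for s
    have "even (sum_list (map h \<tau>) + g vacuum)"
    proof (rule path_weight_even[OF _ _ that])
      show "g (raise t s) = g s + h t" for t s
        by (cases t; cases s rule: shape_size.cases) (auto simp: g_def h_def)
    qed (simp add: g_def vacuum_def)
    then have ev: "even (sum_list (map h \<tau>))" by (simp add: g_def vacuum_def)
    define \<epsilon> :: real where "\<epsilon> = (if lam * \<sigma> < 0 then - 1 else 1)"
    have "weight t / \<delta> = \<epsilon> ^ h t * c t" for t
      using cc[of t] cB \<delta>2(2)
      by (cases t) (auto simp: \<epsilon>_def h_def weight_def abs_if divide_less_0_iff split: if_splits)
    then have "prod_list (map (\<lambda>t. weight t / \<delta>) \<tau>) = \<epsilon> ^ sum_list (map h \<tau>) * prod_list (map c \<tau>)"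
      by (induction \<tau>) (simp_all add: power_add)
    also have "\<epsilon> ^ sum_list (map h \<tau>) = 1" using ev by (auto simp: \<epsilon>_def)
    finally show ?thesis by simp
  qed
  have "(\<Sum>\<tau>\<in>words UNIV m. of_real (prod_list (map weight \<tau>)) * path_weight \<tau> vacuum) / of_real \<delta> ^ m
      = (\<Sum>\<tau>\<in>words UNIV m. prod_list (map (\<lambda>t. of_real (c t)) \<tau>) * path_weight \<tau> vacuum)"
    unfolding sum_divide_distrib
  proof (rule sum.cong)
    fix \<tau> :: "kind list" assume "\<tau> \<in> words UNIV m"
    then have m: "m = length \<tau>" by (simp add: words_def)
    have e: "of_real (prod_list (map weight \<tau>)) / of_real \<delta> ^ m = (of_real (prod_list (map (\<lambda>t. weight t / \<delta>) \<tau>)) :: complex)"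
    proof -
      have "prod_list (map (\<lambda>t. weight t / \<delta>) \<tau>) * \<delta> ^ length \<tau> = prod_list (map weight \<tau>)"
      proof (induction \<tau>)
        case (Cons t \<tau>)
        have "prod_list (map (\<lambda>t. weight t / \<delta>) (t # \<tau>)) * \<delta> ^ length (t # \<tau>) =
            weight t * (prod_list (map (\<lambda>t. weight t / \<delta>) \<tau>) * \<delta> ^ length \<tau>)"
          using \<delta>2(2) by simp
        then show ?case unfolding Cons by simp
      qed simp
      then have "prod_list (map weight \<tau>) / \<delta> ^ m = prod_list (map (\<lambda>t. weight t / \<delta>) \<tau>)"
        using \<delta>2(2) unfolding m by (simp add: divide_eq_eq)
      then show ?thesis by (metis of_real_divide of_real_power)
    qed
    have f: "prod_list (map (\<lambda>t. of_real (c t)) \<tau>) = (of_real (prod_list (map c \<tau>)) :: complex)"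
      by (induction \<tau>) auto
    show "of_real (prod_list (map weight \<tau>)) * path_weight \<tau> vacuum / of_real \<delta> ^ m
        = prod_list (map (\<lambda>t. of_real (c t)) \<tau>) * path_weight \<tau> vacuum"
    proof (cases "path_weight \<tau> vacuum = 0")
      case False
      then show ?thesis using e c_sign[OF False] f by (simp flip: times_divide_eq_left)
    qed simp
  qed simp
  also have "\<dots> = ((\<lambda>f s. \<Sum>t\<in>UNIV. of_real (c t) * adjacency (raise t) f s) ^^ m) (unit_vec vacuum) vacuum"
    by (simp add: adjacency_power_words)
  also have "(\<lambda>f s. \<Sum>t\<in>UNIV. of_real (c t) * adjacency (raise t) f s) =
      (\<lambda>f s. model_op (sqrt q / sqrt 2) (sqrt (1 - q)) False f s + model_op (sqrt q / sqrt 2) (sqrt (1 - q)) True f s)"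
    by (simp add: fun_eq_iff UNIV_kind c_def model_op_def algebra_simps)
  finally show ?thesis by (simp only: mu_q_moment[OF q01])
qed

end

theorem theorem5p1:
  fixes \<phi> :: "'a::unital_cstar_algebra \<Rightarrow> complex"
    and a b :: 'a
    and aseq bseq :: "nat \<Rightarrow> 'a"
    and lam \<sigma> \<delta> q :: real
    and S :: "nat \<Rightarrow> ('a, 'a) tensor"
  assumes state: "state \<phi>"
    and mean: "\<phi> a = of_real lam" "\<phi> b = of_real lam"
    and variance: "var \<phi> a = of_real (\<sigma>\<^sup>2)" "var \<phi> b = of_real (\<sigma>\<^sup>2)" "\<sigma>\<^sup>2 \<noteq> 0"
    and delta: "\<delta> = sqrt (\<sigma>\<^sup>2 * (\<sigma>\<^sup>2 + 2 * lam\<^sup>2))"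
    and q: "q = 2 * lam\<^sup>2 / (\<sigma>\<^sup>2 + 2 * lam\<^sup>2)"
    and free_a: "freely_independent \<phi> {1..} aseq"
    and copies_a: "\<forall>k\<ge>1. same_distribution \<phi> (aseq k) a"
    and free_b: "freely_independent \<phi> {1..} bseq"
    and copies_b: "\<forall>k\<ge>1. same_distribution \<phi> (bseq k) b"
    and S: "\<forall>n\<ge>1. S n = of_real (1 / (\<delta> * sqrt (real n))) *\<^sub>C
              (\<Sum>k=1..n. aseq k \<otimes>\<^sub>t bseq k - (of_real lam *\<^sub>C 1) \<otimes>\<^sub>t (of_real lam *\<^sub>C 1))"
  shows "var (tensor_functional \<phi> \<phi>) (a \<otimes>\<^sub>t a) = of_real (\<delta>\<^sup>2)
    \<and> var (tensor_functional \<phi> \<phi>) (b \<otimes>\<^sub>t b) = of_real (\<delta>\<^sup>2)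
    \<and> \<delta>\<^sup>2 = \<sigma>\<^sup>2 * (\<sigma>\<^sup>2 + 2 * lam\<^sup>2)
    \<and> q \<in> {0..<1}
    \<and> (\<forall>m::nat. (\<lambda>n. tensor_functional \<phi> \<phi> (S n ^ m))
          \<longlonglongrightarrow> of_real (\<integral>x. x ^ m \<partial>mu_q q))"
proof (intro conjI allI)
  have lin: "clinear \<phi>" and one: "\<phi> 1 = 1" using state by (simp_all add: state_def)
  have pos: "\<sigma>\<^sup>2 > 0" "\<sigma>\<^sup>2 + 2 * lam\<^sup>2 > 0" using variance(3) by (simp_all add: add_pos_nonneg)
  show \<delta>2: "\<delta>\<^sup>2 = \<sigma>\<^sup>2 * (\<sigma>\<^sup>2 + 2 * lam\<^sup>2)" using pos by (simp add: delta)
  have "\<delta> \<noteq> 0" using pos by (simp add: delta)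
  show "q \<in> {0..<1}" using pos by (simp add: q)
  have second: "\<phi> (a\<^sup>2) = of_real (\<sigma>\<^sup>2) + (of_real lam)\<^sup>2" "\<phi> (b\<^sup>2) = of_real (\<sigma>\<^sup>2) + (of_real lam)\<^sup>2"
    using variance(1,2) mean by (simp_all add: var_def algebra_simps)
  have var: "var (tensor_functional \<phi> \<phi>) (x \<otimes>\<^sub>t x) = of_real (\<delta>\<^sup>2)"
    if "\<phi> x = of_real lam" "\<phi> (x\<^sup>2) = of_real (\<sigma>\<^sup>2) + (of_real lam)\<^sup>2" for x
  proof -
    have "(x \<otimes>\<^sub>t x)\<^sup>2 = x\<^sup>2 \<otimes>\<^sub>t x\<^sup>2" by (simp add: power2_eq_square tensor_mult)
    then have "var (tensor_functional \<phi> \<phi>) (x \<otimes>\<^sub>t x) =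
        (of_real (\<sigma>\<^sup>2) + (of_real lam)\<^sup>2)\<^sup>2 - (of_real lam * of_real lam)\<^sup>2"
      by (simp add: var_def tensor_functional_tensor[OF lin lin] that) (simp add: power2_eq_square)
    also have "\<dots> = of_real (\<delta>\<^sup>2)"
      unfolding \<delta>2 by (simp add: power2_eq_square algebra_simps)
    finally show ?thesis .
  qed
  show "var (tensor_functional \<phi> \<phi>) (a \<otimes>\<^sub>t a) = of_real (\<delta>\<^sup>2)" "var (tensor_functional \<phi> \<phi>) (b \<otimes>\<^sub>t b) = of_real (\<delta>\<^sup>2)"
    using var mean second by blast+
  have moments: "\<phi> (aseq i ^ m) = \<phi> (a ^ m)" "\<phi> (bseq i ^ m) = \<phi> (b ^ m)" if "i \<ge> 1" for i m
    using copies_a copies_b that by (simp_all add: same_distribution_def)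
  interpret free_tensor_families \<phi> aseq bseq lam \<sigma>
    by unfold_locales
      (use lin one free_a free_b moments moments[of _ 1] mean second in \<open>simp_all\<close>)
  fix m
  have "(\<lambda>n. tensor_functional \<phi> \<phi> ((of_real (1 / (\<delta> * sqrt (real n))) *\<^sub>C
      (\<Sum>k=1..n. aseq k \<otimes>\<^sub>t bseq k - (of_real lam *\<^sub>C 1) \<otimes>\<^sub>t (of_real lam *\<^sub>C 1))) ^ m))
      \<longlonglongrightarrow> of_real (\<integral>x. x ^ m \<partial>mu_q q)"
    using moment_limit[OF \<open>\<delta> \<noteq> 0\<close>, of m] weight_sum_eq_mu_q[OF variance(3) delta q, of m] by simp
  \<comment> \<open>\<open>S\<close> is prescribed only from index \<open>1\<close> on, so the two
    sequences agree eventually.\<close>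
  then show "(\<lambda>n. tensor_functional \<phi> \<phi> (S n ^ m)) \<longlonglongrightarrow> of_real (\<integral>x. x ^ m \<partial>mu_q q)"
    by (rule Lim_transform_eventually)
      (rule eventually_mono[OF eventually_ge_at_top[of 1]], use S in simp)
qed

end
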